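(* Let $F(x,y)=ax^2+bxy+cy^2+ex+fy+g\in\mathbb{Z}[x,y]$ be a polynomial of degree $2$ which represents arbitrarily large (positive) integers, and assume that $\frac{\partial F}{\partial x},\frac{\partial F}{\partial y}$ are linearly independent. Let $\Delta=b^2-4ac$ and $D=af^2+ce^2-bfe+\Delta g$. 1. If $\Delta$ is a perfect square (possibly $0$), then $1\ll\delta_F(N)\ll1$ and $$N\ll\psi_F(N)\ll N.$$ 2. If $\Delta$ is not a perfect square and $D=0$, then $\frac{1}{\sqrt{\log N}}\ll\delta_F(N)\ll\frac{1}{\sqrt{\log N}}$ and $$N\ll\psi_F(N)\ll N.$$
   Context: An integer $n$ is represented by $F$ if $n=F(x_0,y_0)$ for some $x_0,y_0\in\mathbb{Z}$. For $N\ge 1$, $$\psi_F(N)=\log\left(\mathrm{LCM}\{F(x,y): x,y\in\mathbb{Z},\ 0<F(x,y)\le N\}\right),\qquad \delta_F(N)=\frac{\#\{0<n\le N: n=F(x,y)\text{ for some }x,y\in\mathbb{Z}\}}{N}.$$ Linear independence of the partial derivatives is as polynomials over $\mathbb{Q}$. The estimates are asymptotic, i.e. they hold for all sufficiently large $N$ (depending on $F$), with positive implied constants that may depend on $F$. *)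

theory Defs
  imports
    "HOL-Analysis.Analysis"
    "HOL-Computational_Algebra.Computational_Algebra"
    "HOL-Library.Landau_Symbols"
begin

section \<open>Polynomials in two variables\<close>

text \<open>
  A polynomial in \<open>x\<close> and \<open>y\<close> over \<open>R\<close> is an element of \<open>R[y][x]\<close>: the outer variable is \<open>x\<close>,
  the inner one is \<open>y\<close>, so the coefficient of \<open>x ^ i * y ^ j\<close> in \<open>P\<close> is \<open>coeff (coeff P i) j\<close>.
\<close>

type_synonym 'a bipoly = "'a poly poly"

definition varX :: "'a::comm_semiring_1 bipoly" where
  "varX = [:0, 1:]"

definition varY :: "'a::comm_semiring_1 bipoly" where
  "varY = [:[:0, 1:]:]"

definition eval2 :: "'a::comm_semiring_1 bipoly \<Rightarrow> 'a \<Rightarrow> 'a \<Rightarrow> 'a" where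
  "eval2 P x y = poly (poly P [:x:]) y"

text \<open>Total degree; it is \<open>0\<close> for the zero polynomial, as \<open>Sup {} = 0\<close> on the naturals.\<close>

definition total_deg :: "'a::zero bipoly \<Rightarrow> nat" where
  "total_deg P = Sup {i + j | i j. coeff (coeff P i) j \<noteq> 0}"

definition partial_x :: "int bipoly \<Rightarrow> int bipoly" where
  "partial_x P = pderiv P"

definition partial_y :: "int bipoly \<Rightarrow> int bipoly" where
  "partial_y P = map_poly pderiv P"

definition rat_bipoly :: "int bipoly \<Rightarrow> rat bipoly" where
  "rat_bipoly P = map_poly (map_poly of_int) P"

text \<open>
  Linear independence over the rationals of the pair \<open>(P, Q)\<close>, not of the set \<open>{P, Q}\<close>:
  a pair with \<open>P = Q\<close> is dependent.
\<close>

definition lin_indep_rat :: "int bipoly \<Rightarrow> int bipoly \<Rightarrow> bool" where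
  "lin_indep_rat P Q \<longleftrightarrow>
     (\<forall>s t :: rat. smult [:s:] (rat_bipoly P) + smult [:t:] (rat_bipoly Q) = 0 \<longrightarrow> s = 0 \<and> t = 0)"


section \<open>Represented integers\<close>

definition represented :: "int bipoly \<Rightarrow> int \<Rightarrow> bool" where
  "represented F n \<longleftrightarrow> (\<exists>x y. n = eval2 F x y)"

definition rep_upto :: "int bipoly \<Rightarrow> real \<Rightarrow> int set" where
  "rep_upto F N = {n. 0 < n \<and> real_of_int n \<le> N \<and> represented F n}"

definition psi_F :: "int bipoly \<Rightarrow> real \<Rightarrow> real" where
  "psi_F F N = ln (real_of_int (Lcm (rep_upto F N)))"

definition delta_F :: "int bipoly \<Rightarrow> real \<Rightarrow> real" where
  "delta_F F N = real (card (rep_upto F N)) / N"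


section \<open>Basic facts\<close>

lemma eval2_quadratic:
  fixes a b c e f g x y :: int
  shows "eval2 (of_int a * varX ^ 2 + of_int b * varX * varY + of_int c * varY ^ 2
           + of_int e * varX + of_int f * varY + of_int g) x y
         = a * x ^ 2 + b * x * y + c * y ^ 2 + e * x + f * y + g"
  by (simp add: eval2_def varX_def varY_def)

lemma finite_rep_upto: "finite (rep_upto F N)"
  by (rule finite_subset[of _ "{0..\<lfloor>N\<rfloor>}"]) (auto simp: rep_upto_def le_floor_iff)

end

theory Submission
  imports Defs "HOL-Number_Theory.Number_Theory"
begin

text \<open>
  If \<open>\<Delta>\<close> is a square, the quadratic part of \<open>F\<close> has a rational zero direction, and on a suitable
  integral line in this direction \<open>F\<close> is linear and not constant: its values contain an arithmetic
  progression.  The least common multiple of a progression \<open>u, u + m, \<dots>, u + n m\<close> with \<open>u, m\<close>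
  coprime is at least \<open>m ^ n\<close>, because \<open>u (u + m) \<cdots> (u + n m)\<close> divides it times \<open>n!\<close>.

  If \<open>\<Delta>\<close> is not a square and \<open>D = 0\<close>, then \<open>-4a\<Delta>F(x, y) = W\<^sup>2 - \<Delta>Z\<^sup>2\<close> for linear
  \<open>W, Z\<close>.  Hence a represented \<open>n > 0\<close> has even valuation at every prime with character value
  \<open>-1\<close>.  Conversely let \<open>n\<close> have only primes with character value \<open>1\<close>; by Thue's lemma a
  bounded multiple of \<open>n\<close> is a norm from \<open>\<int>[\<surd>\<Delta>]\<close>, and after multiplication by one of finitely many
  elements it is the norm of an element congruent to \<open>1\<close> modulo \<open>2a\<Delta>\<close>, which acts on the values of
  \<open>F\<close>.  So a bounded multiple of each such \<open>n\<close> is represented, and it remains to count these \<open>n\<close>.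
  Comparing the square of the series \<open>\<Sum> 1/n\<close> over them with \<open>\<Sum> (1 * chi)(n)/n\<close>, where \<open>L(1, chi) > 0\<close>,
  gives the order \<open>sqrt (ln x)\<close> for its partial sums, and
  \<open>\<Sum> ln n = \<Sum> \<theta>(x/n)\<close> over such \<open>n\<close> converts this into the order \<open>x / sqrt (ln x)\<close> for their number.
\<close>

section \<open>Chebyshev and Mertens estimates\<close>

text \<open>Only orders of magnitude are claimed, so neither the prime number theorem nor a density
  theorem for primes in progressions enters: Mertens sums suffice. Positivity of L(1, chi) keeps the
  sums of chi(d) Lam(d)/d bounded; hence a window (x/A, x] with A large carries many primes with chi
  p = 1, and \<open>theta\<close> has order x. This also explains why \<open>psi_F\<close> has order
  N although the represented integers have density 0 when \<Delta> is not a square: a bounded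
  multiple of every split u <= N/K is represented, so the least common multiple of the values is
  divisible by that of all these u, and the primes among them already contribute a multiple of N.

  Deciding which split n are themselves represented would involve classes and genera of forms, and F
  is moreover inhomogeneous with \<Delta> not necessarily fundamental. Allowing a bounded multiplier
  costs only constants and removes the question. The congruence to 1 modulo 2a\<Delta> is there
  because (W, Z) comes from integers (x, y) only in certain residue classes, which such a multiplier
  preserves.\<close>

abbreviation Lam :: "nat \<Rightarrow> real" where "Lam \<equiv> mangoldt"

definition psi :: "nat \<Rightarrow> real" where
  "psi n = (\<Sum>d=1..n. Lam d)"

text \<open>Substituting m = d k turns the summatory function of a Dirichlet convolution into a
  double sum under the hyperbola. The convolution identities for \<open>Lam\<close>,
  \<open>chi\<close> and \<open>r\<close> are all used through this step.\<close>

lemma divisor_sum_swap: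
  fixes g :: "nat \<Rightarrow> nat \<Rightarrow> 'a::comm_monoid_add"
  shows "(\<Sum>m=1..n. \<Sum>d | d dvd m. g d (m div d)) = (\<Sum>d=1..n. \<Sum>k=1..n div d. g d k)"
proof -
  have "(\<Sum>m=1..n. \<Sum>d | d dvd m. g d (m div d))
      = (\<Sum>(m,d)\<in>(SIGMA m:{1..n}. {d. d dvd m}). g d (m div d))"
    by (subst sum.Sigma) auto
  also have "\<dots> = (\<Sum>(d,k)\<in>(SIGMA d:{1..n}. {1..n div d}). g d k)"
  proof (rule sum.reindex_bij_witness[where i = "\<lambda>(d,k). (d*k, d)" and j = "\<lambda>(m,d). (d, m div d)"], goal_cases)
    case (2 a)
    then obtain m d where a: "a = (m,d)" "1 \<le> m" "m \<le> n" "d dvd m" by auto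
    then obtain k where k: "m = d * k" by (auto elim: dvdE)
    with a have "d > 0" "k > 0" by (auto intro!: Nat.gr0I)
    with a k show ?case
      by (auto simp: less_eq_div_iff_mult_less_eq mult.commute intro: order.trans[OF _ \<open>m \<le> n\<close>])
  next
    case (4 b)
    then show ?case
      by (auto simp: less_eq_div_iff_mult_less_eq mult.commute)
  qed auto
  also have "\<dots> = (\<Sum>d=1..n. \<Sum>k=1..n div d. g d k)"
    by (subst sum.Sigma) auto
  finally show ?thesis .
qed

lemma divisor_sum_swap':
  fixes g :: "nat \<Rightarrow> nat \<Rightarrow> 'a::comm_monoid_add"
  shows "(\<Sum>d=1..n. \<Sum>k=1..n div d. g d k) = (\<Sum>k=1..n. \<Sum>d=1..n div k. g d k)"
proof -
  have "(\<Sum>d=1..n. \<Sum>k=1..n div d. g d k)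
      = (\<Sum>(d,k)\<in>(SIGMA d:{1..n}. {1..n div d}). g d k)"
    by (subst sum.Sigma) auto
  also have "\<dots> = (\<Sum>(k,d)\<in>(SIGMA k:{1..n}. {1..n div k}). g d k)"
  proof (rule sum.reindex_bij_witness[where i = "\<lambda>(d,k). (k, d)" and j = "\<lambda>(d,k). (k, d)"])
    fix a assume "a \<in> (SIGMA d:{1..n}. {1..n div d})"
    then obtain d k where a: "a = (d,k)" "0 < d" "0 < k" "d * k \<le> n"
      by (auto simp: less_eq_div_iff_mult_less_eq mult.commute Suc_le_eq)
    moreover have "k \<le> d * k" using a by simp
    hence "k \<le> n" using a(4) by (rule order.trans)
    moreover have "d \<le> d * k" using a by simp
    hence "d \<le> n" using a(4) by (rule order.trans)
    ultimately show "(\<lambda>(d,k). (k, d)) a \<in> (SIGMA k:{1..n}. {1..n div k})"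
      by (auto simp: less_eq_div_iff_mult_less_eq mult.commute Suc_le_eq)
  next
    fix a assume "a \<in> (SIGMA d:{1..n}. {1..n div d})"
    then obtain d k where a: "a = (d,k)" "0 < d" "0 < k" "d * k \<le> n"
      by (auto simp: less_eq_div_iff_mult_less_eq mult.commute Suc_le_eq)
    moreover have "k \<le> d * k" using a by simp
    hence "k \<le> n" using a(4) by (rule order.trans)
    moreover have "d \<le> d * k" using a by simp
    hence "d \<le> n" using a(4) by (rule order.trans)
    ultimately show "(\<lambda>(d,k). (k, d)) a \<in> (SIGMA k:{1..n}. {1..n div k})"
      by (auto simp: less_eq_div_iff_mult_less_eq mult.commute Suc_le_eq)
  qed auto
  also have "\<dots> = (\<Sum>k=1..n. \<Sum>d=1..n div k. g d k)"
    by (subst sum.Sigma) auto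
  finally show ?thesis .
qed

lemma ln_fact_eq: "ln (fact n :: real) = (\<Sum>m=1..n. ln (real m))"
  by (induction n) (auto simp: ln_mult add.commute)

lemma ln_fact_mangoldt: "ln (fact n :: real) = (\<Sum>d=1..n. Lam d * real (n div d))"
proof -
  have "ln (fact n :: real) = (\<Sum>m=1..n. \<Sum>d | d dvd m. Lam d)"
    unfolding ln_fact_eq by (intro sum.cong refl) (auto simp: mangoldt_sum)
  also have "\<dots> = (\<Sum>d=1..n. \<Sum>k=1..n div d. Lam d)"
    by (rule divisor_sum_swap)
  also have "\<dots> = (\<Sum>d=1..n. Lam d * real (n div d))"
    by (simp add: mult.commute)
  finally show ?thesis .
qed

text \<open>Chebyshev's argument: \<open>2*m div d - 2 * (m div d)\<close> is 1 for m < d <= 2m and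
  never negative, and its sum against \<open>Lam\<close> is the logarithm of the central binomial
  coefficient, at most 2m ln 2.\<close>

lemma psi_double: "psi (2*m) - psi m \<le> 2 * real m * ln 2"
proof -
  have "psi (2*m) = psi m + (\<Sum>d\<in>{m<..2*m}. Lam d)"
    unfolding psi_def by (subst sum.union_disjoint [symmetric]) (auto intro!: sum.cong)
  also have "(\<Sum>d\<in>{m<..2*m}. Lam d) \<le> (\<Sum>d=1..2*m. Lam d * (real (2*m div d) - 2 * real (m div d)))"
  proof (rule order.trans[OF _ sum_mono2])
    have 1: "2 * m div d = Suc 0" if "m < d" "d \<le> 2*m" for d
      using that by (intro div_nat_eqI) auto
    show "(\<Sum>d\<in>{m<..2*m}. Lam d) \<le> (\<Sum>d\<in>{m<..2*m}. Lam d * (real (2*m div d) - 2 * real (m div d)))"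
      by (intro sum_mono) (auto simp: 1)
    fix d
    have "2 * (m div d) \<le> 2 * m div d"
      by (metis div_mult1_eq le_add1)
    hence "2 * real (m div d) \<le> real (2*m div d)"
      by linarith
    thus "0 \<le> Lam d * (real (2*m div d) - 2 * real (m div d))"
      by (simp add: mangoldt_nonneg)
  qed auto
  also have "\<dots> = (\<Sum>d=1..2*m. Lam d * real (2*m div d)) - 2 * (\<Sum>d=1..2*m. Lam d * real (m div d))"
    by (simp add: algebra_simps sum_subtractf sum_distrib_left)
  also have "(\<Sum>d=1..2*m. Lam d * real (m div d)) = (\<Sum>d=1..m. Lam d * real (m div d))"
    by (rule sum.mono_neutral_right) auto
  also have "(\<Sum>d=1..2*m. Lam d * real (2*m div d)) - 2 * (\<Sum>d=1..m. Lam d * real (m div d))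
     = ln (fact (2*m)) - 2 * ln (fact m)"
    by (simp only: ln_fact_mangoldt)
  also have "\<dots> = ln (real ((2*m) choose m))"
    by (simp add: binomial_fact ln_div ln_mult)
  also have "\<dots> \<le> ln (2 ^ (2*m))"
  proof -
    have "(2*m) choose m \<le> 2 ^ (2*m)" by (rule binomial_le_pow2)
    hence "real ((2*m) choose m) \<le> 2 ^ (2*m)" by (metis of_nat_le_iff of_nat_numeral of_nat_power)
    thus ?thesis by (subst ln_le_cancel_iff) auto
  qed
  also have "\<dots> = 2 * real m * ln 2"
    by (simp add: ln_realpow)
  finally show ?thesis by simp
qed

lemma psi_Suc: "psi (Suc n) = psi n + Lam (Suc n)"
  by (simp add: psi_def)

text \<open>Halving n gives psi(2m) <= 4m + 2m ln 2 <= 6m; the slack up to 8m absorbs the extra term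
  ln n <= n when n = 2m + 1.\<close>

lemma psi_le: "psi n \<le> 4 * real n"
proof (induction n rule: less_induct)
  case (less n)
  show ?case
  proof (cases "n = 0")
    case False
    define m where "m = n div 2"
    have IH: "psi m \<le> 4 * real m" using less False by (auto simp: m_def)
    have ln2: "ln 2 \<le> (1::real)" using ln_le_minus_one[of "2::real"] by simp
    have "2 * real m * ln 2 \<le> 2 * real m * 1"
      by (intro mult_left_mono ln2) auto
    with psi_double[of m] IH have A: "psi (2*m) \<le> 6 * real m" by linarith
    have "n = 2*m \<or> n = Suc (2*m)" unfolding m_def by presburger
    then consider "n = 2*m" | "n = Suc (2*m)" by blast
    then show ?thesis
    proof cases
      case 1 with A show ?thesis by simp
    next
      case 2
      have "psi n \<le> psi (2*m) + ln (real n)"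
        using mangoldt_le[of n] 2 by (simp add: psi_Suc)
      also have "ln (real n) \<le> real n" using ln_le_minus_one[of "real n"] False by simp
      finally show ?thesis using A 2 by simp
    qed
  qed (auto simp: psi_def)
qed

text \<open>Appending n + 1 multiplies the least common multiple by at most p if n + 1 = p^k,
  because p^(k-1) is already present, and does not change it otherwise, because n + 1 is then a
  product of two coprime factors <= n. The factor is \<open>exp (Lam (Suc n))\<close> in both
  cases.\<close>

lemma ln_Lcm_le_psi: "ln (real (Lcm {1..n})) \<le> psi n"
proof (induction n)
  case 0 then show ?case by (simp add: psi_def)
next
  case (Suc n)
  define L where "L = Lcm {1..n}"
  have L: "L > 0" unfolding L_def by (auto intro!: Nat.gr0I simp: Lcm_0_iff)
  have eq: "Lcm {1..Suc n} = lcm (Suc n) L"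
    unfolding L_def by (simp add: atLeastAtMostSuc_conv)
  have "real (lcm (Suc n) L) \<le> exp (Lam (Suc n)) * real L"
  proof (cases "primepow (Suc n)")
    case True
    then obtain p k where pk: "prime p" "k > 0" "Suc n = p ^ k"
      by (auto simp: primepow_def)
    have "p ^ (k-1) < p ^ k" using pk prime_gt_1_nat by (intro power_strict_increasing) auto
    hence "p ^ (k - 1) \<in> {1..n}" using pk by (auto simp: Suc_le_eq prime_gt_0_nat)
    hence "p ^ (k-1) dvd L" unfolding L_def by (rule dvd_Lcm)
    hence "p * p ^ (k-1) dvd p * L" by simp
    also have "p * p ^ (k-1) = p ^ k" using pk by (cases k) auto
    finally have "lcm (Suc n) L dvd p * L" using pk by simp
    hence "lcm (Suc n) L \<le> p * L" using L pk by (intro dvd_imp_le) (auto simp: prime_gt_0_nat)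
    moreover have "exp (Lam (Suc n)) = real p"
      using pk by (simp add: prime_gt_0_nat)
    ultimately show ?thesis by (metis of_nat_le_iff of_nat_mult)
  next
    case False
    have "Suc n dvd L"
    proof (cases "n = 0")
      case False
      then obtain p where p: "prime p" "p dvd Suc n"
        using prime_factor_nat[of "Suc n"] by auto
      define k where "k = multiplicity p (Suc n)"
      have "\<not> p dvd 1" using p by (metis not_prime_unit)
      obtain m where m: "Suc n = p ^ k * m" "\<not> p dvd m"
        using multiplicity_decompose'[of "Suc n" p] p unfolding k_def by (metis nat.distinct(1) not_prime_unit)
      have k0: "k > 0" using m p by (cases k) auto
      have m1: "m \<noteq> 1" using \<open>\<not> primepow (Suc n)\<close> m p k0 by (metis mult_1_right primepow_def)
      have m0: "m > 0" using m by (auto intro!: Nat.gr0I)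
      have pk1: "p ^ k > 1" using p k0 by (metis prime_gt_1_nat one_less_power)
      have "m < p ^ k * m" using pk1 m0 by simp
      moreover have "p ^ k * 1 < p ^ k * m"
        using pk1 m0 m1 by (intro mult_strict_left_mono) linarith+
      hence "p ^ k < p ^ k * m" by (simp only: mult_1_right)
      ultimately have "m < Suc n" "p ^ k < Suc n" using m(1) by simp_all
      hence "m \<in> {1..n}" "p ^ k \<in> {1..n}" using m0 pk1 by simp_all
      hence "m dvd L" "p ^ k dvd L" unfolding L_def by (blast intro: dvd_Lcm)+
      moreover have "coprime (p^k) m" using p m by (simp add: prime_imp_coprime)
      ultimately show ?thesis using m divides_mult by metis
    qed auto
    hence "lcm (Suc n) L = L" by (simp add: lcm_proj2_if_dvd)
    thus ?thesis using L mangoldt_nonneg[of "Suc n"] by simp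
  qed
  hence "ln (real (lcm (Suc n) L)) \<le> ln (exp (Lam (Suc n)) * real L)"
    using L by (subst ln_le_cancel_iff) (auto intro!: Nat.gr0I simp: lcm_eq_0_iff)
  also have "\<dots> = Lam (Suc n) + ln (real L)" using L by (simp add: ln_mult)
  also have "\<dots> \<le> psi (Suc n)" using Suc by (simp add: psi_Suc L_def)
  finally show ?case by (simp only: eq)
qed

text \<open>A weak Stirling formula: the lower bound is n^n/n! <= e^n, a single term of the
  exponential series.\<close>

lemma ln_fact_bounds:
  "\<bar>ln (fact n :: real) - real n * ln (real n)\<bar> \<le> real n"
proof -
  have up: "ln (fact n :: real) \<le> real n * ln (real n)"
  proof (cases "n = 0")
    case False
    have "(fact n :: real) \<le> real n ^ n" by (metis fact_le_power of_nat_fact of_nat_le_iff of_nat_power le_refl)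
    hence "ln (fact n :: real) \<le> ln (real n ^ n)" using False by (subst ln_le_cancel_iff) auto
    thus ?thesis using False by (simp add: ln_realpow)
  qed auto
  have "real n * ln (real n) - real n \<le> ln (fact n)"
  proof (cases "n = 0")
    case False
    have "real n ^ n / fact n \<le> exp (real n)"
      using sum_le_suminf[of "\<lambda>k. real n ^ k / fact k" "{n}"] summable_exp[of "real n"]
      by (auto simp: exp_def scaleR_conv_of_real field_simps)
    hence "ln (real n ^ n / fact n) \<le> real n"
      using False by (metis ln_exp ln_le_cancel_iff divide_pos_pos exp_gt_zero fact_gt_zero of_nat_0_less_iff zero_less_power gr0I)
    thus ?thesis using False by (simp add: ln_div ln_realpow)
  qed auto
  with up show ?thesis by (auto simp: abs_le_iff)
qed

text \<open>In the formula for ln n!, replacing \<open>n div d\<close> by n/d costs at most psi n <=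
  4n, and Stirling costs n; dividing by n gives the constant 5.\<close>

lemma mertens:
  assumes "n \<ge> 1"
  shows "\<bar>(\<Sum>d=1..n. Lam d / real d) - ln (real n)\<bar> \<le> 5"
proof -
  have "real n * (\<Sum>d=1..n. Lam d / real d) - ln (fact n) = (\<Sum>d=1..n. Lam d * (real n / real d - real (n div d)))"
    unfolding ln_fact_mangoldt by (simp add: sum_distrib_left sum_subtractf algebra_simps)
  moreover have "(\<Sum>d=1..n. Lam d * (real n / real d - real (n div d))) \<ge> 0"
    by (intro sum_nonneg mult_nonneg_nonneg mangoldt_nonneg)
       (auto simp: of_nat_div_le_of_nat)
  moreover have "(\<Sum>d=1..n. Lam d * (real n / real d - real (n div d))) \<le> (\<Sum>d=1..n. Lam d * 1)"
  proof (intro sum_mono mult_left_mono mangoldt_nonneg)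
    fix d
    show "real n / real d - real (n div d) \<le> 1"
      using real_of_int_floor_gt_diff_one[of "real n / real d"]
      unfolding floor_divide_of_nat_eq of_int_of_nat_eq by linarith
  qed
  ultimately have "\<bar>real n * (\<Sum>d=1..n. Lam d / real d) - ln (fact n)\<bar> \<le> 4 * real n"
    using psi_le[of n] by (simp add: psi_def)
  with ln_fact_bounds[of n]
  have "\<bar>real n * (\<Sum>d=1..n. Lam d / real d) - real n * ln (real n)\<bar> \<le> 5 * real n"
    by linarith
  hence "\<bar>real n * ((\<Sum>d=1..n. Lam d / real d) - ln (real n))\<bar> \<le> real n * 5"
    by (simp add: algebra_simps)
  hence "real n * \<bar>(\<Sum>d=1..n. Lam d / real d) - ln (real n)\<bar> \<le> real n * 5"
    by (simp add: abs_mult)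
  thus ?thesis using assms by (simp add: mult_le_cancel_left)
qed

section \<open>Non-vanishing of \<open>L(1, chi)\<close>\<close>

text \<open>Summation by parts: the differences of the decreasing weights telescope, so only the
  first weight survives in the bound.\<close>

lemma abel_bound:
  fixes c w :: "nat \<Rightarrow> real"
  assumes c: "\<And>n. \<bar>\<Sum>k=m..n. c k\<bar> \<le> B"
    and w: "\<And>n. m \<le> n \<Longrightarrow> w (Suc n) \<le> w n" "\<And>n. m \<le> n \<Longrightarrow> 0 \<le> w n"
  shows "\<bar>\<Sum>k=m..n. c k * w k\<bar> \<le> B * w m"
proof (cases "m \<le> n")
  case True
  have "0 \<le> B" using c[of 0] by linarith
  define S where "S n = (\<Sum>k=m..n. c k)" for n
  have "(\<Sum>k=m..n. c k * w k) = S n * w n + (\<Sum>k=m..<n. S k * (w k - w (Suc k))) \<and>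
        (\<Sum>k=m..<n. w k - w (Suc k)) = w m - w n"
    using True
  proof (induction n rule: dec_induct)
    case base then show ?case by (simp add: S_def)
  next
    case (step n)
    then show ?case by (simp add: S_def algebra_simps)
  qed
  hence eq: "(\<Sum>k=m..n. c k * w k) = S n * w n + (\<Sum>k=m..<n. S k * (w k - w (Suc k)))"
    and eq2: "(\<Sum>k=m..<n. w k - w (Suc k)) = w m - w n" by auto
  have "\<bar>\<Sum>k=m..n. c k * w k\<bar> \<le> \<bar>S n * w n\<bar> + (\<Sum>k=m..<n. \<bar>S k * (w k - w (Suc k))\<bar>)"
    unfolding eq by (intro order.trans[OF abs_triangle_ineq] add_mono sum_abs order_refl)
  also have "\<dots> \<le> B * w n + (\<Sum>k=m..<n. B * (w k - w (Suc k)))"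
    unfolding abs_mult using True w c \<open>0 \<le> B\<close>
    by (intro add_mono sum_mono mult_mono) (auto simp: S_def)
  also have "\<dots> = B * w m"
    by (simp only: sum_distrib_left [symmetric] eq2) (simp add: algebra_simps)
  finally show ?thesis .
next
  case False
  have "0 \<le> B" using c[of 0] by linarith
  with False w(2)[of m] show ?thesis by auto
qed

text \<open>Pairing the exponents i and n - 1 - i, the arithmetic-geometric mean inequality bounds
  each pair below by twice the middle term y^(n-1).\<close>

lemma geometric_sum_ge:
  fixes y :: real
  assumes "0 < y" "y < 1"
  shows "real n * y ^ (n - 1) \<le> (\<Sum>i<n. (y\<^sup>2) ^ i)"
proof -
  have "2 * (real n * y ^ (n-1)) = (\<Sum>i<n. 2 * y ^ (n-1))" by simp
  also have "\<dots> \<le> (\<Sum>i<n. (y\<^sup>2) ^ i + (y\<^sup>2) ^ (n - Suc i))"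
  proof (intro sum_mono)
    fix i assume "i \<in> {..<n}"
    hence "y ^ (n-1) = y ^ i * y ^ (n - Suc i)" by (simp flip: power_add)
    moreover have "2 * (y ^ i * y ^ (n - Suc i)) \<le> (y ^ i)\<^sup>2 + (y ^ (n - Suc i))\<^sup>2"
      using sum_squares_bound[of "y^i" "y ^ (n - Suc i)"] by simp
    ultimately show "2 * y ^ (n-1) \<le> (y\<^sup>2) ^ i + (y\<^sup>2) ^ (n - Suc i)"
      by (simp flip: power_mult add: mult.commute)
  qed
  also have "\<dots> = 2 * (\<Sum>i<n. (y\<^sup>2) ^ i)"
    by (simp add: sum.distrib sum.nat_diff_reindex)
  finally show ?thesis by simp
qed

text \<open>
  Monsky's weights: with \<open>L(1, chi) = 0\<close> the main terms \<open>chi n / (n (1 - x))\<close> would cancel in the Lambert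
  series \<open>\<Sum> chi n * x ^ n / (1 - x ^ n)\<close>, and monotonicity would keep the series bounded as \<open>x\<close>
  tends to \<open>1\<close>, although it dominates \<open>\<Sum> x ^ k\<^sup>2\<close>.
\<close>

definition monsky :: "real \<Rightarrow> nat \<Rightarrow> real" where
  "monsky x n = 1 / (real n * (1 - x)) - x ^ n / (1 - x ^ n)"

text \<open>With 1 - x^n = (1 - x) Q n, monotonicity amounts to n (n + 1) x^n <= Q n * Q (n + 1).
  This follows from \<open>geometric_sum_ge\<close> for y = sqrt x, since the two lower bounds
  multiply to n (n + 1) y^(2n-1) and x^n = y^(2n).\<close>

lemma monsky_props:
  assumes x: "0 < x" "x < 1" and n: "n \<ge> 1"
  shows "monsky x (Suc n) \<le> monsky x n" "0 \<le> monsky x n"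
proof -
  define Q where "Q n = (\<Sum>i<n. x ^ i)" for n
  have Q: "1 - x ^ n = (1 - x) * Q n" for n
    unfolding Q_def by (rule one_diff_power_eq)
  define y where "y = sqrt x"
  have y: "0 < y" "y < 1" "x = y\<^sup>2" using x by (auto simp: y_def)
  have Qge: "real n * y ^ (n-1) \<le> Q n" for n
    unfolding Q_def y(3) using geometric_sum_ge y by auto
  have Qpos: "Q n > 0" if "n \<ge> 1" for n
    using Qge[of n] that y by (smt (verit) mult_pos_pos of_nat_0_less_iff zero_less_power less_le_trans One_nat_def Suc_le_eq)
  have Q1: "Q (Suc n) = Q n + x ^ n" by (simp add: Q_def)
  have "real n * x ^ n \<le> real n * y ^ (n-1)"
    using y by (intro mult_left_mono) (auto simp flip: power_mult intro!: power_decreasing)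
  hence A: "real n * x ^ n \<le> Q n" using Qge[of n] by linarith
  have "x ^ n / Q n \<le> 1 / real n"
    using A n Qpos[of n] by (simp add: field_simps)
  hence "x ^ n / Q n / (1 - x) \<le> 1 / real n / (1 - x)"
    using x by (intro divide_right_mono) auto
  hence "x ^ n / (1 - x ^ n) \<le> 1 / (real n * (1 - x))"
    unfolding Q by (simp add: mult.commute)
  thus "0 \<le> monsky x n" by (simp add: monsky_def)
  have "real n * real (Suc n) * x ^ n \<le> (real n * y ^ (n-1)) * (real (Suc n) * y ^ n)"
  proof -
    have "x ^ n \<le> y ^ (n-1) * y ^ n"
      using y by (auto simp flip: power_mult power_add intro!: power_decreasing)
    hence "real n * real (Suc n) * x ^ n \<le> real n * real (Suc n) * (y ^ (n-1) * y ^ n)"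
      by (intro mult_left_mono) auto
    thus ?thesis by (simp add: mult_ac)
  qed
  also have "\<dots> \<le> Q n * Q (Suc n)"
    using Qge[of n] Qge[of "Suc n"] y Qpos[of n] n by (intro mult_mono) auto
  finally have B: "real n * real (Suc n) * x ^ n \<le> Q n * Q (Suc n)" .
  have "x ^ n / (1 - x ^ n) - x ^ Suc n / (1 - x ^ Suc n) = x ^ n / ((1 - x) * (Q n * Q (Suc n)))"
  proof -
    have "x ^ n / (1 - x ^ n) - x ^ Suc n / (1 - x ^ Suc n) = (x ^ n * (Q (Suc n) - x * Q n)) / ((1-x) * (Q n * Q (Suc n)))"
    proof -
      have "p / (a * u) - x * p / (a * v) = (p * (v - x * u)) / (a * (u * v))"
        if "a \<noteq> 0" "u \<noteq> 0" "v \<noteq> 0" for a u v p :: real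
        using that by (simp add: field_simps)
      from this[of "1 - x" "Q n" "Q (Suc n)" "x ^ n"] show ?thesis
        unfolding Q unfolding power_Suc using x Qpos[of n] Qpos[of "Suc n"] n by simp
    qed
    also have "Q (Suc n) - x * Q n = 1"
      using Q[of n] unfolding Q1 by (simp add: algebra_simps)
    finally show ?thesis by simp
  qed
  also have "\<dots> \<le> 1 / ((1 - x) * (real n * real (Suc n)))"
    using B x n Qpos[of n] Qpos[of "Suc n"] by (simp add: divide_simps mult_ac)
  also have "\<dots> = 1 / (real n * (1 - x)) - 1 / (real (Suc n) * (1 - x))"
    using x n by (simp add: divide_simps)
  finally show "monsky x (Suc n) \<le> monsky x n"
    by (simp add: monsky_def)
qed

text \<open>The induction removes the full power of one prime at a time, so that the two factors are
  coprime and multiplicative functions can be evaluated on them.\<close>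

lemma prime_power_coprime_induct [consumes 1, case_names one step]:
  fixes n :: nat
  assumes "n > 0" and "P 1"
    and "\<And>p k m. prime p \<Longrightarrow> k > 0 \<Longrightarrow> \<not> p dvd m \<Longrightarrow> m > 0 \<Longrightarrow> P m \<Longrightarrow> P (p ^ k * m)"
  shows "P n"
  using assms(1)
proof (induction n rule: less_induct)
  case (less n)
  show ?case
  proof (cases "n = 1")
    case False
    then obtain p where p: "prime p" "p dvd n" using prime_factor_nat by blast
    obtain m where m: "n = p ^ multiplicity p n * m" "\<not> p dvd m"
      using multiplicity_decompose'[of n p] p less.prems by (metis not_prime_unit less_not_refl)
    define k where "k = multiplicity p n"
    have k: "k > 0" unfolding k_def using p less.prems by (simp add: prime_multiplicity_gt_zero_iff)
    have "m > 0" using m less.prems by (auto intro!: Nat.gr0I)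
    moreover have "1 < p ^ k" using p k by (metis prime_gt_1_nat one_less_power)
    ultimately have "m < n" using m by (metis k_def mult_less_cancel2 nat_mult_1)
    with less.IH[of m] \<open>m > 0\<close> p k m show ?thesis
      by (metis assms(3) k_def)
  qed (use assms in auto)
qed

lemma bij_betw_divisors_coprime:
  fixes a b :: nat
  assumes "coprime a b" "a > 0" "b > 0"
  shows "bij_betw (\<lambda>(x,y). x * y) ({d. d dvd a} \<times> {d. d dvd b}) {d. d dvd a * b}"
proof (rule bij_betw_imageI)
  show "inj_on (\<lambda>(x,y). x * y) ({d. d dvd a} \<times> {d. d dvd b})"
  proof (rule inj_onI, clarify)
    fix x y x' y' assume *: "x dvd a" "y dvd b" "x' dvd a" "y' dvd b" "x * y = x' * y'"
    hence "coprime x y'" "coprime x' y" using assms by (meson coprime_divisors)+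
    hence "x dvd x'" "x' dvd x" using *(5)
      by (metis coprime_dvd_mult_left_iff dvd_triv_left)+
    hence "x = x'" by (rule dvd_antisym)
    moreover have "x > 0" using * assms by (auto intro!: Nat.gr0I)
    ultimately show "x = x' \<and> y = y'" using * by auto
  qed
next
  show "(\<lambda>(x,y). x * y) ` ({d. d dvd a} \<times> {d. d dvd b}) = {d. d dvd a * b}"
  proof (intro equalityI subsetI)
    fix d assume "d \<in> {d. d dvd a * b}"
    then obtain x y where "d = x * y" "x dvd a" "y dvd b" using division_decomp by blast
    thus "d \<in> (\<lambda>(x,y). x * y) ` ({d. d dvd a} \<times> {d. d dvd b})"
      by (intro image_eqI[of _ _ "(x,y)"]) auto
  qed (auto intro: mult_dvd_mono)
qed

lemma frac_le_cross:
  fixes b s t x :: real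
  shows "0 < s \<Longrightarrow> 0 < x \<Longrightarrow> b * x \<le> b * (t * s) \<Longrightarrow> b / s \<le> b * t / x"
  by (simp add: field_simps)

text \<open>The analysis sees only these properties of a real character. Nonprincipality enters
  through the bounded sums \<open>chi_sum\<close>, and \<open>chi_zero\<close> confines the primes
  with value 0 to the finitely many divisors of q.\<close>

locale real_char =
  fixes chi :: "nat \<Rightarrow> real" and B :: real and q :: nat
  assumes chi_1 [simp]: "chi (Suc 0) = 1"
    and chi_mult: "chi (m * n) = chi m * chi n"
    and chi_cases: "chi n = 0 \<or> chi n = 1 \<or> chi n = -1"
    and chi_sum: "\<bar>\<Sum>k=m..n. chi k\<bar> \<le> B"
    and q_pos: "q > 0"
    and chi_zero: "prime p \<Longrightarrow> chi p = 0 \<Longrightarrow> p dvd q"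
begin

lemma chi_power: "chi (p ^ k) = chi p ^ k"
  by (induction k) (auto simp: chi_mult)

lemma abs_chi_le: "\<bar>chi n\<bar> \<le> 1"
  using chi_cases[of n] by auto

lemma B_ge_1: "B \<ge> 1"
  using chi_sum[of 1 1] by simp

section \<open>Partial sums of L(1, chi) and the convolution of 1 with chi\<close>

definition S :: "nat \<Rightarrow> real" where "S n = (\<Sum>k=1..n. chi k / real k)"

lemma S_diff: "m \<le> n \<Longrightarrow> \<bar>S n - S m\<bar> \<le> B / real (Suc m)"
proof -
  assume "m \<le> n"
  hence "S n - S m = (\<Sum>k=Suc m..n. chi k * (1 / real k))"
    unfolding S_def
    by (induction n rule: dec_induct) auto
  also have "\<bar>\<dots>\<bar> \<le> B * (1 / real (Suc m))"
    by (intro abel_bound chi_sum) (auto simp: field_simps)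
  finally show ?thesis by simp
qed

lemma convergent_S: "convergent S"
proof (rule Cauchy_convergent, rule metric_CauchyI)
  fix e :: real assume e: "e > 0"
  obtain N where N: "real N > 2 * B / e" using reals_Archimedean2 by blast
  have N2: "2 * (B / real (Suc N)) < e"
    using N e by (simp add: field_simps)
  show "\<exists>M. \<forall>m\<ge>M. \<forall>n\<ge>M. dist (S m) (S n) < e"
  proof (intro exI[of _ N] allI impI)
    fix m n assume "N \<le> m" "N \<le> n"
    with S_diff[of N m] S_diff[of N n] N2 show "dist (S m) (S n) < e"
      unfolding dist_real_def by linarith
  qed
qed

definition L :: real where "L = lim S"

lemma S_tendsto: "S \<longlonglongrightarrow> L"
  using convergent_S by (simp add: L_def convergent_LIMSEQ_iff)

text \<open>The rate matters: for m = \<open>x div k\<close> the error is at most B k / x, which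
  cancels the weight 1/k of the convolution sums below and leaves a total of O(1).\<close>

lemma S_L: "\<bar>S m - L\<bar> \<le> B / real (Suc m)"
proof -
  have "(\<lambda>n. \<bar>S m - S n\<bar>) \<longlonglongrightarrow> \<bar>S m - L\<bar>"
    by (intro tendsto_intros S_tendsto)
  moreover have "\<forall>\<^sub>F n in sequentially. \<bar>S m - S n\<bar> \<le> B / real (Suc m)"
    using eventually_ge_at_top[of m] by eventually_elim (metis S_diff abs_minus_commute)
  ultimately show ?thesis by (rule tendsto_upperbound) auto
qed

text \<open>These are the Dirichlet coefficients of zeta(s) L(s, chi). For n > 0 the value is
  nonnegative, and it is zero exactly when a prime with character value -1 has odd exponent in
  n.\<close>

definition r :: "nat \<Rightarrow> real" where "r n = (\<Sum>d | d dvd n. chi d)"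

lemma r_1 [simp]: "r (Suc 0) = 1"
  by (simp add: r_def)

lemma r_mult:
  assumes "coprime a b" "a > 0" "b > 0"
  shows "r (a * b) = r a * r b"
proof -
  have "r (a * b) = (\<Sum>(x,y)\<in>{d. d dvd a} \<times> {d. d dvd b}. chi (x * y))"
    unfolding r_def using sum.reindex_bij_betw[OF bij_betw_divisors_coprime[OF assms], of chi]
    by (simp add: case_prod_unfold)
  also have "\<dots> = r a * r b"
    unfolding r_def sum_product sum.cartesian_product by (simp add: chi_mult)
  finally show ?thesis .
qed

lemma r_prime_power:
  assumes "prime p"
  shows "r (p ^ k) = (\<Sum>i\<le>k. chi p ^ i)"
proof -
  have "{d. d dvd p ^ k} = (\<lambda>i. p ^ i) ` {..k}"
    using divides_primepow_nat[OF assms] by auto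
  moreover have "inj_on (\<lambda>i. p ^ i) {..k}"
    using prime_gt_1_nat[OF assms] by (auto simp: inj_on_def power_inject_exp)
  ultimately show ?thesis by (simp add: r_def sum.reindex chi_power)
qed

lemma sum_minus_one_powers: "(\<Sum>i\<le>k. (-1::real) ^ i) = (if even k then 1 else 0)"
  by (induction k) auto

lemma r_prime_power_cases:
  assumes "prime p"
  shows "r (p ^ k) = (if chi p = 1 then real (Suc k) else if chi p = 0 \<or> even k then 1 else 0)"
  using chi_cases[of p] by (auto simp: r_prime_power assms sum_minus_one_powers power_0_left)

lemma r_nonneg: "n > 0 \<Longrightarrow> r n \<ge> 0"
proof (induction n rule: prime_power_coprime_induct)
  case (step p k m)
  then show ?case
    by (subst r_mult) (auto simp: prime_imp_coprime prime_gt_0_nat r_prime_power_cases)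
qed auto

text \<open>All exponents of a square are even, so every local factor is at least 1. Through this
  the Lambert series dominates the sum over squares.\<close>

lemma r_square_ge_1: "n > 0 \<Longrightarrow> r (n\<^sup>2) \<ge> 1"
proof (induction n rule: prime_power_coprime_induct)
  case (step p k m)
  have "r ((p ^ k * m)\<^sup>2) = r (p ^ (2*k)) * r (m\<^sup>2)"
    unfolding power_mult_distrib using step
    by (subst r_mult) (auto simp: prime_imp_coprime prime_gt_0_nat mult.commute simp flip: power_mult)
  also have "\<dots> \<ge> 1 * 1"
    using step by (intro mult_mono) (auto simp: r_prime_power_cases)
  finally show ?case by simp
qed auto

text \<open>A finite form of the Lambert series argument. The main terms add up to S N / (1 - x),
  the Monsky weights contribute at most B by partial summation since \<open>monsky x 1\<close> = 1,
  and the truncation of the geometric series costs N x^N / (1 - x), which vanishes as N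
  grows.\<close>

lemma sum_square_powers_le:
  assumes x: "0 < x" "x < 1" and N: "K\<^sup>2 \<le> N"
  shows "(\<Sum>k=1..K. x ^ (k\<^sup>2)) \<le> B + S N / (1 - x) + real N * x ^ N / (1 - x)"
proof -
  have "(\<Sum>k=1..K. x ^ (k\<^sup>2)) = (\<Sum>n\<in>(\<lambda>k. k\<^sup>2) ` {1..K}. x ^ n)"
    by (subst sum.reindex) (auto simp: inj_on_def)
  also have "\<dots> \<le> (\<Sum>n\<in>(\<lambda>k. k\<^sup>2) ` {1..K}. r n * x ^ n)"
  proof (intro sum_mono)
    fix n assume "n \<in> (\<lambda>k. k\<^sup>2) ` {1..K}"
    hence "r n \<ge> 1" using r_square_ge_1 by auto
    thus "x ^ n \<le> r n * x ^ n" using x by simp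
  qed
  also have "\<dots> \<le> (\<Sum>n=1..N. r n * x ^ n)"
  proof (intro sum_mono2)
    show "(\<lambda>k. k\<^sup>2) ` {1..K} \<subseteq> {1..N}"
    proof clarify
      fix k assume "k \<in> {1..K}"
      hence "k\<^sup>2 \<le> K\<^sup>2" "k\<^sup>2 > 0" by (auto intro!: power_mono)
      from order.trans[OF this(1) N] this(2) show "k\<^sup>2 \<in> {1..N}" by auto
    qed
  qed (use x r_nonneg in auto)
  also have "\<dots> = (\<Sum>n=1..N. \<Sum>d | d dvd n. chi d * x ^ (d * (n div d)))"
    by (intro sum.cong refl) (auto simp: r_def sum_distrib_right intro!: sum.cong)
  also have "\<dots> = (\<Sum>d=1..N. \<Sum>k=1..N div d. chi d * x ^ (d * k))"
    by (rule divisor_sum_swap)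
  also have "\<dots> = (\<Sum>d=1..N. chi d * (x ^ d / (1 - x ^ d)) - chi d * (x ^ (d * Suc (N div d)) / (1 - x ^ d)))"
  proof (intro sum.cong refl)
    fix d assume d: "d \<in> {1..N}"
    hence xd: "x ^ d < 1" using x by (auto simp: power_less_one_iff)
    have "(\<Sum>k=1..N div d. chi d * x ^ (d * k)) = chi d * (\<Sum>k=1..N div d. (x ^ d) ^ k)"
      by (simp add: sum_distrib_left power_mult)
    also have "(\<Sum>k=1..N div d. (x ^ d) ^ k) = (x ^ d - (x ^ d) ^ Suc (N div d)) / (1 - x ^ d)"
      using sum_gp_multiplied[of 1 "N div d" "x ^ d"] d xd
      by (auto simp: field_simps div_greater_zero_iff Suc_le_eq)
    finally show "(\<Sum>k=1..N div d. chi d * x ^ (d * k)) =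
      chi d * (x ^ d / (1 - x ^ d)) - chi d * (x ^ (d * Suc (N div d)) / (1 - x ^ d))"
      by (simp only: power_mult diff_divide_distrib right_diff_distrib)
  qed
  also have "\<dots> = (\<Sum>d=1..N. chi d * (x ^ d / (1 - x ^ d))) - (\<Sum>d=1..N. chi d * (x ^ (d * Suc (N div d)) / (1 - x ^ d)))"
    by (simp only: sum_subtractf)
  \<comment> \<open>The weight x^d / (1 - x^d) is 1 / (d (1 - x)) minus \<open>monsky x d\<close>;
    the first part sums to S N / (1 - x).\<close>
  also have "(\<Sum>d=1..N. chi d * (x ^ d / (1 - x ^ d))) = S N / (1 - x) - (\<Sum>d=1..N. chi d * monsky x d)"
    by (simp add: S_def monsky_def algebra_simps sum_subtractf sum_divide_distrib)
  also have "\<bar>\<Sum>d=1..N. chi d * monsky x d\<bar> \<le> B * monsky x 1"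
    using monsky_props[OF x] by (intro abel_bound chi_sum) auto
  hence "- (\<Sum>d=1..N. chi d * monsky x d) \<le> B"
    using x by (simp add: monsky_def diff_divide_distrib [symmetric])
  moreover have "\<bar>\<Sum>d=1..N. chi d * (x ^ (d * Suc (N div d)) / (1 - x ^ d))\<bar> \<le> (\<Sum>d=1..N. x ^ N / (1 - x))"
  proof (rule order.trans[OF sum_abs], intro sum_mono)
    fix d assume d: "d \<in> {1..N}"
    have "x ^ d \<le> x ^ 1" using x d by (intro power_decreasing) auto
    hence xd: "x ^ d \<le> x" by simp
    have "N \<le> d * Suc (N div d)" using d dividend_less_times_div[of d N] by simp
    hence "x ^ (d * Suc (N div d)) \<le> x ^ N" using x by (intro power_decreasing) auto
    hence "\<bar>chi d\<bar> * (x ^ (d * Suc (N div d)) / (1 - x ^ d)) \<le> 1 * (x ^ N / (1 - x))"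
      using xd x abs_chi_le[of d] by (intro mult_mono frac_le) auto
    thus "\<bar>chi d * (x ^ (d * Suc (N div d)) / (1 - x ^ d))\<bar> \<le> x ^ N / (1 - x)"
      using xd x by (simp add: abs_mult)
  qed
  ultimately show ?thesis by simp
qed

text \<open>If L <= 0, letting N tend to infinity bounds the sum of x^(k^2) over k <= K by B for
  each x < 1. Letting x tend to 1 gives K <= B, which fails for large K.\<close>

lemma L_pos: "L > 0"
proof (rule ccontr)
  assume "\<not> L > 0"
  hence L: "L \<le> 0" by simp
  obtain K where K: "real K > B" using reals_Archimedean2 by blast
  have le: "(\<Sum>k=1..K. x ^ (k\<^sup>2)) \<le> B" if x: "0 < x" "x < 1" for x :: real
  proof -
    have "(\<lambda>N. B + S N / (1 - x) + real N * x ^ N / (1 - x)) \<longlonglongrightarrow> B + L / (1 - x) + 0 / (1 - x)"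
      using x by (intro tendsto_intros S_tendsto powser_times_n_limit_0) auto
    moreover have "\<forall>\<^sub>F N in sequentially. (\<Sum>k=1..K. x ^ (k\<^sup>2)) \<le> B + S N / (1 - x) + real N * x ^ N / (1 - x)"
      using eventually_ge_at_top[of "K\<^sup>2"] by eventually_elim (use sum_square_powers_le x in auto)
    ultimately have "(\<Sum>k=1..K. x ^ (k\<^sup>2)) \<le> B + L / (1 - x) + 0 / (1 - x)"
      by (rule tendsto_lowerbound) auto
    moreover have "L / (1 - x) \<le> 0" using L x by (simp add: divide_le_0_iff)
    ultimately show ?thesis by simp
  qed
  have "((\<lambda>x. \<Sum>k=1..K. x ^ (k\<^sup>2)) \<longlongrightarrow> (\<Sum>k=1..K. 1 ^ (k\<^sup>2))) (at_left (1::real))"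
    by (intro tendsto_intros)
  moreover have "\<forall>\<^sub>F x in at_left (1::real). (\<Sum>k=1..K. x ^ (k\<^sup>2)) \<le> B"
    using eventually_at_left_real[OF zero_less_one] by eventually_elim (rule le, auto)
  ultimately have "(\<Sum>k=1..K. (1::real) ^ (k\<^sup>2)) \<le> B"
    by (rule tendsto_upperbound) auto
  thus False using K by simp
qed

text \<open>The left sum is the sum of S(x div k)/k over k <= x; replacing each S by L costs B/x for
  each of the x values of k.\<close>

lemma sum_r_div: "\<bar>(\<Sum>m=1..x. r m / real m) - L * harm x\<bar> \<le> B"
proof (cases "x = 0")
  case False
  have "(\<Sum>m=1..x. r m / real m) = (\<Sum>m=1..x. \<Sum>d | d dvd m. chi d / (real d * real (m div d)))"
  proof (intro sum.cong refl)
    fix m assume m: "m \<in> {1..x}"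
    have "real d * real (m div d) = real m" if "d dvd m" for d
      using that by (simp flip: of_nat_mult)
    thus "r m / real m = (\<Sum>d | d dvd m. chi d / (real d * real (m div d)))"
      unfolding r_def sum_divide_distrib by (intro sum.cong) auto
  qed
  also have "\<dots> = (\<Sum>k=1..x. \<Sum>d=1..x div k. chi d / (real d * real k))"
    unfolding divisor_sum_swap[of "\<lambda>d k. chi d / (real d * real k)"] by (rule divisor_sum_swap')
  also have "\<dots> = (\<Sum>k=1..x. S (x div k) / real k)"
    by (simp add: S_def sum_divide_distrib)
  finally have "(\<Sum>m=1..x. r m / real m) - L * harm x = (\<Sum>k=1..x. (S (x div k) - L) / real k)"
    by (simp add: harm_def sum_distrib_left [of L] diff_divide_distrib sum_subtractf)
       (simp add: divide_inverse)
  also have "\<bar>\<dots>\<bar> \<le> (\<Sum>k=1..x. B / real x)"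
  proof (rule order.trans[OF sum_abs], intro sum_mono)
    fix k assume k: "k \<in> {1..x}"
    have "\<bar>S (x div k) - L\<bar> \<le> B / real (Suc (x div k))" by (rule S_L)
    also have "\<dots> \<le> B * real k / real x"
    proof -
      have "x \<le> k * Suc (x div k)" using k dividend_less_times_div[of k x] by simp
      hence "real x \<le> real k * real (Suc (x div k))" by (metis of_nat_le_iff of_nat_mult)
      hence "B * real x \<le> B * (real k * real (Suc (x div k)))"
        using B_ge_1 by (intro mult_left_mono) auto
      thus ?thesis using False by (intro frac_le_cross) auto
    qed
    finally show "\<bar>(S (x div k) - L) / real k\<bar> \<le> B / real x"
      using k False by (simp add: abs_div field_simps)
  qed
  also have "\<dots> = B" using False by simp
  finally show ?thesis .
qed (use B_ge_1 in \<open>auto simp: harm_def\<close>)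

text \<open>Partial summation again, but ln n / n decreases only from n = 3 on (as e < 3), so the
  first two terms are split off.\<close>

lemma sum_chi_ln:
  "\<exists>C. \<forall>x. \<bar>\<Sum>n=1..x. chi n * (ln (real n) / real n)\<bar> \<le> C"
proof (intro exI allI)
  fix x
  have w: "ln (real (Suc n)) / real (Suc n) \<le> ln (real n) / real n" if "3 \<le> n" for n
  proof -
    have "ln (1 + 1 / real n) \<le> 1 / real n"
      by (rule ln_add_one_self_le_self) auto
    moreover have "1 + 1 / real n = real (Suc n) / real n" using that by (simp add: field_simps)
    ultimately have "ln (real (Suc n)) - ln (real n) \<le> 1 / real n" using that by (simp add: ln_div)
    moreover have "ln (real n) \<ge> 1"
    proof -
      have "exp 1 \<le> (3::real)" by (rule exp_le)
      hence "exp 1 \<le> real n" using that by simp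
      thus ?thesis using that by (subst ln_ge_iff) auto
    qed
    ultimately have "real n * (ln (real (Suc n)) - ln (real n)) \<le> ln (real n)"
      using that by (simp add: field_simps)
    thus ?thesis using that by (simp add: field_simps)
  qed
  have tail: "\<bar>\<Sum>n=3..x. chi n * (ln (real n) / real n)\<bar> \<le> B * (ln (real 3) / real 3)"
    by (intro abel_bound chi_sum w) auto
  have "(\<Sum>n=1..x. chi n * (ln (real n) / real n)) =
        (\<Sum>n\<in>{1..x} \<inter> {1,2}. chi n * (ln (real n) / real n)) + (\<Sum>n=3..x. chi n * (ln (real n) / real n))"
    by (subst sum.union_disjoint [symmetric]) (auto intro!: sum.cong)
  also have "\<bar>\<dots>\<bar> \<le> (\<Sum>n\<in>{1..x} \<inter> {1,2}. \<bar>chi n * (ln (real n) / real n)\<bar>) + B * (ln (real 3) / real 3)"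
    by (intro order.trans[OF abs_triangle_ineq] add_mono sum_abs tail)
  also have "(\<Sum>n\<in>{1..x} \<inter> {1,2}. \<bar>chi n * (ln (real n) / real n)\<bar>) \<le> (\<Sum>n\<in>{1,2}. \<bar>chi n * (ln (real n) / real n)\<bar>)"
    by (intro sum_mono2) auto
  finally show "\<bar>\<Sum>n=1..x. chi n * (ln (real n) / real n)\<bar> \<le> (\<Sum>n\<in>{1,2::nat}. \<bar>chi n * (ln (real n) / real n)\<bar>) + B * (ln (real 3) / real 3)"
    by simp
qed

text \<open>Since chi ln is the convolution of chi Lam with chi, the bounded sum of chi(n) ln n / n
  equals the sum of chi(d) Lam(d)/d * S(x div d). Replacing S by L costs at most B psi(x)/x <= 4 B,
  and L > 0 allows the division by L.\<close>

lemma mertens_chi: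
  "\<exists>C\<ge>0. \<forall>x. \<bar>\<Sum>d=1..x. chi d * (Lam d / real d)\<bar> \<le> C"
proof -
  obtain C where C: "\<And>x. \<bar>\<Sum>n=1..x. chi n * (ln (real n) / real n)\<bar> \<le> C" using sum_chi_ln by blast
  have C0: "C \<ge> 0" using C[of 0] by simp
  have "\<bar>\<Sum>d=1..x. chi d * (Lam d / real d)\<bar> \<le> (C + 4 * B) / L" for x
  proof -
    have "(\<Sum>n=1..x. chi n * (ln (real n) / real n)) =
       (\<Sum>n=1..x. \<Sum>d | d dvd n. (chi d * (Lam d / real d)) * (chi (n div d) / real (n div d)))"
    proof (intro sum.cong refl)
      fix n assume n: "n \<in> {1..x}"
      have eq: "real d * real (n div d) = real n" "chi d * chi (n div d) = chi n" if "d dvd n" for d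
        using that by (simp_all flip: of_nat_mult chi_mult)
      have "chi n * (ln (real n) / real n) = (\<Sum>d | d dvd n. chi n * (Lam d / real n))"
        using n mangoldt_sum[of n, where ?'a = real] by (simp flip: sum_distrib_left sum_divide_distrib)
      also have "\<dots> = (\<Sum>d | d dvd n. (chi d * (Lam d / real d)) * (chi (n div d) / real (n div d)))"
      proof (intro sum.cong refl)
        fix d assume "d \<in> {d. d dvd n}"
        hence d: "d dvd n" by simp
        show "chi n * (Lam d / real n) = (chi d * (Lam d / real d)) * (chi (n div d) / real (n div d))"
          unfolding eq(1)[OF d, symmetric] eq(2)[OF d, symmetric] by simp
      qed
      finally show "chi n * (ln (real n) / real n) =
         (\<Sum>d | d dvd n. (chi d * (Lam d / real d)) * (chi (n div d) / real (n div d)))" .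
    qed
    also have "\<dots> = (\<Sum>d=1..x. \<Sum>k=1..x div d. (chi d * (Lam d / real d)) * (chi k / real k))"
      by (rule divisor_sum_swap)
    also have "\<dots> = (\<Sum>d=1..x. chi d * (Lam d / real d) * S (x div d))"
      by (simp add: S_def sum_distrib_left)
    finally have "(\<Sum>n=1..x. chi n * (ln (real n) / real n)) - L * (\<Sum>d=1..x. chi d * (Lam d / real d))
       = (\<Sum>d=1..x. chi d * (Lam d / real d) * (S (x div d) - L))"
      by (simp only: right_diff_distrib sum_subtractf sum_distrib_left [of L]) (simp add: mult_ac)
    also have "\<bar>\<dots>\<bar> \<le> (\<Sum>d=1..x. Lam d * (B / real x))"
    proof (rule order.trans[OF sum_abs], intro sum_mono)
      fix k assume k: "k \<in> {1..x}"
      have "\<bar>S (x div k) - L\<bar> \<le> B / real (Suc (x div k))" by (rule S_L)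
      also have "\<dots> \<le> B * real k / real x"
      proof -
        have "x \<le> k * Suc (x div k)" using k dividend_less_times_div[of k x] by simp
        hence "real x \<le> real k * real (Suc (x div k))" by (metis of_nat_le_iff of_nat_mult)
        hence "B * real x \<le> B * (real k * real (Suc (x div k)))"
          using B_ge_1 by (intro mult_left_mono) auto
        thus ?thesis using k by (intro frac_le_cross) auto
      qed
      finally have 1: "\<bar>S (x div k) - L\<bar> \<le> B * real k / real x" .
      have "\<bar>chi k * (Lam k / real k) * (S (x div k) - L)\<bar> \<le> 1 * (Lam k / real k) * (B * real k / real x)"
        unfolding abs_mult using abs_chi_le 1 by (intro mult_mono) (auto simp: mangoldt_nonneg)
      also have "\<dots> = Lam k * (B / real x)" using k by simp
      finally show "\<bar>chi k * (Lam k / real k) * (S (x div k) - L)\<bar> \<le> Lam k * (B / real x)" .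
    qed
    also have "\<dots> = psi x * (B / real x)" by (simp only: psi_def sum_distrib_right)
    also have "\<dots> \<le> 4 * real x * (B / real x)"
      using psi_le[of x] B_ge_1 by (intro mult_right_mono) auto
    also have "\<dots> \<le> 4 * B" using B_ge_1 by simp
    finally have "\<bar>L * (\<Sum>d=1..x. chi d * (Lam d / real d))\<bar> \<le> C + 4 * B"
      using C[of x] by linarith
    thus ?thesis using L_pos by (simp add: abs_mult field_simps)
  qed
  moreover have "(C + 4 * B) / L \<ge> 0" using C0 B_ge_1 L_pos by simp
  ultimately show ?thesis by blast
qed

end

section \<open>Integers all of whose primes split\<close>

lemma sum_prime_powers_div_le:
  assumes "prime p"
  shows "(\<Sum>k=1..K. Lam (p ^ k) / real (p ^ k)) \<le> ln (real p)"
proof -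
  have p: "real p \<ge> 2" using prime_ge_2_nat[OF assms] by simp
  have geom: "(\<Sum>k=1..K. (1 / real p) ^ k) \<le> 1"
  proof -
    have "(1 - 1 / real p) * (\<Sum>k=1..K. (1 / real p) ^ k) \<le> (1 / real p) ^ 1"
      using sum_gp_multiplied[of 1 K "1 / real p"] p by (cases "K = 0") auto
    also have "\<dots> \<le> 1 - 1 / real p" using p by (simp add: field_simps)
    finally have "(1 - 1 / real p) * (\<Sum>k=1..K. (1 / real p) ^ k) \<le> (1 - 1 / real p) * 1" by simp
    moreover have "1 - 1 / real p > 0" using p by (simp add: field_simps)
    ultimately show ?thesis by (simp only: mult_le_cancel_left_pos)
  qed
  have "(\<Sum>k=1..K. Lam (p ^ k) / real (p ^ k)) = ln (real p) * (\<Sum>k=1..K. (1 / real p) ^ k)"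
    unfolding sum_distrib_left using assms by (intro sum.cong) (auto simp: power_divide)
  also have "\<dots> \<le> ln (real p) * 1" using geom p by (intro mult_left_mono) auto
  finally show ?thesis by simp
qed

lemma sum_inverse_squares_le: "(\<Sum>k=1..n. 1 / (real k)\<^sup>2) \<le> 2"
proof -
  have "(\<Sum>k=1..n. 1 / (real k)\<^sup>2) \<le> 2 - 1 / real n" if "n \<ge> 1" for n
    using that
  proof (induction n rule: dec_induct)
    case (step n)
    have "1 / (real (Suc n))\<^sup>2 \<le> 1 / real n - 1 / real (Suc n)"
    proof -
      have "1 / (real (Suc n))\<^sup>2 \<le> 1 / (real n * real (Suc n))"
        using step by (intro divide_left_mono) (auto simp: power2_eq_square)
      also have "\<dots> = 1 / real n - 1 / real (Suc n)"
        using step by (simp add: field_simps)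
      finally show ?thesis .
    qed
    with step show ?case by simp
  qed auto
  from this[of n] show ?thesis by (cases "n \<ge> 1") (auto intro: order.trans)
qed

lemma summable_sqrt_div_square: "\<exists>C\<ge>0. \<forall>n. (\<Sum>k=1..n. sqrt (real k) / (real k)\<^sup>2) \<le> C"
proof (intro exI[of _ "\<Sum>k. real k powr (-3/2)"] conjI allI)
  have summ: "summable (\<lambda>k. real k powr (-3/2))" by (subst summable_real_powr_iff) auto
  show "0 \<le> (\<Sum>k. real k powr (-3/2))" by (intro suminf_nonneg summ) auto
  fix n
  have "(\<Sum>k=1..n. sqrt (real k) / (real k)\<^sup>2) = (\<Sum>k=1..n. real k powr (-3/2))"
  proof (intro sum.cong refl)
    fix k assume "k \<in> {1..n}"
    hence k: "real k > 0" by simp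
    have "sqrt (real k) / (real k)\<^sup>2 = real k powr (1/2) / real k powr 2"
      using k by (simp add: powr_half_sqrt)
    also have "\<dots> = real k powr (1/2 - 2)" by (rule powr_diff [symmetric])
    also have "\<dots> = real k powr (-3/2)" by simp
    finally show "sqrt (real k) / (real k)\<^sup>2 = real k powr (-3/2)" .
  qed
  also have "\<dots> \<le> (\<Sum>k. real k powr (-3/2))"
    by (intro sum_le_suminf summ) auto
  finally show "(\<Sum>k=1..n. sqrt (real k) / (real k)\<^sup>2) \<le> (\<Sum>k. real k powr (-3/2))" .
qed

lemma harm_le: "n \<ge> 1 \<Longrightarrow> harm n \<le> 1 + ln (real n)"
proof -
  assume "n \<ge> 1"
  then obtain m where m: "n = Suc m" by (cases n) auto
  have "harm (Suc m) - ln (real (Suc m)) \<le> harm (Suc 0) - ln (real (Suc 0))"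
    using decseqD[OF decseq_harm_diff_ln, of 0 m] by simp
  thus ?thesis by (simp add: m harm_expand)
qed

context real_char
begin

definition split :: "nat \<Rightarrow> bool" where
  "split n \<longleftrightarrow> n > 0 \<and> (\<forall>p. prime p \<longrightarrow> p dvd n \<longrightarrow> chi p = 1)"

lemma split_1 [simp]: "split (Suc 0)"
  by (auto simp: split_def)

lemma split_mult_iff: "split (m * n) \<longleftrightarrow> split m \<and> split n"
  by (auto simp: split_def prime_dvd_mult_iff)

lemma split_dvd: "split n \<Longrightarrow> d dvd n \<Longrightarrow> split d"
  by (auto simp: split_mult_iff elim!: dvdE)

lemma split_pos: "split n \<Longrightarrow> n > 0"
  by (simp add: split_def)

lemma split_prime_power: "prime p \<Longrightarrow> chi p = 1 \<Longrightarrow> split (p ^ k)"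
  by (auto simp: split_def prime_gt_0_nat) (metis prime_dvd_power primes_dvd_imp_eq)

lemma chi_split: "split n \<Longrightarrow> chi n = 1"
proof -
  assume "split n"
  hence "n > 0" by (simp add: split_def)
  thus ?thesis using \<open>split n\<close>
  proof (induction n rule: prime_power_coprime_induct)
    case (step p k m)
    hence "chi p = 1" by (auto simp: split_def)
    with step show ?case by (simp add: chi_mult chi_power split_mult_iff)
  qed auto
qed

lemma r_split: "split n \<Longrightarrow> r n = real (card {d. d dvd n})"
  unfolding r_def using chi_split split_dvd by simp

text \<open>As \<open>Lam\<close> lives on prime powers, this is Chebyshev's function restricted to
  powers of primes with character value 1.\<close>

definition theta :: "nat \<Rightarrow> real" where
  "theta n = (\<Sum>d | d \<in> {1..n} \<and> split d. Lam d)"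

text \<open>The factor 1 + chi is 2 on powers of split primes and 0 on odd powers of primes with
  value -1. The remaining prime powers belong to the finitely many primes dividing q, or are even
  powers and hence squares; both kinds have convergent sums, so E can be chosen independently of the
  window (m, n].\<close>

lemma one_plus_chi_mangoldt_le:
  "\<exists>E\<ge>0. \<forall>m n. (\<Sum>d\<in>{m<..n}. (1 + chi d) * (Lam d / real d))
      \<le> 2 * (\<Sum>d | d \<in> {m<..n} \<and> split d. Lam d / real d) + E"
proof -
  define bad where "bad = {p. prime p \<and> p dvd q}"
  have fin: "finite bad" unfolding bad_def using q_pos by (auto intro: finite_subset[of _ "{d. d dvd q}"])
  define E1 where "E1 = (\<Sum>p\<in>bad. ln (real p))"
  obtain C where C: "C \<ge> 0" "\<And>n. (\<Sum>k=1..n. sqrt (real k) / (real k)\<^sup>2) \<le> C"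
    using summable_sqrt_div_square by blast
  have E1: "E1 \<ge> 0" unfolding E1_def bad_def by (intro sum_nonneg ln_ge_zero) (auto dest: prime_ge_1_nat)
  have "(\<Sum>d\<in>{m<..n}. (1 + chi d) * (Lam d / real d))
      \<le> 2 * (\<Sum>d | d \<in> {m<..n} \<and> split d. Lam d / real d) + (2 * E1 + 8 * C)" for m n
  proof -
    define P where "P = {d\<in>{m<..n}. primepow d}"
    \<comment> \<open>X takes in the powers of primes dividing q, and Y the even powers of primes
      with value -1; being a superset of these is enough.\<close>
    define X where "X = (\<lambda>(p,k). p ^ k) ` (bad \<times> {1..n})"
    define Y where "Y = (\<lambda>k. k\<^sup>2) ` {1..n}"
    have finX: "finite X" "finite Y" using fin by (auto simp: X_def Y_def)
    have dom: "d \<in> {d\<in>{m<..n}. split d} \<or> d \<in> X \<or> d \<in> Y \<or> (1 + chi d) * (Lam d / real d) = 0"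
      if d: "d \<in> {m<..n}" for d
    proof (cases "primepow d")
      case True
      then obtain p k where pk: "prime p" "k > 0" "d = p ^ k" by (auto simp: primepow_def)
      have "k < p ^ k" using prime_gt_1_nat[OF pk(1)] by (intro power_gt_expt) simp
      hence kn: "k \<le> n" using d pk by simp
      consider "chi p = 1" | "chi p = 0" | "chi p = -1" using chi_cases by blast
      then show ?thesis
      proof cases
        case 1 then show ?thesis using d pk split_prime_power by auto
      next
        case 2
        hence "p \<in> bad" using chi_zero pk by (auto simp: bad_def)
        hence "d \<in> X" unfolding X_def using pk kn by (intro image_eqI[of _ _ "(p,k)"]) auto
        thus ?thesis by blast
      next
        case 3
        show ?thesis
        proof (cases "even k")
          case True
          then obtain j where j: "k = 2 * j" by (auto elim: evenE)
          hence dj: "d = (p ^ j)\<^sup>2" using pk by (simp add: power_mult [symmetric] mult.commute)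
          have "p ^ j \<le> d" unfolding dj by (simp add: power2_eq_square)
          hence "p ^ j \<in> {1..n}" using d pk by (auto simp: Suc_le_eq prime_gt_0_nat)
          thus ?thesis using dj by (auto simp: Y_def)
        next
          case False
          thus ?thesis using 3 pk by (simp add: chi_power)
        qed
      qed
    qed (auto simp: mangoldt_def)
    define h where "h d = 2 * (Lam d / real d)" for d
    have h: "h d \<ge> 0" for d by (simp add: h_def mangoldt_nonneg)
    have "(\<Sum>d\<in>{m<..n}. (1 + chi d) * (Lam d / real d)) \<le>
      (\<Sum>d\<in>{m<..n}. (if split d then h d else 0) + (if d \<in> X then h d else 0)
         + (if d \<in> Y then h d else 0))"
    proof (intro sum_mono)
      fix d assume d: "d \<in> {m<..n}"
      have "(1 + chi d) * (Lam d / real d) \<le> h d"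
        unfolding h_def using abs_chi_le[of d] by (intro mult_right_mono) (auto simp: mangoldt_nonneg)
      thus "(1 + chi d) * (Lam d / real d) \<le> (if split d then h d else 0) + (if d \<in> X then h d else 0)
         + (if d \<in> Y then h d else 0)"
        using dom[OF d] h[of d] d by auto
    qed
    also have "\<dots> = (\<Sum>d | d \<in> {m<..n} \<and> split d. h d) + (\<Sum>d\<in>{m<..n} \<inter> X. h d) + (\<Sum>d\<in>{m<..n} \<inter> Y. h d)"
      by (simp only: sum.distrib sum.inter_filter sum.inter_restrict finite_greaterThanAtMost)
    also have "(\<Sum>d\<in>{m<..n} \<inter> X. h d) \<le> (\<Sum>d\<in>X. h d)"
      using finX h by (intro sum_mono2) auto
    also have "\<dots> \<le> (\<Sum>(p,k)\<in>bad \<times> {1..n}. h (p ^ k))"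
      unfolding X_def using fin h by (intro order.trans[OF sum_image_le]) (auto simp: case_prod_unfold)
    also have "\<dots> = (\<Sum>p\<in>bad. 2 * (\<Sum>k=1..n. Lam (p ^ k) / real (p ^ k)))"
      unfolding h_def sum_distrib_left by (rule sum.cartesian_product [symmetric])
    also have "\<dots> \<le> (\<Sum>p\<in>bad. 2 * ln (real p))"
      using sum_prime_powers_div_le by (intro sum_mono mult_left_mono) (auto simp: bad_def)
    also have "\<dots> = 2 * E1" by (simp add: E1_def sum_distrib_left)
    also have "(\<Sum>d\<in>{m<..n} \<inter> Y. h d) \<le> (\<Sum>d\<in>Y. h d)"
      using finX h by (intro sum_mono2) auto
    also have "\<dots> \<le> (\<Sum>k=1..n. h (k\<^sup>2))"
      unfolding Y_def using h by (intro order.trans[OF sum_image_le]) auto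
    also have "\<dots> \<le> (\<Sum>k=1..n. 8 * (sqrt (real k) / (real k)\<^sup>2))"
    proof (intro sum_mono)
      fix k assume "k \<in> {1..n}"
      hence k: "real k > 0" by simp
      have "Lam (k\<^sup>2) \<le> ln (real (k\<^sup>2))" using k by (intro mangoldt_le) auto
      also have "\<dots> = 4 * ln (sqrt (real k))" using k by (simp add: ln_realpow ln_sqrt)
      also have "ln (sqrt (real k)) \<le> sqrt (real k)"
        using ln_le_minus_one[of "sqrt (real k)"] k by simp
      finally have "Lam (k\<^sup>2) / (real k)\<^sup>2 \<le> 4 * sqrt (real k) / (real k)\<^sup>2"
        by (intro divide_right_mono) auto
      thus "h (k\<^sup>2) \<le> 8 * (sqrt (real k) / (real k)\<^sup>2)" by (simp add: h_def)
    qed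
    also have "\<dots> \<le> 8 * C" unfolding sum_distrib_left [symmetric] using C by simp
    finally show ?thesis by (simp add: h_def sum_distrib_left)
  qed
  thus ?thesis using E1 C by (intro exI[of _ "2 * E1 + 8 * C"]) auto
qed

text \<open>In the window (x/A, x] the two Mertens estimates make the sum of (1 + chi(d)) Lam(d)/d
  at least ln A - O(1). For a suitable A the split prime powers of the window therefore contribute
  at least 1 to the sum of Lam(d)/d, and there 1/d <= A/x.\<close>

lemma theta_lower:
  "\<exists>c>0. \<exists>x0\<ge>1. \<forall>x\<ge>x0. c * real x \<le> theta x"
proof -
  obtain E where E: "E \<ge> 0" "\<And>m n. (\<Sum>d\<in>{m<..n}. (1 + chi d) * (Lam d / real d))
      \<le> 2 * (\<Sum>d | d \<in> {m<..n} \<and> split d. Lam d / real d) + E"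
    using one_plus_chi_mangoldt_le by blast
  obtain C where C: "C \<ge> 0" "\<And>x. \<bar>\<Sum>d=1..x. chi d * (Lam d / real d)\<bar> \<le> C"
    using mertens_chi by blast
  \<comment> \<open>Of the 12, 10 pays for Mertens at both ends of the window and 2 leaves at least
    1 after halving; 2 C pays for the twisted sum at both ends, and E for the prime powers that are
    not split.\<close>
  obtain A :: nat where "real A > exp (12 + 2 * C + E)" using reals_Archimedean2 by blast
  moreover have "exp (12 + 2 * C + E) \<ge> 1" using C E by simp
  ultimately have A: "A \<ge> 1" "real A > exp (12 + 2 * C + E)" by linarith+
  hence lnA: "ln (real A) \<ge> 12 + 2 * C + E" by (subst ln_ge_iff) auto
  have "1 / real A * real x \<le> theta x" if x: "x \<ge> A" for x
  proof -
    define y where "y = x div A"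
    have y: "y \<ge> 1" using x A by (simp add: y_def Suc_le_eq div_greater_zero_iff)
    have yx: "y \<le> x" by (simp add: y_def)
    have lny: "ln (real y) \<le> ln (real x) - ln (real A)"
    proof -
      have "y * A \<le> x" by (simp add: y_def)
      hence "ln (real (y * A)) \<le> ln (real x)" using x y A by (subst ln_le_cancel_iff) (auto simp flip: of_nat_mult)
      thus ?thesis using y A by (simp add: ln_mult)
    qed
    have split_sum: "sum f {1..x} = sum f {1..y} + sum f {y<..x}" for f :: "nat \<Rightarrow> real"
      using yx by (subst sum.union_disjoint [symmetric]) (auto intro!: sum.cong)
    have m1: "(\<Sum>d\<in>{y<..x}. Lam d / real d) \<ge> ln (real A) - 10"
      using mertens[of x] mertens[of y] x y A lny split_sum[of "\<lambda>d. Lam d / real d"] by linarith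
    have m2: "(\<Sum>d\<in>{y<..x}. chi d * (Lam d / real d)) \<ge> - 2 * C"
      using C(2)[of x] C(2)[of y] split_sum[of "\<lambda>d. chi d * (Lam d / real d)"] by linarith
    have "2 + E \<le> (\<Sum>d\<in>{y<..x}. (1 + chi d) * (Lam d / real d))"
      using m1 m2 lnA unfolding distrib_right sum.distrib mult_1 by linarith
    also note E(2)[of y x]
    finally have "1 \<le> (\<Sum>d | d \<in> {y<..x} \<and> split d. Lam d / real d)" by simp
    also have "\<dots> \<le> (\<Sum>d | d \<in> {y<..x} \<and> split d. Lam d * (real A / real x))"
    proof (intro sum_mono)
      fix d assume "d \<in> {d. d \<in> {y<..x} \<and> split d}"
      hence d: "y < d" by simp
      have "x < A * Suc y" unfolding y_def using A dividend_less_times_div[of A x] by simp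
      also have "\<dots> \<le> A * d" using d by (intro mult_le_mono2) auto
      finally have "real x \<le> real A * real d" by (metis less_imp_le of_nat_le_iff of_nat_mult)
      hence "1 / real d \<le> real A / real x" using d x A by (simp add: field_simps)
      thus "Lam d / real d \<le> Lam d * (real A / real x)"
        using mult_left_mono[of "1 / real d" "real A / real x" "Lam d"] by (simp add: mangoldt_nonneg)
    qed
    also have "\<dots> \<le> (\<Sum>d | d \<in> {1..x} \<and> split d. Lam d * (real A / real x))"
      by (intro sum_mono2) (auto simp: mangoldt_nonneg)
    also have "\<dots> = theta x * (real A / real x)"
      by (simp only: theta_def sum_distrib_right)
    finally show ?thesis using x A by (simp add: field_simps)
  qed
  thus ?thesis using A by (intro exI[of _ "1 / real A"] conjI exI[of _ A]) auto
qed

section \<open>Reciprocal sums over split integers and their count\<close>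

definition T :: "nat \<Rightarrow> real" where
  "T n = (\<Sum>k | k \<in> {1..n} \<and> split k. 1 / real k)"

definition cnt :: "nat \<Rightarrow> real" where
  "cnt n = real (card {k \<in> {1..n}. split k})"

lemma T_nonneg: "T n \<ge> 0"
  unfolding T_def by (intro sum_nonneg) auto

lemma T_square: "(T n)\<^sup>2 = (\<Sum>(a,b)\<in>{k. k \<in> {1..n} \<and> split k} \<times> {k. k \<in> {1..n} \<and> split k}. 1 / real (a * b))"
  unfolding T_def power2_eq_square sum_product sum.cartesian_product by simp

text \<open>A pair (a, b) of split integers is recorded as a product m = a b <= n^2 with a divisor
  a. For split m the number of divisors is r m, so the square is at most the sum of r(m)/m up to
  n^2.\<close>

lemma T_square_le: "(T n)\<^sup>2 \<le> L * harm (n\<^sup>2) + B"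
proof -
  have "(T n)\<^sup>2 \<le> (\<Sum>(m,d)\<in>(SIGMA m:{m \<in> {1..n\<^sup>2}. split m}. {d. d dvd m}). 1 / real m)"
    unfolding T_square
  proof (rule sum_le_included[where i = "\<lambda>(m,d). (d, m div d)"])
    show "\<forall>x\<in>{k. k \<in> {1..n} \<and> split k} \<times> {k. k \<in> {1..n} \<and> split k}.
       \<exists>y\<in>(SIGMA m:{m \<in> {1..n\<^sup>2}. split m}. {d. d dvd m}). (\<lambda>(m,d). (d, m div d)) y = x \<and>
         (case x of (a,b) \<Rightarrow> 1 / real (a * b)) \<le> (case y of (m,d) \<Rightarrow> 1 / real m)"
    proof
      fix x assume "x \<in> {k. k \<in> {1..n} \<and> split k} \<times> {k. k \<in> {1..n} \<and> split k}"
      then obtain a b where x: "x = (a,b)"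
        and ab: "a \<in> {1..n}" "b \<in> {1..n}" "split a" "split b" by auto
      have "a * b \<le> n * n" using ab by (intro mult_le_mono) auto
      thus "\<exists>y\<in>(SIGMA m:{m \<in> {1..n\<^sup>2}. split m}. {d. d dvd m}). (\<lambda>(m,d). (d, m div d)) y = x \<and>
         (case x of (a,b) \<Rightarrow> 1 / real (a * b)) \<le> (case y of (m,d) \<Rightarrow> 1 / real m)"
        using ab unfolding x by (intro bexI[of _ "(a * b, a)"]) (auto simp: split_mult_iff power2_eq_square)
    qed
  qed (auto intro!: finite_SigmaI)
  also have "\<dots> = (\<Sum>m\<in>{m \<in> {1..n\<^sup>2}. split m}. \<Sum>d | d dvd m. 1 / real m)"
    by (subst sum.Sigma) auto
  also have "\<dots> = (\<Sum>m\<in>{m \<in> {1..n\<^sup>2}. split m}. r m / real m)"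
    by (intro sum.cong) (auto simp: r_split)
  also have "\<dots> \<le> (\<Sum>m=1..n\<^sup>2. r m / real m)"
    using r_nonneg by (intro sum_mono2) auto
  also have "\<dots> \<le> L * harm (n\<^sup>2) + B"
    using sum_r_div[of "n\<^sup>2"] by linarith
  finally show ?thesis .
qed

text \<open>The split primes go into u, each prime dividing q with odd exponent gives one factor to
  d, and all remaining exponents are even and go into k. The clauses \<open>d dvd m\<close> and
  \<open>u dvd m\<close> serve the induction: they keep d and u coprime to the next prime.\<close>

lemma r_nonzero_decomp:
  assumes "m > 0" "r m \<noteq> 0"
  shows "\<exists>u d k. m = u * (d * k\<^sup>2) \<and> split u \<and> d dvd q \<and> d dvd m \<and> u dvd m \<and> r m \<le> r u"
  using assms
proof (induction m rule: prime_power_coprime_induct)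
  case one
  show ?case by (intro exI[of _ 1]) auto
next
  case (step p j m)
  have cop: "coprime (p ^ j) m" using step by (simp add: prime_imp_coprime)
  have rm: "r (p ^ j * m) = r (p ^ j) * r m"
    using step cop by (intro r_mult) (auto simp: prime_gt_0_nat)
  with step obtain u d k where udk: "m = u * (d * k\<^sup>2)" "split u" "d dvd q" "d dvd m" "u dvd m" "r m \<le> r u"
    by auto
  have rpj: "r (p ^ j) = (if chi p = 1 then real (Suc j) else if chi p = 0 \<or> even j then 1 else 0)"
    using step by (intro r_prime_power_cases)
  consider "chi p = 1" | "chi p = 0" "odd j" | "chi p \<noteq> 1" "even j"
    using rpj rm step.prems by (auto split: if_splits)
  then show ?case
  proof cases
    case 1
    have "coprime (p ^ j) u" using cop udk(5) by (meson coprime_divisors dvd_refl)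
    hence "r (p ^ j * u) = r (p ^ j) * r u"
      using step udk split_pos by (intro r_mult) (auto simp: prime_gt_0_nat)
    moreover have "r (p ^ j) * r m \<le> r (p ^ j) * r u"
      using udk rpj 1 by (intro mult_left_mono) auto
    ultimately have "r (p ^ j * m) \<le> r (p ^ j * u)" by (simp only: rm)
    moreover have "split (p ^ j * u)"
      using udk(2) 1 step split_prime_power[of p j] by (simp add: split_mult_iff)
    moreover have "p ^ j * m = (p ^ j * u) * (d * k\<^sup>2)" by (simp only: udk(1) mult_ac)
    moreover have "d dvd p ^ j * m" using udk(4) by (rule dvd_mult)
    moreover have "p ^ j * u dvd p ^ j * m" using udk(5) by (intro mult_dvd_mono dvd_refl)
    ultimately show ?thesis using udk(3) by blast
  next
    case 2
    then obtain i where i: "j = Suc (2 * i)" by (auto elim!: oddE)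
    have "\<not> p dvd d" using udk(4) step by (meson dvd_trans)
    hence "coprime p d" using step by (simp add: prime_imp_coprime)
    moreover have "p dvd q" using chi_zero 2 step by auto
    ultimately have "p * d dvd q" using udk by (intro divides_mult) auto
    moreover have "p * d dvd p ^ j * m" using udk(4) i by (intro mult_dvd_mono) auto
    moreover have "p ^ j * m = u * ((p * d) * (p ^ i * k)\<^sup>2)"
    proof -
      have "p ^ j = p * (p ^ i)\<^sup>2" by (simp add: i mult.commute flip: power_mult)
      thus ?thesis by (simp only: udk(1) power_mult_distrib mult_ac)
    qed
    moreover have "u dvd p ^ j * m" using udk(5) by (rule dvd_mult)
    moreover have "r (p ^ j * m) \<le> r u" using udk(6) 2 by (simp add: rm rpj)
    ultimately show ?thesis using udk(2) by blast
  next
    case 3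
    then obtain i where i: "j = 2 * i" by (auto elim!: evenE)
    have "p ^ j * m = u * (d * (p ^ i * k)\<^sup>2)"
      by (simp add: i udk(1) power_mult_distrib mult_ac flip: power_mult)
    moreover have "u dvd p ^ j * m" "d dvd p ^ j * m" using udk(4,5) by (simp_all add: dvd_mult)
    moreover have "r (p ^ j * m) \<le> r u" using udk(6) 3 by (simp add: rm rpj)
    ultimately show ?thesis using udk(2,3) by blast
  qed
qed

text \<open>Writing m = u d k^2 gives r(m)/m <= r(u)/u * 1/k^2. The choices of d account for the
  factor q, the sum over k for the factor 2, and r(u), the number of factorizations u = a b, turns
  the sum over u into part of the square.\<close>

lemma sum_r_le_T_square: "(\<Sum>m=1..n. r m / real m) \<le> 2 * real q * (T n)\<^sup>2"
proof -
  let ?G = "{u. u \<in> {1..n} \<and> split u}"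
  have "(\<Sum>m=1..n. r m / real m) = (\<Sum>m\<in>{m \<in> {1..n}. r m \<noteq> 0}. r m / real m)"
    by (intro sum.mono_neutral_right) auto
  also have "\<dots> \<le> (\<Sum>(u,d,k)\<in>?G \<times> {1..q} \<times> {1..n}. r u / real u * (1 * (1 / (real k)\<^sup>2)))"
  proof (rule sum_le_included[where i = "\<lambda>(u,d,k). u * (d * k\<^sup>2)"])
    show "\<forall>x\<in>{m \<in> {1..n}. r m \<noteq> 0}. \<exists>y\<in>?G \<times> {1..q} \<times> {1..n}.
       (\<lambda>(u,d,k). u * (d * k\<^sup>2)) y = x \<and> r x / real x \<le> (case y of (u,d,k) \<Rightarrow> r u / real u * (1 * (1 / (real k)\<^sup>2)))"
    proof
      fix m assume m: "m \<in> {m \<in> {1..n}. r m \<noteq> 0}"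
      then obtain u d k where udk: "m = u * (d * k\<^sup>2)" "split u" "d dvd q" "d dvd m" "u dvd m" "r m \<le> r u"
        using r_nonzero_decomp[of m] by auto
      have pos: "m > 0" "u > 0" "d > 0" "k > 0" using udk m by (auto intro!: Nat.gr0I)
      have "k dvd m" unfolding udk(1) by (auto simp: power2_eq_square)
      hence "k \<le> n" "u \<le> n" using udk(5) m pos by (auto dest!: dvd_imp_le)
      moreover have "d \<le> q" using udk(3) q_pos by (auto dest: dvd_imp_le)
      moreover have "r m / real m \<le> r u / real u * (1 * (1 / (real k)\<^sup>2))"
      proof -
        have "r m / real m \<le> r u / (real u * (real k)\<^sup>2)"
        proof (intro frac_le)
          have "real (u * (1 * k\<^sup>2)) \<le> real m"
            unfolding udk(1) of_nat_le_iff using pos by (intro mult_le_mono) auto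
          thus "real u * (real k)\<^sup>2 \<le> real m" by simp
        qed (use udk pos r_nonneg in auto)
        thus ?thesis by simp
      qed
      ultimately show "\<exists>y\<in>?G \<times> {1..q} \<times> {1..n}.
       (\<lambda>(u,d,k). u * (d * k\<^sup>2)) y = m \<and> r m / real m \<le> (case y of (u,d,k) \<Rightarrow> r u / real u * (1 * (1 / (real k)\<^sup>2)))"
        using udk pos by (intro bexI[of _ "(u,d,k)"]) auto
    qed
  qed (use r_nonneg in auto)
  also have "\<dots> = (\<Sum>u\<in>?G. r u / real u) * ((\<Sum>d=1..q. 1) * (\<Sum>k=1..n. 1 / (real k)\<^sup>2))"
    by (simp only: sum_product sum.cartesian_product case_prod_unfold fst_conv snd_conv)
  also have "\<dots> \<le> (T n)\<^sup>2 * (real q * 2)"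
  proof (intro mult_mono)
    have "(\<Sum>u\<in>?G. r u / real u) = (\<Sum>u\<in>?G. \<Sum>a | a dvd u. 1 / real u)"
      by (intro sum.cong) (auto simp: r_split)
    also have "\<dots> = (\<Sum>(u,a)\<in>(SIGMA u:?G. {a. a dvd u}). 1 / real u)"
      by (subst sum.Sigma) auto
    also have "\<dots> \<le> (T n)\<^sup>2"
      unfolding T_square
    proof (rule sum_le_included[where i = "\<lambda>(a,b). (a * b, a)"])
      show "\<forall>x\<in>(SIGMA u:?G. {a. a dvd u}). \<exists>y\<in>?G \<times> ?G. (\<lambda>(a,b). (a * b, a)) y = x \<and>
         (case x of (u,a) \<Rightarrow> 1 / real u) \<le> (case y of (a,b) \<Rightarrow> 1 / real (a * b))"
      proof
        fix x assume "x \<in> (SIGMA u:?G. {a. a dvd u})"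
        then obtain u a where x: "x = (u,a)" and u: "u \<in> {1..n}" "split u" "a dvd u" by auto
        then obtain b where b: "u = a * b" by (auto elim: dvdE)
        have pos: "a > 0" "b > 0" using u b by (auto intro!: Nat.gr0I)
        have "a \<le> u" "b \<le> u" using b pos by auto
        hence "a \<le> n" "b \<le> n" using u by auto
        thus "\<exists>y\<in>?G \<times> ?G. (\<lambda>(a,b). (a * b, a)) y = x \<and>
         (case x of (u,a) \<Rightarrow> 1 / real u) \<le> (case y of (a,b) \<Rightarrow> 1 / real (a * b))"
          using u b pos unfolding x by (intro bexI[of _ "(a,b)"]) (auto simp: split_mult_iff)
      qed
    qed (auto intro!: finite_SigmaI)
    finally show "(\<Sum>u\<in>?G. r u / real u) \<le> (T n)\<^sup>2" .
  qed (use sum_inverse_squares_le in \<open>auto intro!: mult_nonneg_nonneg sum_nonneg\<close>)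
  finally show ?thesis by (simp add: mult_ac)
qed

lemma T_lower: "\<exists>c>0. \<exists>n0\<ge>1. \<forall>n\<ge>n0. c * sqrt (ln (real n)) \<le> T n"
proof -
  \<comment> \<open>Once ln n >= 2 B / L, the error B takes away at most half of L ln n, so L/2 * ln
    n <= 2 q (T n)^2.\<close>
  define c where "c = sqrt (L / (4 * real q))"
  obtain n0 :: nat where n0: "real n0 > exp (2 * B / L)" using reals_Archimedean2 by blast
  have e1: "exp (2 * B / L) \<ge> 1" using B_ge_1 L_pos by simp
  have "c * sqrt (ln (real n)) \<le> T n" if n: "n \<ge> n0" for n
  proof -
    have "real n > exp (2 * B / L)" using n n0 by linarith
    moreover from this have n1: "real n > 0" using e1 by linarith
    ultimately have "ln (real n) \<ge> 2 * B / L" by (simp only: ln_ge_iff less_imp_le)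
    hence "B \<le> L / 2 * ln (real n)" using L_pos by (simp add: field_simps)
    moreover have "L * ln (real n) \<le> L * harm n"
    proof (intro mult_left_mono)
      have "ln (real n) \<le> ln (real n + 1)" using n1 by simp
      also have "\<dots> \<le> harm n" by (rule harm_ge_ln)
      finally show "ln (real n) \<le> harm n" .
    qed (use L_pos in simp)
    ultimately have "L / 2 * ln (real n) \<le> (\<Sum>m=1..n. r m / real m)"
      using sum_r_div[of n] by linarith
    also have "\<dots> \<le> 2 * real q * (T n)\<^sup>2" by (rule sum_r_le_T_square)
    finally have "L / (4 * real q) * ln (real n) \<le> (T n)\<^sup>2"
      using q_pos by (simp add: field_simps)
    hence "sqrt (L / (4 * real q) * ln (real n)) \<le> T n"
      using T_nonneg by (rule real_le_lsqrt[rotated])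
    thus ?thesis by (simp only: c_def real_sqrt_mult)
  qed
  moreover have "c > 0" using L_pos q_pos by (simp add: c_def)
  moreover have "n0 \<ge> 1" using n0 e1 by linarith
  ultimately show ?thesis by blast
qed

lemma T_upper: "\<exists>C>0. \<forall>n\<ge>1. T n \<le> C * sqrt (1 + ln (real n))"
proof -
  define C where "C = sqrt (2 * L + B)"
  have "T n \<le> C * sqrt (1 + ln (real n))" if n: "n \<ge> 1" for n
  proof -
    have ln0: "ln (real n) \<ge> 0" using n by simp
    have "L * harm (n\<^sup>2) \<le> L * (1 + ln (real (n\<^sup>2)))"
      using harm_le[of "n\<^sup>2"] n L_pos by (intro mult_left_mono) auto
    also have "ln (real (n\<^sup>2)) = 2 * ln (real n)" using n by (simp add: ln_realpow)
    also have "L * (1 + 2 * ln (real n)) \<le> 2 * L * (1 + ln (real n))"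
      using L_pos by (simp add: algebra_simps)
    finally have "(T n)\<^sup>2 \<le> 2 * L * (1 + ln (real n)) + B"
      using T_square_le[of n] by linarith
    also have "2 * L * (1 + ln (real n)) + B \<le> (2 * L + B) * (1 + ln (real n))"
      using mult_nonneg_nonneg[OF _ ln0, of B] B_ge_1 by (simp add: algebra_simps)
    finally have "T n \<le> sqrt ((2 * L + B) * (1 + ln (real n)))"
      by (rule real_le_rsqrt)
    thus ?thesis by (simp add: C_def real_sqrt_mult)
  qed
  moreover have "C > 0" using L_pos B_ge_1 by (simp add: C_def)
  ultimately show ?thesis by blast
qed

text \<open>The indicator f of split integers is completely multiplicative, so ln = Lam * 1 becomes
  f ln = (f Lam) * f. This identity carries information on reciprocals over to counts.\<close>

lemma sum_split_ln:
  "(\<Sum>n | n \<in> {1..x} \<and> split n. ln (real n)) = (\<Sum>k | k \<in> {1..x} \<and> split k. theta (x div k))"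
proof -
  define f where "f n = (if split n then 1 else 0 :: real)" for n
  have f: "f (m * n) = f m * f n" for m n by (simp add: f_def split_mult_iff)
  have fil: "(\<Sum>n | n \<in> {1..m} \<and> split n. g n) = (\<Sum>n=1..m. f n * g n)" for g m
    by (rule sum.mono_neutral_cong_left) (auto simp: f_def)
  have "(\<Sum>n | n \<in> {1..x} \<and> split n. ln (real n)) = (\<Sum>n=1..x. f n * ln (real n))"
    by (rule fil)
  also have "\<dots> = (\<Sum>n=1..x. \<Sum>d | d dvd n. f d * Lam d * f (n div d))"
  proof (intro sum.cong refl)
    fix n assume n: "n \<in> {1..x}"
    have "f n * ln (real n) = (\<Sum>d | d dvd n. f n * Lam d)"
      using n mangoldt_sum[of n, where ?'a = real] by (simp flip: sum_distrib_left)
    also have "\<dots> = (\<Sum>d | d dvd n. f d * Lam d * f (n div d))"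
    proof (intro sum.cong refl)
      fix d assume "d \<in> {d. d dvd n}"
      hence "f n = f d * f (n div d)" by (simp flip: f)
      thus "f n * Lam d = f d * Lam d * f (n div d)" by simp
    qed
    finally show "f n * ln (real n) = (\<Sum>d | d dvd n. f d * Lam d * f (n div d))" .
  qed
  also have "\<dots> = (\<Sum>k=1..x. \<Sum>d=1..x div k. f d * Lam d * f k)"
    unfolding divisor_sum_swap[of "\<lambda>d k. f d * Lam d * f k"] by (rule divisor_sum_swap')
  also have "\<dots> = (\<Sum>k=1..x. f k * theta (x div k))"
    unfolding theta_def fil by (simp add: sum_distrib_left mult_ac)
  also have "\<dots> = (\<Sum>k | k \<in> {1..x} \<and> split k. theta (x div k))"
    by (rule fil [symmetric])
  finally show ?thesis .
qed

lemma theta_nonneg: "theta n \<ge> 0"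
  unfolding theta_def by (intro sum_nonneg) (auto simp: mangoldt_nonneg)

lemma theta_le_psi: "theta n \<le> psi n"
  unfolding theta_def psi_def by (intro sum_mono2) (auto simp: mangoldt_nonneg)

lemma cnt_le: "cnt n \<le> real n"
proof -
  have "card {k \<in> {1..n}. split k} \<le> card {1..n}" by (intro card_mono) auto
  thus ?thesis by (simp add: cnt_def)
qed

text \<open>The sum of ln k over split k <= n is at most cnt(n) ln n. By \<open>sum_split_ln\<close>
  and the lower bound for \<open>theta\<close> it is also at least a constant times n T(n div x1),
  of order n sqrt(ln n).\<close>

lemma cnt_lower:
  "\<exists>c>0. \<exists>n0\<ge>2. \<forall>n\<ge>n0. c * real n / sqrt (ln (real n)) \<le> cnt n"
proof -
  obtain c1 x1 where c1: "c1 > 0" "x1 \<ge> 1" "\<And>x. x \<ge> x1 \<Longrightarrow> c1 * real x \<le> theta x"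
    using theta_lower by blast
  obtain c2 n2 where c2: "c2 > 0" "n2 \<ge> 1" "\<And>n. n \<ge> n2 \<Longrightarrow> c2 * sqrt (ln (real n)) \<le> T n"
    using T_lower by blast
  define c where "c = c1 * c2 / 4"
  \<comment> \<open>The bound \<open>n2 * x1\<close> makes y = n div x1 at least n2; the square
    bound together with n < 2 x1 y gives n < y^2, so ln y is comparable with ln n.\<close>
  define n0 where "n0 = max 2 (max (n2 * x1) ((2 * x1) ^ 2))"
  have "c * real n / sqrt (ln (real n)) \<le> cnt n" if n: "n \<ge> n0" for n
  proof -
    define y where "y = n div x1"
    have n': "n \<ge> 2" "n2 * x1 \<le> n" "(2 * x1) ^ 2 \<le> n" using n by (auto simp: n0_def)
    have lnn: "ln (real n) > 0" using n' by simp
    have y: "y \<ge> n2" unfolding y_def using n'(2) c1 by (simp add: less_eq_div_iff_mult_less_eq)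
    hence y1: "y \<ge> 1" using c2 by simp
    have yn: "y \<le> n" by (simp add: y_def)
    have lny: "ln (real n) \<le> 4 * ln (real y)"
    proof -
      have "n < x1 * Suc y" unfolding y_def using c1 dividend_less_times_div[of x1 n] by simp
      also have "\<dots> \<le> x1 * (2 * y)" using y1 by (intro mult_le_mono) auto
      finally have 1: "n < 2 * x1 * y" by simp
      have "real ((2 * x1)\<^sup>2) * real n \<le> real n * real n" using n' by (intro mult_right_mono) (simp_all only: of_nat_le_iff of_nat_0_le_iff)
      also have "\<dots> < real (2 * x1 * y) * real (2 * x1 * y)"
        using 1 n' c1 y1 by (intro mult_strict_mono) (auto simp del: of_nat_mult)
      also have "\<dots> = real ((2 * x1)\<^sup>2) * (real y)\<^sup>2" by (simp add: power2_eq_square)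
      finally have "real n < (real y)\<^sup>2" by (rule mult_left_less_imp_less) simp
      hence "ln (real n) < ln ((real y)\<^sup>2)" using n' y1 by (subst ln_less_cancel_iff) auto
      also have "\<dots> = 2 * ln (real y)" using y1 by (simp add: ln_realpow)
      finally show ?thesis using ln_ge_zero[of "real y"] y1 by linarith
    qed
    have "c1 * real n / 2 * (c2 * (sqrt (ln (real n)) / 2)) \<le> c1 * real n / 2 * T y"
    proof (intro mult_left_mono)
      have "sqrt (ln (real n)) \<le> sqrt (4 * ln (real y))" using lny by simp
      also have "\<dots> = 2 * sqrt (ln (real y))" by (simp add: real_sqrt_mult)
      finally have "c2 * (sqrt (ln (real n)) / 2) \<le> c2 * sqrt (ln (real y))"
        using c2 by (intro mult_left_mono) auto
      also have "\<dots> \<le> T y" using c2 y by blast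
      finally show "c2 * (sqrt (ln (real n)) / 2) \<le> T y" .
    qed (use c1 in auto)
    also have "\<dots> = (\<Sum>k | k \<in> {1..y} \<and> split k. c1 * (real n / (2 * real k)))"
      by (simp add: T_def sum_distrib_left)
    also have "\<dots> \<le> (\<Sum>k | k \<in> {1..y} \<and> split k. theta (n div k))"
    proof (intro sum_mono)
      fix k assume "k \<in> {k. k \<in> {1..y} \<and> split k}"
      hence k: "k \<ge> 1" "k \<le> y" by auto
      have "x1 * k \<le> n" using k(2) c1 unfolding y_def by (simp add: less_eq_div_iff_mult_less_eq mult.commute)
      hence x1: "n div k \<ge> x1" using k by (simp add: less_eq_div_iff_mult_less_eq)
      hence d1: "n div k \<ge> 1" using c1 by simp
      have "n < k * Suc (n div k)" using k dividend_less_times_div[of k n] by simp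
      also have "\<dots> \<le> k * (2 * (n div k))" using d1 by (intro mult_le_mono) auto
      finally have "n \<le> 2 * k * (n div k)" by simp
      hence "real n \<le> 2 * real k * real (n div k)" by (metis of_nat_le_iff of_nat_mult of_nat_numeral)
      hence "real n / (2 * real k) \<le> real (n div k)" using k by (simp add: field_simps)
      hence "c1 * (real n / (2 * real k)) \<le> c1 * real (n div k)" using c1 by (intro mult_left_mono) auto
      also have "\<dots> \<le> theta (n div k)" using c1 x1 by blast
      finally show "c1 * (real n / (2 * real k)) \<le> theta (n div k)" .
    qed
    also have "\<dots> \<le> (\<Sum>k | k \<in> {1..n} \<and> split k. theta (n div k))"
      using yn by (intro sum_mono2) (auto simp: theta_nonneg)
    also have "\<dots> = (\<Sum>k | k \<in> {1..n} \<and> split k. ln (real k))" by (rule sum_split_ln [symmetric])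
    also have "\<dots> \<le> (\<Sum>k | k \<in> {1..n} \<and> split k. ln (real n))"
      by (intro sum_mono) auto
    also have "\<dots> = cnt n * ln (real n)" by (simp add: cnt_def)
    finally have le: "c * real n * sqrt (ln (real n)) \<le> cnt n * ln (real n)"
      by (simp add: c_def mult_ac)
    define u where "u = sqrt (ln (real n))"
    have u: "u > 0" "ln (real n) = u * u" using lnn by (simp_all add: u_def)
    have "c * real n * u \<le> cnt n * u * u"
      using le[folded u_def] unfolding u(2) by (simp only: mult.assoc)
    hence "c * real n \<le> cnt n * u" using u(1) by (simp only: mult_le_cancel_right_pos)
    thus ?thesis using u(1) unfolding u_def [symmetric] by (simp add: field_simps)
  qed
  moreover have "c > 0" "n0 \<ge> 2" using c1 c2 by (auto simp: c_def n0_def)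
  ultimately show ?thesis by blast
qed

text \<open>The bound theta(n div k) <= 4n/k makes the sum of ln k over split k at most 4 n T(n).
  Writing 1 + ln n instead of ln n keeps the square root at least 1 from n = 1 on.\<close>

lemma cnt_upper:
  "\<exists>C>0. \<forall>n\<ge>1. cnt n * sqrt (1 + ln (real n)) \<le> C * real n"
proof -
  obtain C where C: "C > 0" "\<And>n. n \<ge> 1 \<Longrightarrow> T n \<le> C * sqrt (1 + ln (real n))"
    using T_upper by blast
  have "cnt n * sqrt (1 + ln (real n)) \<le> (4 * C + 2) * real n" if n: "n \<ge> 1" for n
  proof -
    let ?G = "{k. k \<in> {1..n} \<and> split k}"
    define s where "s = sqrt (1 + ln (real n))"
    have ln0: "ln (real n) \<ge> 0" using n by simp
    have s: "s \<ge> 1" "s * s = 1 + ln (real n)" using ln0 by (auto simp: s_def)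
    have 1: "(\<Sum>k\<in>?G. ln (real k)) \<le> 4 * real n * T n"
    proof -
      have "(\<Sum>k\<in>?G. ln (real k)) = (\<Sum>k\<in>?G. theta (n div k))" by (rule sum_split_ln)
      also have "\<dots> \<le> (\<Sum>k\<in>?G. 4 * real n * (1 / real k))"
      proof (intro sum_mono)
        fix k
        have "theta (n div k) \<le> 4 * real (n div k)" using theta_le_psi psi_le order.trans by blast
        also have "\<dots> \<le> 4 * (real n / real k)" by (intro mult_left_mono of_nat_div_le_of_nat) auto
        finally show "theta (n div k) \<le> 4 * real n * (1 / real k)" by simp
      qed
      also have "\<dots> = 4 * real n * T n" by (simp only: T_def sum_distrib_left)
      finally show ?thesis .
    qed
    \<comment> \<open>Replacing ln k by ln n is cheap: even over all k <= n the total loss is n ln n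
      - ln n! <= n.\<close>
    have 2: "(\<Sum>k\<in>?G. ln (real n) - ln (real k)) \<le> real n"
    proof -
      have "(\<Sum>k\<in>?G. ln (real n) - ln (real k)) \<le> (\<Sum>k=1..n. ln (real n) - ln (real k))"
        by (intro sum_mono2) auto
      also have "\<dots> = real n * ln (real n) - ln (fact n)"
        by (simp add: sum_subtractf ln_fact_eq)
      also have "\<dots> \<le> real n" using ln_fact_bounds[of n] by linarith
      finally show ?thesis .
    qed
    have "cnt n * ln (real n) = (\<Sum>k\<in>?G. ln (real k)) + (\<Sum>k\<in>?G. ln (real n) - ln (real k))"
      by (simp add: cnt_def flip: sum.distrib)
    also have "\<dots> \<le> 4 * real n * T n + real n" using 1 2 by (rule add_mono)
    finally have "cnt n * (1 + ln (real n)) \<le> 4 * real n * T n + 2 * real n"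
      using cnt_le[of n] by (simp add: algebra_simps)
    also have "4 * real n * T n \<le> 4 * real n * (C * s)"
      unfolding s_def using C n by (intro mult_left_mono) auto
    also have "2 * real n \<le> 2 * real n * s" using s mult_left_mono[of 1 s "2 * real n"] by simp
    finally have "cnt n * s * s \<le> (4 * C + 2) * real n * s"
      unfolding s(2) [symmetric] by (simp add: algebra_simps)
    thus ?thesis using s unfolding s_def [symmetric] by (simp only: mult_le_cancel_right_pos less_le_trans[OF zero_less_one])
  qed
  moreover have "4 * C + 2 > 0" using C by simp
  ultimately show ?thesis by blast
qed

text \<open>The bound pays for passing from n to n/w in the logarithm. The fourth root suffices: for
  w = d k^2 it is of order sqrt k, and the sum of sqrt k / k^2 converges.\<close>

lemma sqrt_one_plus_ln_le:
  assumes "w > 0"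
  shows "sqrt (1 + ln (2 * real (w::nat))) \<le> 2 * sqrt (sqrt (real w))"
proof -
  have "1 + ln (2 * real w) = 1 + ln 2 + 2 * ln (sqrt (real w))"
    using assms by (simp add: ln_mult ln_sqrt)
  also have "ln 2 \<le> (1::real)" using ln_le_minus_one[of "2::real"] by simp
  also have "ln (sqrt (real w)) \<le> sqrt (real w) - 1" using assms by (intro ln_le_minus_one) auto
  finally have "1 + ln (2 * real w) \<le> 1 + 1 + 2 * (sqrt (real w) - 1)" by simp
  moreover have "sqrt (real w) \<ge> 0" by simp
  ultimately have "1 + ln (2 * real w) \<le> 4 * sqrt (real w)" by argo
  hence "sqrt (1 + ln (2 * real w)) \<le> sqrt (4 * sqrt (real w))" by (rule real_sqrt_le_mono)
  thus ?thesis by (simp add: real_sqrt_mult)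
qed

text \<open>For fixed w = d k^2 there are at most cnt(n div w) choices of u. Replacing the logarithm
  of n div w by that of n loses a factor O(w^(1/4)), and the sum over d <= q and all k still
  converges.\<close>

lemma card_split_times_square:
  assumes A: "\<And>n. n \<in> A \<Longrightarrow> n > 0 \<and> (\<exists>u d k. n = u * (d * k\<^sup>2) \<and> split u \<and> d dvd q)"
  shows "\<exists>C>0. \<forall>n\<ge>1. real (card (A \<inter> {1..n})) * sqrt (1 + ln (real n)) \<le> C * real n"
proof -
  obtain C where C: "C > 0" "\<And>n. n \<ge> 1 \<Longrightarrow> cnt n * sqrt (1 + ln (real n)) \<le> C * real n"
    using cnt_upper by blast
  obtain K where K: "K \<ge> 0" "\<And>n. (\<Sum>k=1..n. sqrt (real k) / (real k)\<^sup>2) \<le> K"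
    using summable_sqrt_div_square by blast
  \<comment> \<open>The added 1 keeps the constant positive, as K is only known to be
    nonnegative.\<close>
  have "real (card (A \<inter> {1..n})) * sqrt (1 + ln (real n)) \<le> (2 * C * real q * real q * K + 1) * real n" if n: "n \<ge> 1" for n
  proof -
    define s where "s = sqrt (1 + ln (real n))"
    have s: "s \<ge> 0" using n by (simp add: s_def)
    define Z where "Z d k = (\<lambda>u. u * (d * k\<^sup>2)) ` {u \<in> {1..n div (d * k\<^sup>2)}. split u}" for d k
    have fin: "finite (Z d k)" for d k by (simp add: Z_def)
    have "A \<inter> {1..n} \<subseteq> (\<Union>(d,k)\<in>{1..q}\<times>{1..n}. Z d k)"
    proof
      fix m assume m: "m \<in> A \<inter> {1..n}"
      then obtain u d k where udk: "m = u * (d * k\<^sup>2)" "split u" "d dvd q" using A by blast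
      have pos: "u > 0" "d > 0" "k > 0" using udk m by (auto intro!: Nat.gr0I)
      have "k \<le> k\<^sup>2" by (simp add: power2_eq_square)
      also have "k\<^sup>2 \<le> m" unfolding udk(1) using pos by simp
      finally have "k \<le> n" using m by simp
      moreover have "d \<le> q" using udk(3) q_pos by (auto dest: dvd_imp_le)
      moreover have "u \<le> n div (d * k\<^sup>2)"
        using m udk pos by (simp add: less_eq_div_iff_mult_less_eq)
      hence "m \<in> Z d k" unfolding Z_def udk(1) using udk pos by (intro imageI) auto
      ultimately show "m \<in> (\<Union>(d,k)\<in>{1..q}\<times>{1..n}. Z d k)" using pos
        by (intro UN_I[of "(d,k)"]) auto
    qed
    hence "card (A \<inter> {1..n}) \<le> card (\<Union>(d,k)\<in>{1..q}\<times>{1..n}. Z d k)"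
      by (intro card_mono) (auto simp: fin)
    also have "\<dots> \<le> (\<Sum>(d,k)\<in>{1..q}\<times>{1..n}. card (Z d k))"
      using card_UN_le[of "{1..q}\<times>{1..n}" "\<lambda>(d,k). Z d k"] by (simp add: case_prod_unfold)
    finally have "real (card (A \<inter> {1..n})) * s \<le> real (\<Sum>(d,k)\<in>{1..q}\<times>{1..n}. card (Z d k)) * s"
      using s by (intro mult_right_mono) (simp_all only: of_nat_le_iff)
    also have "\<dots> = (\<Sum>(d,k)\<in>{1..q}\<times>{1..n}. real (card (Z d k)) * s)"
      by (simp add: sum_distrib_right case_prod_unfold)
    also have "\<dots> \<le> (\<Sum>(d,k)\<in>{1..q}\<times>{1..n}. (2 * C * real q * real n) * (1 * (sqrt (real k) / (real k)\<^sup>2)))"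
    proof (intro sum_mono, clarify)
      fix d k assume dk: "d \<in> {1..q}" "k \<in> {1..n}"
      define w where "w = d * k\<^sup>2"
      have w: "w > 0" using dk by (simp add: w_def)
      have "real (card (Z d k)) * s \<le> (2 * C * real q * real n) * (sqrt (real k) / (real k)\<^sup>2)"
      proof (cases "w \<le> n")
        case True
        define y where "y = n div w"
        have y: "y \<ge> 1" using True w by (simp add: y_def Suc_le_eq div_greater_zero_iff)
        have cZ: "real (card (Z d k)) \<le> cnt y"
          unfolding Z_def cnt_def y_def w_def by (simp add: card_image_le)
        have "n < w * Suc y" unfolding y_def using w dividend_less_times_div[of w n] by simp
        also have "\<dots> \<le> w * (2 * y)" using y by (intro mult_le_mono) auto
        finally have "n \<le> y * (2 * w)" by (simp add: mult_ac)
        hence "ln (real n) \<le> ln (real (y * (2 * w)))" using n y w by (subst ln_le_cancel_iff) (auto simp del: of_nat_mult)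
        also have "\<dots> = ln (real y) + ln (2 * real w)" using y w by (simp add: ln_mult)
        finally have ln_le: "ln (real n) \<le> ln (real y) + ln (2 * real w)" .
        \<comment> \<open>This is 1 + s + t <= (1 + s)(1 + t) for nonnegative s and t; it separates
          the dependence on w.\<close>
        have "1 + ln (real n) \<le> (1 + ln (real y)) * (1 + ln (2 * real w))"
        proof -
          have "ln (real y) * ln (2 * real w) \<ge> 0"
            using y w by (intro mult_nonneg_nonneg ln_ge_zero) auto
          with ln_le show ?thesis by (simp add: algebra_simps)
        qed
        hence "s \<le> sqrt (1 + ln (real y)) * sqrt (1 + ln (2 * real w))"
          unfolding s_def real_sqrt_mult [symmetric] by (rule real_sqrt_le_mono)
        hence "real (card (Z d k)) * s \<le> cnt y * (sqrt (1 + ln (real y)) * sqrt (1 + ln (2 * real w)))"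
          using cZ s by (intro mult_mono) (auto simp: cnt_def)
        also have "\<dots> = (cnt y * sqrt (1 + ln (real y))) * sqrt (1 + ln (2 * real w))" by simp
        also have "\<dots> \<le> (C * real y) * (2 * sqrt (sqrt (real w)))"
          using C(1) w by (intro mult_mono[OF C(2)[OF y] sqrt_one_plus_ln_le[OF w]]) auto
        also have "real y \<le> real n / real w" unfolding y_def by (rule of_nat_div_le_of_nat)
        hence "(C * real y) * (2 * sqrt (sqrt (real w))) \<le> (C * (real n / real w)) * (2 * sqrt (sqrt (real w)))"
          using C by (intro mult_right_mono mult_left_mono) auto
        also have "\<dots> \<le> (C * (real n / (real k)\<^sup>2)) * (2 * (real q * sqrt (real k)))"
        proof (intro mult_mono)
          have "real (1 * k\<^sup>2) \<le> real w" unfolding w_def of_nat_le_iff using dk by (intro mult_le_mono) auto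
          hence "(real k)\<^sup>2 \<le> real w" by simp
          thus "real n / real w \<le> real n / (real k)\<^sup>2"
            using dk by (intro divide_left_mono) (auto simp: w)
          \<comment> \<open>The weakening of d <= q to q^4 makes the fourth root equal to q times
            sqrt k.\<close>
          have "real w \<le> real (q ^ 4 * k\<^sup>2)"
            unfolding w_def of_nat_le_iff
          proof (intro mult_le_mono order_refl)
            have "d \<le> q ^ 1" using dk by simp
            also have "\<dots> \<le> q ^ 4" using q_pos by (intro power_increasing) auto
            finally show "d \<le> q ^ 4" .
          qed
          hence "sqrt (sqrt (real w)) \<le> sqrt (sqrt (((real q)\<^sup>2)\<^sup>2 * (real k)\<^sup>2))" by simp
          also have "\<dots> = real q * sqrt (real k)"
            by (simp only: real_sqrt_mult real_sqrt_abs abs_power2 abs_of_nat)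
          finally show "sqrt (sqrt (real w)) \<le> real q * sqrt (real k)" .
        qed (use C in auto)
        also have "\<dots> = (2 * C * real q * real n) * (sqrt (real k) / (real k)\<^sup>2)" by simp
        finally show ?thesis .
      next
        case False
        hence "n div w = 0" by simp
        hence "Z d k = {}" by (auto simp: Z_def w_def)
        thus ?thesis using C by simp
      qed
      thus "real (card (Z d k)) * s \<le> (2 * C * real q * real n) * (1 * (sqrt (real k) / (real k)\<^sup>2))" by simp
    qed
    also have "\<dots> = (2 * C * real q * real n) * ((\<Sum>d=1..q. 1) * (\<Sum>k=1..n. sqrt (real k) / (real k)\<^sup>2))"
      unfolding sum_product sum.cartesian_product by (simp add: sum_distrib_left case_prod_unfold)
    also have "\<dots> \<le> (2 * C * real q * real n) * (real q * K)"
      using K C by (intro mult_left_mono) (auto intro!: mult_left_mono)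
    also have "\<dots> \<le> (2 * C * real q * real q * K + 1) * real n" by (simp add: algebra_simps)
    finally show ?thesis unfolding s_def .
  qed
  moreover have "2 * C * real q * real q * K + 1 > 0" using C K by (auto intro!: add_nonneg_pos)
  ultimately show ?thesis by blast
qed

text \<open>A new split prime power p^k does not divide the least common multiple so far, since no x
  < p^k is divisible by p^k. But p^(k-1) is split and does divide it, so the least common multiple
  grows by exactly p = exp(Lam(p^k)).\<close>

lemma ln_Lcm_split_ge: "theta n \<le> ln (real (Lcm {k \<in> {1..n}. split k}))"
proof (induction n)
  case 0 then show ?case by (simp add: theta_def)
next
  case (Suc n)
  define L' where "L' = Lcm {k \<in> {1..n}. split k}"
  have L': "L' > 0" unfolding L'_def by (auto intro!: Nat.gr0I simp: Lcm_0_iff)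
  show ?case
  proof (cases "split (Suc n)")
    case False
    hence "{k \<in> {1..Suc n}. split k} = {k \<in> {1..n}. split k}"
      by (auto simp: le_Suc_eq)
    with Suc show ?thesis by (simp add: theta_def)
  next
    case True
    have eq: "{k \<in> {1..Suc n}. split k} = insert (Suc n) {k \<in> {1..n}. split k}"
      using True by (auto simp: le_Suc_eq)
    have th: "theta (Suc n) = theta n + Lam (Suc n)"
      using eq by (simp add: theta_def)
    define M where "M = lcm (Suc n) L'"
    have M: "M > 0" using L' by (auto simp: M_def intro!: Nat.gr0I simp: lcm_eq_0_iff)
    have "exp (Lam (Suc n)) * real L' \<le> real M"
    proof (cases "primepow (Suc n)")
      case True
      then obtain p k where pk: "prime p" "k > 0" "Suc n = p ^ k"
        by (auto simp: primepow_def)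
      have "\<not> p ^ k dvd L'"
      proof
        assume "p ^ k dvd L'"
        have dv: "multiplicity p x < k" if "x \<in> {1..n}" for x
        proof (rule ccontr)
          assume "\<not> multiplicity p x < k"
          hence "p ^ k dvd x" by (intro multiplicity_dvd') auto
          hence "p ^ k \<le> x" using that by (auto dest: dvd_imp_le)
          thus False using that pk by auto
        qed
        have "L' dvd Lcm {1..n}" unfolding L'_def by (intro Lcm_subset) auto
        have "\<not> p ^ k dvd Lcm {1..m}" if "m \<le> n" for m
          using that
        proof (induction m)
          case (Suc m)
          have "Lcm {1..Suc m} = lcm (Suc m) (Lcm {1..m})" by (simp add: atLeastAtMostSuc_conv)
          moreover have "Lcm {1..m} \<noteq> 0" by (auto simp: Lcm_0_iff)
          ultimately have "multiplicity p (Lcm {1..Suc m}) = max (multiplicity p (Suc m)) (multiplicity p (Lcm {1..m}))"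
            using pk by (simp add: multiplicity_lcm)
          moreover have "multiplicity p (Lcm {1..m}) < k"
            using Suc \<open>Lcm {1..m} \<noteq> 0\<close> pk by (metis multiplicity_dvd' not_less Suc_leD)
          ultimately have "multiplicity p (Lcm {1..Suc m}) < k" using dv[of "Suc m"] Suc.prems by simp
          moreover have "Lcm {1..Suc m} \<noteq> 0" by (auto simp: Lcm_0_iff)
          ultimately show ?case using pk
            by (metis not_less multiplicity_geI not_prime_unit)
        qed (use pk in \<open>auto dest: prime_gt_1_nat\<close>)
        thus False using \<open>p ^ k dvd L'\<close> \<open>L' dvd Lcm {1..n}\<close> dvd_trans by blast
      qed
      hence "M \<noteq> L'" unfolding M_def using pk by (metis dvd_lcm1)
      have "M dvd p * L'"
      proof -
        have sp: "split (p ^ (k - 1))" using \<open>split (Suc n)\<close> pk by (metis split_dvd le_imp_power_dvd diff_le_self)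
        have "p ^ (k-1) < p ^ k" using pk prime_gt_1_nat by (intro power_strict_increasing) auto
        hence "p ^ (k - 1) \<in> {k \<in> {1..n}. split k}" using pk sp by (auto simp: Suc_le_eq prime_gt_0_nat)
        hence "p ^ (k-1) dvd L'" unfolding L'_def by (rule dvd_Lcm)
        hence "p * p ^ (k-1) dvd p * L'" by simp
        also have "p * p ^ (k-1) = p ^ k" using pk by (cases k) auto
        finally show ?thesis unfolding M_def using pk by simp
      qed
      moreover obtain t where t: "M = L' * t" unfolding M_def by (meson dvd_lcm2 dvdE)
      ultimately have "t dvd p" using L' by (simp add: mult.commute)
      hence "t = p" using pk t \<open>M \<noteq> L'\<close> by (metis mult_1_right prime_nat_iff)
      moreover have "exp (Lam (Suc n)) = real p"
        using pk by (simp add: prime_gt_0_nat)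
      ultimately show ?thesis using t by simp
    next
      case False
      hence "Lam (Suc n) = 0" by (simp add: mangoldt_def)
      moreover have "L' dvd M" by (simp add: M_def)
      hence "L' \<le> M" using M by (auto dest: dvd_imp_le)
      ultimately show ?thesis by simp
    qed
    hence "ln (exp (Lam (Suc n)) * real L') \<le> ln (real M)"
      using L' M by (subst ln_le_cancel_iff) auto
    hence "Lam (Suc n) + ln (real L') \<le> ln (real M)" using L' by (simp add: ln_mult)
    moreover have "Lcm {k \<in> {1..Suc n}. split k} = M"
      unfolding eq M_def L'_def by simp
    ultimately show ?thesis using Suc by (simp add: th L'_def)
  qed
qed

end

section \<open>The quadratic character of a discriminant\<close>

text \<open>Two elements of {-1, 0, 1} differ by at most 2 < p, so the congruences of Euler's
  criterion become equalities.\<close>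

lemma cong_imp_eq_of_small:
  assumes "[a = b] (mod int p)" "p > 2" "a = 0 \<or> a = 1 \<or> a = -1" "b = 0 \<or> b = 1 \<or> b = -1"
  shows "a = b"
proof -
  have "int p dvd a - b" using assms(1) by (simp add: cong_iff_dvd_diff)
  moreover have "\<bar>a - b\<bar> < int p" using assms by auto
  ultimately show ?thesis using zdvd_not_zless[of "\<bar>a - b\<bar>" "int p"] by auto
qed

lemma Legendre_mult:
  assumes "prime p" "p > 2"
  shows "Legendre (a * b) (int p) = Legendre a (int p) * Legendre b (int p)"
proof (rule cong_imp_eq_of_small[OF _ assms(2)])
  have "[Legendre (a * b) (int p) = a ^ ((p - 1) div 2) * b ^ ((p - 1) div 2)] (mod int p)"
    using euler_criterion[OF assms, of "a * b"] by (simp add: power_mult_distrib)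
  moreover have "[Legendre a (int p) * Legendre b (int p) = a ^ ((p - 1) div 2) * b ^ ((p - 1) div 2)] (mod int p)"
    using euler_criterion[OF assms] by (intro cong_mult) auto
  ultimately show "[Legendre (a * b) (int p) = Legendre a (int p) * Legendre b (int p)] (mod int p)"
    using cong_sym cong_trans by blast
qed (auto simp: Legendre_def)

lemma Legendre_minus_one:
  assumes "prime p" "p > 2"
  shows "Legendre (-1) (int p) = (if p mod 4 = 1 then 1 else -1)"
proof (rule cong_imp_eq_of_small[OF _ assms(2)])
  have odd: "odd p" using assms prime_odd_nat by blast
  have "(-1::int) ^ ((p - 1) div 2) = (if p mod 4 = 1 then 1 else -1)"
  proof (cases "p mod 4 = 1")
    case True
    hence "even ((p - 1) div 2)" by presburger
    with True show ?thesis by simp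
  next
    case False
    hence "odd ((p - 1) div 2)" using odd by presburger
    with False show ?thesis by simp
  qed
  thus "[Legendre (-1) (int p) = (if p mod 4 = 1 then 1 else -1)] (mod int p)"
    using euler_criterion[OF assms, of "-1"] by simp
qed (auto simp: Legendre_def)

text \<open>Gauss's lemma for p = 2h + 1: the doubles 2x with x <= h are already reduced modulo p
  and exceed h exactly for x > h div 2. The parity of h - h div 2 depends on p modulo 8
  only.\<close>

lemma Legendre_two:
  assumes "prime p" "p > 2"
  shows "Legendre 2 (int p) = (if p mod 8 = 1 \<or> p mod 8 = 7 then 1 else -1)"
proof -
  have odd: "odd p" using assms prime_odd_nat by blast
  have G: "GAUSS p 2"
  proof
    show "[2 \<noteq> 0] (mod int p)"
      using assms by (auto simp: cong_0_iff dest!: zdvd_imp_le)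
  qed (use assms in auto)
  define h where "h = (int p - 1) div 2"
  have h: "int p = 2 * h + 1" "h > 0" using odd assms unfolding h_def by presburger+
  have E: "GAUSS.E p 2 = (\<lambda>x. x * 2) ` {h div 2<..h}"
  proof -
    have "(\<lambda>x. x * 2 mod int p) ` {0<..h} = (\<lambda>x. x * 2) ` {0<..h}"
      using h by (intro image_cong) auto
    hence "GAUSS.C p 2 = (\<lambda>x. x * 2) ` {0<..h}"
      unfolding GAUSS.C_def[OF G] GAUSS.B_def[OF G] GAUSS.A_def[OF G] h_def [symmetric] image_image .
    hence "GAUSS.E p 2 = (\<lambda>x. x * 2) ` {0<..h} \<inter> {h<..}"
      unfolding GAUSS.E_def[OF G] h_def [symmetric] by simp
    also have "\<dots> = (\<lambda>x. x * 2) ` {h div 2<..h}"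
    proof (intro equalityI subsetI)
      fix y assume "y \<in> (\<lambda>x. x * 2) ` {0<..h} \<inter> {h<..}"
      then obtain x where "y = x * 2" "0 < x" "x \<le> h" "h < x * 2" by auto
      moreover from this have "h div 2 < x" by linarith
      ultimately show "y \<in> (\<lambda>x. x * 2) ` {h div 2<..h}" by auto
    next
      fix y assume "y \<in> (\<lambda>x. x * 2) ` {h div 2<..h}"
      then obtain x where "y = x * 2" "h div 2 < x" "x \<le> h" by auto
      moreover from this h have "h < x * 2" "0 < x" by linarith+
      ultimately show "y \<in> (\<lambda>x. x * 2) ` {0<..h} \<inter> {h<..}" by auto
    qed
    finally show ?thesis .
  qed
  have "card (GAUSS.E p 2) = nat (h - h div 2)"
    unfolding E by (subst card_image) (auto simp: inj_on_def)
  hence L: "Legendre 2 (int p) = (-1) ^ nat (h - h div 2)"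
    using GAUSS.gauss_lemma[OF G] by simp
  have pm: "int p mod 8 = int (p mod 8)" by (simp add: zmod_int)
  show ?thesis
  proof (cases "p mod 8 = 1 \<or> p mod 8 = 7")
    case True
    hence "int p mod 8 = 1 \<or> int p mod 8 = 7" unfolding pm by auto
    hence "h mod 4 = 0 \<or> h mod 4 = 3" unfolding h(1) by presburger
    then obtain k where "h = 4 * k \<or> h = 4 * k + 3" by (metis add_0_right mult_div_mod_eq)
    moreover have "(4 * k + 3) div 2 = 2 * k + 1" by simp
    ultimately have "even (h - h div 2)" by auto
    hence "even (nat (h - h div 2))" using h by (simp add: even_nat_iff)
    with True L show ?thesis by simp
  next
    case False
    hence "int p mod 8 \<noteq> 1 \<and> int p mod 8 \<noteq> 7" unfolding pm by auto
    hence "h mod 4 = 1 \<or> h mod 4 = 2" unfolding h(1) by presburger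
    then obtain k where "h = 4 * k + 1 \<or> h = 4 * k + 2" by (metis mult_div_mod_eq)
    moreover have "(4 * k + 1) div 2 = 2 * k" "(4 * k + 2) div 2 = 2 * k + 1" by simp_all
    ultimately have "odd (h - h div 2)" by auto
    hence "odd (nat (h - h div 2))" using h by (simp add: even_nat_iff)
    with False L show ?thesis by simp
  qed
qed

text \<open>An axiomatic stand-in for the Kronecker symbol (d/n). As a relation it can be satisfied
  by multiplying solutions over the factorization of d, and the uniform period 8d serves -1, 2 and
  the odd primes alike. Periodicity in n is the content of quadratic reciprocity; values at n not
  coprime to 2d are unconstrained.\<close>

definition quad_char :: "int \<Rightarrow> (nat \<Rightarrow> int) \<Rightarrow> bool" where
  "quad_char d \<psi> \<longleftrightarrow>
     (\<forall>m n. coprime (int m) (2 * d) \<longrightarrow> coprime (int n) (2 * d) \<longrightarrow> \<psi> (m * n) = \<psi> m * \<psi> n) \<and>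
     (\<forall>n. coprime (int n) (2 * d) \<longrightarrow> \<psi> n = 1 \<or> \<psi> n = -1) \<and>
     (\<forall>m n. coprime (int m) (2 * d) \<longrightarrow> [int m = int n] (mod 8 * d) \<longrightarrow> \<psi> m = \<psi> n) \<and>
     (\<forall>p. prime p \<longrightarrow> coprime (int p) (2 * d) \<longrightarrow> \<psi> p = Legendre d (int p))"

lemma quad_charD:
  assumes "quad_char d \<psi>"
  shows "\<And>m n. coprime (int m) (2 * d) \<Longrightarrow> coprime (int n) (2 * d) \<Longrightarrow> \<psi> (m * n) = \<psi> m * \<psi> n"
    and "\<And>n. coprime (int n) (2 * d) \<Longrightarrow> \<psi> n = 1 \<or> \<psi> n = -1"
    and "\<And>m n. coprime (int m) (2 * d) \<Longrightarrow> [int m = int n] (mod 8 * d) \<Longrightarrow> \<psi> m = \<psi> n"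
    and "\<And>p. prime p \<Longrightarrow> coprime (int p) (2 * d) \<Longrightarrow> \<psi> p = Legendre d (int p)"
  using assms unfolding quad_char_def by simp_all

lemma prime_coprime_2_gt_2:
  assumes "prime p" "coprime (int p) (2 * d)"
  shows "p > 2"
proof -
  have "p \<noteq> 2" using assms(2) by auto
  with prime_ge_2_nat[OF assms(1)] show ?thesis by simp
qed

lemma quad_char_mult:
  assumes "quad_char d \<psi>" "quad_char e \<phi>"
  shows "quad_char (d * e) (\<lambda>n. \<psi> n * \<phi> n)"
proof -
  have c: "coprime (int n) (2 * d)" "coprime (int n) (2 * e)" if "coprime (int n) (2 * (d * e))" for n
    using that by auto
  have m: "[int m = int n] (mod 8 * d)" "[int m = int n] (mod 8 * e)"
    if "[int m = int n] (mod 8 * (d * e))" for m n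
    using that by (auto simp: cong_iff_dvd_diff elim!: dvd_trans[rotated])
  show ?thesis
    unfolding quad_char_def
  proof (intro conjI allI impI)
    fix m n assume "coprime (int m) (2 * (d * e))" "coprime (int n) (2 * (d * e))"
    with c have "\<psi> (m * n) = \<psi> m * \<psi> n" "\<phi> (m * n) = \<phi> m * \<phi> n"
      by (simp_all add: quad_charD(1)[OF assms(1)] quad_charD(1)[OF assms(2)])
    thus "\<psi> (m * n) * \<phi> (m * n) = \<psi> m * \<phi> m * (\<psi> n * \<phi> n)" by simp
  next
    fix n assume "coprime (int n) (2 * (d * e))"
    with c have "\<psi> n = 1 \<or> \<psi> n = -1" "\<phi> n = 1 \<or> \<phi> n = -1"
      by (intro quad_charD(2)[OF assms(1)] quad_charD(2)[OF assms(2)]; blast)+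
    thus "\<psi> n * \<phi> n = 1 \<or> \<psi> n * \<phi> n = -1" by auto
  next
    fix m n assume "coprime (int m) (2 * (d * e))" "[int m = int n] (mod 8 * (d * e))"
    with c m have "\<psi> m = \<psi> n" "\<phi> m = \<phi> n"
      by (intro quad_charD(3)[OF assms(1)] quad_charD(3)[OF assms(2)]; blast)+
    thus "\<psi> m * \<phi> m = \<psi> n * \<phi> n" by simp
  next
    fix p assume p: "prime p" "coprime (int p) (2 * (d * e))"
    with c have "\<psi> p = Legendre d (int p)" "\<phi> p = Legendre e (int p)"
      by (intro quad_charD(4)[OF assms(1)] quad_charD(4)[OF assms(2)]; blast)+
    thus "\<psi> p * \<phi> p = Legendre (d * e) (int p)"
      using Legendre_mult[OF p(1)] prime_coprime_2_gt_2[OF p] by simp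
  qed
qed

lemma quad_char_one: "quad_char 1 (\<lambda>_. 1)"
proof -
  have "Legendre 1 (int p) = 1" if "prime p" for p
    using that by (auto simp: Legendre_def QuadRes_def cong_0_iff dest: prime_gt_1_nat intro!: exI[of _ 1])
  thus ?thesis by (simp add: quad_char_def)
qed

lemma odd_mod_8: "odd n \<Longrightarrow> n mod 8 = 1 \<or> n mod 8 = 3 \<or> n mod 8 = 5 \<or> n mod 8 = (7::nat)"
  by presburger

lemma cong_mod_8: "[int m = int n] (mod 8 * d) \<Longrightarrow> m mod 8 = n mod 8"
proof -
  assume "[int m = int n] (mod 8 * d)"
  hence "[int m = int n] (mod int 8)" by (rule cong_dvd_modulus) simp
  hence "[m = n] (mod 8)" by (simp only: cong_int_iff)
  thus ?thesis by (simp only: cong_def)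
qed

lemma cong_mod_4: "[int m = int n] (mod 8 * d) \<Longrightarrow> m mod 4 = n mod 4"
proof -
  assume "[int m = int n] (mod 8 * d)"
  hence "m mod 8 mod 4 = n mod 8 mod 4" by (simp only: cong_mod_8)
  thus ?thesis by (simp add: mod_mod_cancel)
qed

lemma quad_char_minus_one: "quad_char (-1) (\<lambda>n. if n mod 4 = 1 then 1 else -1)"
  unfolding quad_char_def
proof (intro conjI allI impI)
  fix m n assume "coprime (int m) (2 * -1)" "coprime (int n) (2 * -1)"
  hence "m mod 4 = 1 \<or> m mod 4 = 3" "n mod 4 = 1 \<or> n mod 4 = 3" by (simp_all, presburger+)
  moreover have mod_case: "(if a * b mod 4 = 1 then 1 else -1) = (if a = 1 then 1 else -1) * (if b = 1 then 1 else - (1::int))"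
    if "a = 1 \<or> a = 3" "b = 1 \<or> b = 3" for a b :: nat
    using that by (elim disjE) simp_all
  ultimately show "(if m * n mod 4 = 1 then 1 else -1) = (if m mod 4 = 1 then 1 else -1) * (if n mod 4 = 1 then 1 else - (1::int))"
    using mod_case[of "m mod 4" "n mod 4"] by (simp only: mod_mult_eq)
next
  fix m n assume "[int m = int n] (mod 8 * -1)"
  hence "m mod 4 = n mod 4" by (rule cong_mod_4)
  thus "(if m mod 4 = 1 then 1 else -1) = (if n mod 4 = 1 then 1 else - (1::int))" by simp
next
  fix p assume "prime p" "coprime (int p) (2 * -1)"
  thus "(if p mod 4 = 1 then 1 else -1) = Legendre (-1) (int p)"
    using Legendre_minus_one prime_coprime_2_gt_2 by metis
qed auto

lemma quad_char_two: "quad_char 2 (\<lambda>n. if n mod 8 = 1 \<or> n mod 8 = 7 then 1 else -1)"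
  unfolding quad_char_def
proof (intro conjI allI impI)
  fix m n assume "coprime (int m) (2 * 2)" "coprime (int n) (2 * 2)"
  hence "odd m" "odd n" by (auto simp: coprime_mult_right_iff)
  have mod_case: "(if a * b mod 8 = 1 \<or> a * b mod 8 = 7 then 1 else -1) =
     (if a = 1 \<or> a = 7 then 1 else -1) * (if b = 1 \<or> b = 7 then 1 else - (1::int))"
    if "a = 1 \<or> a = 3 \<or> a = 5 \<or> a = 7" "b = 1 \<or> b = 3 \<or> b = 5 \<or> b = 7" for a b :: nat
    using that by (elim disjE) simp_all
  from mod_case[OF odd_mod_8[OF \<open>odd m\<close>] odd_mod_8[OF \<open>odd n\<close>]]
  show "(if m * n mod 8 = 1 \<or> m * n mod 8 = 7 then 1 else -1) =
     (if m mod 8 = 1 \<or> m mod 8 = 7 then 1 else -1) * (if n mod 8 = 1 \<or> n mod 8 = 7 then 1 else - (1::int))"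
    by (simp only: mod_mult_eq)
next
  fix m n assume "[int m = int n] (mod 8 * 2)"
  hence "m mod 8 = n mod 8" by (rule cong_mod_8)
  thus "(if m mod 8 = 1 \<or> m mod 8 = 7 then 1 else -1) = (if n mod 8 = 1 \<or> n mod 8 = 7 then 1 else - (1::int))" by simp
next
  fix p assume p: "prime p" "coprime (int p) (2 * 2)"
  show "(if p mod 8 = 1 \<or> p mod 8 = 7 then 1 else -1) = Legendre 2 (int p)"
    using Legendre_two[OF p(1) prime_coprime_2_gt_2[OF p]] by simp
qed auto

lemma Legendre_cong: "[a = b] (mod p) \<Longrightarrow> Legendre a p = Legendre b p"
proof -
  assume ab: "[a = b] (mod p)"
  have "[a = 0] (mod p) \<longleftrightarrow> [b = 0] (mod p)" using ab by (meson cong_sym cong_trans)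
  moreover have "QuadRes p a \<longleftrightarrow> QuadRes p b"
    unfolding QuadRes_def using ab by (meson cong_sym cong_trans)
  ultimately show ?thesis by (simp add: Legendre_def)
qed

text \<open>Reciprocity exchanges (l/p) for (p/l), which is visibly multiplicative and periodic in
  p. The extra factor is the reciprocity sign, -1 exactly when both numbers are 3 modulo 4.\<close>

lemma quad_char_odd_prime:
  assumes l: "prime l" "l > 2"
  shows "quad_char (int l) (\<lambda>n. Legendre (int n) (int l) * (if l mod 4 = 3 \<and> n mod 4 = 3 then -1 else 1))"
  unfolding quad_char_def
proof (intro conjI allI impI)
  fix m n assume "coprime (int m) (2 * int l)" "coprime (int n) (2 * int l)"
  hence "odd m" "odd n" by (auto simp: coprime_mult_right_iff)
  hence "m mod 4 = 1 \<or> m mod 4 = 3" "n mod 4 = 1 \<or> n mod 4 = 3" by presburger+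
  moreover have mod_case: "(if l mod 4 = 3 \<and> a * b mod 4 = 3 then -1 else 1) = (if l mod 4 = 3 \<and> a = 3 then -1 else 1) *
     (if l mod 4 = 3 \<and> b = 3 then -1 else 1 :: int)"
    if "a = 1 \<or> a = 3" "b = 1 \<or> b = 3" for a b :: nat
    using that by (elim disjE) simp_all
  ultimately have "(if l mod 4 = 3 \<and> m * n mod 4 = 3 then -1 else 1) = (if l mod 4 = 3 \<and> m mod 4 = 3 then -1 else 1) *
     (if l mod 4 = 3 \<and> n mod 4 = 3 then -1 else 1 :: int)"
    using mod_case[of "m mod 4" "n mod 4"] by (simp only: mod_mult_eq)
  thus "Legendre (int (m * n)) (int l) * (if l mod 4 = 3 \<and> m * n mod 4 = 3 then -1 else 1) =
    Legendre (int m) (int l) * (if l mod 4 = 3 \<and> m mod 4 = 3 then -1 else 1) *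
    (Legendre (int n) (int l) * (if l mod 4 = 3 \<and> n mod 4 = 3 then -1 else 1))"
    using Legendre_mult[OF l, of "int m" "int n"] by simp
next
  fix n assume "coprime (int n) (2 * int l)"
  hence "coprime (int n) (int l)" by simp
  hence "\<not> [int n = 0] (mod int l)" using l
    by (metis coprime_common_divisor cong_0_iff dvd_refl not_prime_unit prime_nat_int_transfer)
  thus "Legendre (int n) (int l) * (if l mod 4 = 3 \<and> n mod 4 = 3 then -1 else 1) = 1 \<or>
        Legendre (int n) (int l) * (if l mod 4 = 3 \<and> n mod 4 = 3 then -1 else 1) = -1"
    by (auto simp: Legendre_def)
next
  fix m n assume *: "[int m = int n] (mod 8 * int l)"
  have "m mod 4 = n mod 4" using * by (rule cong_mod_4)
  moreover have "Legendre (int m) (int l) = Legendre (int n) (int l)"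
    using * by (intro Legendre_cong) (rule cong_dvd_modulus, auto)
  ultimately show "Legendre (int m) (int l) * (if l mod 4 = 3 \<and> m mod 4 = 3 then -1 else 1) =
        Legendre (int n) (int l) * (if l mod 4 = 3 \<and> n mod 4 = 3 then -1 else 1)" by simp
next
  fix p assume p: "prime p" "coprime (int p) (2 * int l)"
  have p2: "p > 2" using prime_coprime_2_gt_2[OF p] .
  have "p \<noteq> l" using p l by auto
  have "coprime (int p) (int l)" using p by simp
  hence "\<not> [int p = 0] (mod int l)" using l
    by (metis coprime_common_divisor cong_0_iff dvd_refl not_prime_unit prime_nat_int_transfer)
  hence L1: "Legendre (int p) (int l) * Legendre (int p) (int l) = 1" by (simp add: Legendre_def)
  have "Legendre (int p) (int l) * Legendre (int l) (int p) = (-1) ^ ((p - 1) div 2 * ((l - 1) div 2))"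
    using p l p2 \<open>p \<noteq> l\<close> by (intro Quadratic_Reciprocity) auto
  hence "Legendre (int p) (int l) * (Legendre (int p) (int l) * Legendre (int l) (int p)) =
     Legendre (int p) (int l) * (-1) ^ ((p - 1) div 2 * ((l - 1) div 2))" by simp
  hence "Legendre (int l) (int p) = Legendre (int p) (int l) * (-1) ^ ((p - 1) div 2 * ((l - 1) div 2))"
    unfolding mult.assoc [symmetric] L1 by simp
  also have "(-1::int) ^ ((p - 1) div 2 * ((l - 1) div 2)) = (if l mod 4 = 3 \<and> p mod 4 = 3 then -1 else 1)"
  proof -
    have "odd p" "odd l" using p l p2 prime_odd_nat by blast+
    hence "odd ((p - 1) div 2) \<longleftrightarrow> p mod 4 = 3" "odd ((l - 1) div 2) \<longleftrightarrow> l mod 4 = 3"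
      by presburger+
    thus ?thesis by (auto simp: minus_one_power_iff)
  qed
  finally show "Legendre (int p) (int l) * (if l mod 4 = 3 \<and> p mod 4 = 3 then -1 else 1) = Legendre (int l) (int p)"
    by simp
qed

lemma quad_char_exists: "d \<noteq> 0 \<Longrightarrow> \<exists>\<psi>. quad_char d \<psi>"
proof (induction d rule: prime_divisors_induct)
  case (unit x)
  hence "x = 1 \<or> x = -1" by auto
  thus ?case using quad_char_one quad_char_minus_one by blast
next
  case (factor p x)
  then obtain \<psi> where \<psi>: "quad_char x \<psi>" by auto
  have "\<exists>\<phi>. quad_char p \<phi>"
  proof (cases "p = 2")
    case False
    hence "nat p > 2" "prime (nat p)" "p = int (nat p)" using factor prime_ge_2_int[of p] by auto
    thus ?thesis using quad_char_odd_prime[of "nat p"] by metis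
  qed (use quad_char_two in blast)
  thus ?case using quad_char_mult \<psi> by blast
qed auto

text \<open>Since x and l - x have the same square, the nonzero squares modulo l are attained on
  1..(l-1)/2, too few to fill all l - 1 nonzero classes.\<close>

lemma exists_nonresidue:
  assumes "prime l" "l > 2"
  shows "\<exists>a. \<not> l dvd a \<and> Legendre (int a) (int l) = -1"
proof (rule ccontr)
  assume *: "\<not> ?thesis"
  let ?sq = "\<lambda>x. x\<^sup>2 mod l"
  have "{1..<l} \<subseteq> ?sq ` {1..(l-1) div 2}"
  proof
    fix a assume a: "a \<in> {1..<l}"
    hence "\<not> l dvd a" by (auto dest: dvd_imp_le)
    hence "Legendre (int a) (int l) \<noteq> -1" using * by auto
    hence "QuadRes (int l) (int a)"
      by (auto simp: Legendre_def split: if_splits simp: cong_0_iff \<open>\<not> l dvd a\<close>)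
    then obtain y where y: "[y\<^sup>2 = int a] (mod int l)" by (auto simp: QuadRes_def)
    define x where "x = nat (y mod int l)"
    have x: "int x = y mod int l" using assms by (simp add: x_def)
    have "[(int x)\<^sup>2 = int a] (mod int l)"
      unfolding x using y by (simp add: cong_def power_mod)
    hence xa: "[x\<^sup>2 = a] (mod l)" by (simp flip: cong_int_iff)
    have xl: "x < l" using x assms by (metis of_nat_less_iff pos_mod_bound of_nat_0_less_iff prime_gt_0_nat)
    have x0: "x \<noteq> 0"
    proof
      assume "x = 0"
      hence "[a = 0] (mod l)" using xa by (simp add: cong_sym_eq)
      thus False using \<open>\<not> l dvd a\<close> by (simp add: cong_0_iff)
    qed
    have xa': "a = ?sq x" using xa a by (auto simp: cong_def)
    show "a \<in> ?sq ` {1..(l-1) div 2}"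
    proof (cases "x \<le> (l-1) div 2")
      case True
      thus ?thesis using xa' x0 by auto
    next
      case False
      have "int (l - x) = int l - int x" using xl by simp
      hence "[(int (l - x))\<^sup>2 = (int x)\<^sup>2] (mod int l)"
        by (simp add: cong_iff_dvd_diff power2_eq_square algebra_simps)
      hence "[(l - x)\<^sup>2 = x\<^sup>2] (mod l)" by (simp flip: cong_int_iff)
      hence "a = ?sq (l - x)" using xa' by (simp add: cong_def)
      moreover have "l - x \<in> {1..(l-1) div 2}"
      proof -
        obtain j where "l = 2 * j + 1" using prime_odd_nat[OF assms(1)] assms(2) by (auto elim: oddE)
        thus ?thesis using False xl by auto
      qed
      ultimately show ?thesis by blast
    qed
  qed
  hence "card {1..<l} \<le> card {1..(l-1) div 2}" by (rule surj_card_le[rotated]) auto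
  thus False using assms by auto
qed

lemma quad_char_nonprincipal:
  assumes s: "squarefree s" "s \<noteq> (1::int)"
  shows "\<exists>\<psi>. quad_char s \<psi> \<and> (\<forall>q>0. 8 * s dvd int q \<longrightarrow> (\<exists>n. coprime n q \<and> \<psi> n = -1))"
proof (cases "\<exists>l. prime l \<and> l > 2 \<and> int l dvd s")
  case True
  then obtain l s' where l: "prime l" "l > 2" and s': "s = int l * s'" by (auto elim: dvdE)
  have s0: "s \<noteq> 0" using s by auto
  have ls': "\<not> int l dvd s'"
  proof
    assume "int l dvd s'"
    hence "(int l)\<^sup>2 dvd s" unfolding s' power2_eq_square by (intro mult_dvd_mono) auto
    hence "is_unit (int l)" using s by (auto simp: squarefree_def)
    thus False using l by auto
  qed
  obtain \<psi> where \<psi>: "quad_char s' \<psi>" using quad_char_exists[of s'] s0 s' by auto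
  define \<phi> where "\<phi> = (\<lambda>n. Legendre (int n) (int l) * (if l mod 4 = 3 \<and> n mod 4 = 3 then -1 else 1))"
  have qc: "quad_char s (\<lambda>n. \<phi> n * \<psi> n)"
    unfolding s' \<phi>_def by (intro quad_char_mult quad_char_odd_prime l \<psi>)
  have "\<exists>n. coprime n q \<and> \<phi> n * \<psi> n = -1" if q: "q > 0" "8 * s dvd int q" for q
  proof -
    obtain m where m: "q = l ^ multiplicity l q * m" "\<not> l dvd m"
      using multiplicity_decompose'[of q l] l q by (metis not_prime_unit less_not_refl)
    define k where "k = multiplicity l q"
    have qk: "q = l ^ k * m" using m by (simp add: k_def)
    have copl: "coprime (l ^ k) m" "coprime l m" using l m by (simp_all add: prime_imp_coprime)
    have "8 * s' dvd int q" using q(2) unfolding s' by (meson dvd_mult_right dvd_trans mult_dvd_mono dvd_refl dvd_triv_right)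
    moreover have "coprime (8 * s') (int l ^ k)"
    proof -
      have "coprime s' (int l)" using ls' l by (metis prime_imp_coprime coprime_commute prime_nat_int_transfer)
      moreover have "\<not> l dvd 8"
      proof
        assume "l dvd 8"
        hence "l dvd 2 ^ 3" by simp
        hence "l dvd 2" using l prime_dvd_power by blast
        thus False using l by (auto dest: dvd_imp_le)
      qed
      hence "coprime (int 8) (int l)" using l by (metis prime_imp_coprime coprime_commute coprime_int_iff)
      ultimately show ?thesis by simp
    qed
    ultimately have dvdm: "8 * s' dvd int m"
      unfolding qk by (simp add: coprime_dvd_mult_right_iff)
    obtain a where a: "\<not> l dvd a" "Legendre (int a) (int l) = -1" using exists_nonresidue l by blast
    obtain n where n: "[n = a] (mod l)" "[n = 1] (mod m)"
      using binary_chinese_remainder_nat[OF copl(2)] by blast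
    have "coprime n m" using n(2) by (metis cong_imp_coprime cong_sym coprime_1_left)
    moreover have "\<not> l dvd n" using n(1) a by (metis cong_dvd_iff)
    hence "coprime n l" using l by (metis prime_imp_coprime coprime_commute)
    ultimately have copnq: "coprime n q" unfolding qk by simp
    have n1: "[int n = 1] (mod 8 * s')"
      using n(2) dvdm by (metis cong_dvd_modulus cong_int_iff of_nat_1)
    hence "[int 1 = int n] (mod 8 * s')" by (simp add: cong_sym_eq)
    hence "\<psi> 1 = \<psi> n" by (intro quad_charD(3)[OF \<psi>]) auto
    moreover have "\<psi> 1 = 1"
    proof -
      have "\<psi> 1 = 1 \<or> \<psi> 1 = -1" "\<psi> (1 * 1) = \<psi> 1 * \<psi> 1"
        by (intro quad_charD(2)[OF \<psi>] quad_charD(1)[OF \<psi>]; simp)+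
      thus ?thesis by auto
    qed
    moreover have "\<phi> n = -1"
    proof -
      have "n mod 4 = 1 mod 4" using n1 by (intro cong_mod_4) simp
      hence "n mod 4 \<noteq> 3" by simp
      moreover have "Legendre (int n) (int l) = -1"
        using Legendre_cong[of "int n" "int a" "int l"] n(1) a by (simp add: cong_int_iff)
      ultimately show ?thesis by (simp add: \<phi>_def)
    qed
    ultimately show ?thesis using copnq by auto
  qed
  with qc show ?thesis by blast
next
  case False
  have no_odd: "x = 1 \<or> x = -1" if "x dvd s" "odd x" for x
  proof (rule ccontr)
    assume "\<not> ?thesis"
    hence "nat \<bar>x\<bar> \<noteq> 1" by auto
    then obtain p where p: "prime p" "p dvd nat \<bar>x\<bar>" using prime_factor_nat by blast
    hence px: "int p dvd x" by (simp add: dvd_nat_abs_iff)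
    hence "p \<noteq> 2" using that by auto
    hence "p > 2" using prime_ge_2_nat[OF p(1)] by simp
    thus False using False p px that by (meson dvd_trans)
  qed
  have "s = -1 \<or> s = 2 \<or> s = -2"
  proof (cases "even s")
    case True
    then obtain t where t: "s = 2 * t" by (auto elim: evenE)
    have "odd t"
    proof
      assume "even t"
      hence "2\<^sup>2 dvd s" unfolding t power2_eq_square by (intro mult_dvd_mono) auto
      hence "is_unit (2::int)" by (rule squarefreeD[OF s(1)])
      thus False by simp
    qed
    with no_odd[of t] t show ?thesis by auto
  next
    case False
    with no_odd[of s] s show ?thesis by auto
  qed
  \<comment> \<open>The class 3 modulo 8 gives value -1 for s = -1; the class 5 does so for s = 2
    and s = -2.\<close>
  moreover have crt: "\<exists>n. coprime n q \<and> n mod 8 = c" if q: "q > 0" "8 dvd int q" and c: "c = 3 \<or> c = 5" for q c :: nat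
  proof -
    obtain m where m: "q = 2 ^ multiplicity 2 q * m" "\<not> 2 dvd m"
      using multiplicity_decompose'[of q 2] q by (metis less_not_refl not_prime_unit two_is_prime_nat)
    have "coprime 2 m" using m(2) by (simp add: coprime_left_2_iff_odd)
    hence "coprime (2 ^ 3) m" by (rule coprime_power_left_iff[THEN iffD2, OF disjI1])
    hence "coprime 8 m" by simp
    then obtain n where n: "[n = c] (mod 8)" "[n = 1] (mod m)"
      using binary_chinese_remainder_nat by blast
    have "n mod 8 = c" using n(1) c by (auto simp: cong_def)
    moreover from this have "odd n" using c by presburger
    hence "coprime n (2 ^ multiplicity 2 q)" by simp
    moreover have "coprime n m" using n(2) by (metis cong_imp_coprime cong_sym coprime_1_left)
    ultimately show ?thesis using m(1) by (metis coprime_mult_right_iff)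
  qed
  have dvd8: "8 dvd int q" if "8 * s dvd int q" for q using that by (rule dvd_mult_left)
  ultimately consider "s = -1" | "s = 2" | "s = -2" by blast
  then show ?thesis
  proof cases
    case 1
    have "\<exists>n. coprime n q \<and> (if n mod 4 = 1 then 1 else - 1) = (-1::int)" if q: "q > 0" "8 * s dvd int q" for q
    proof -
      obtain n where "coprime n q" "n mod 8 = 3" using crt[of q 3] dvd8 q by auto
      moreover from this have "n mod 4 \<noteq> 1" by presburger
      ultimately show ?thesis by auto
    qed
    thus ?thesis using quad_char_minus_one 1 by blast
  next
    case 2
    have "\<exists>n. coprime n q \<and> (if n mod 8 = 1 \<or> n mod 8 = 7 then 1 else - 1) = (-1::int)" if q: "q > 0" "8 * s dvd int q" for q
    proof -
      obtain n where "coprime n q" "n mod 8 = 5" using crt[of q 5] dvd8 q by auto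
      thus ?thesis by (intro exI[of _ n]) auto
    qed
    thus ?thesis using quad_char_two 2 by blast
  next
    case 3
    have "\<exists>n. coprime n q \<and> (if n mod 4 = 1 then 1 else - 1) * (if n mod 8 = 1 \<or> n mod 8 = 7 then 1 else - 1) = (-1::int)"
      if q: "q > 0" "8 * s dvd int q" for q
    proof -
      obtain n where "coprime n q" "n mod 8 = 5" using crt[of q 5] dvd8 q by auto
      moreover from this have "n mod 4 = 1" by presburger
      ultimately show ?thesis by (intro exI[of _ n]) auto
    qed
    moreover have "quad_char s (\<lambda>n. (if n mod 4 = 1 then 1 else - 1) * (if n mod 8 = 1 \<or> n mod 8 = 7 then 1 else - 1))"
      using quad_char_mult[OF quad_char_minus_one quad_char_two] 3 by simp
    ultimately show ?thesis by blast
  qed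
qed

lemma periodic_sum_bound:
  fixes f :: "nat \<Rightarrow> real"
  assumes q: "q > 0" and per: "\<And>n. f (n + q) = f n" and bd: "\<And>n. \<bar>f n\<bar> \<le> 1"
    and zero: "(\<Sum>k<q. f k) = 0"
  shows "\<bar>\<Sum>k=m..n. f k\<bar> \<le> 2 * real q"
proof -
  define S where "S n = (\<Sum>k<n. f k)" for n
  have S_per: "S (n + q) = S n" for n
    by (induction n) (use zero per in \<open>auto simp: S_def\<close>)
  have S_mult: "S (j + k * q) = S j" for j k
  proof (induction k)
    case (Suc k)
    have "S (j + Suc k * q) = S ((j + k * q) + q)" by (simp add: add_ac)
    thus ?case using S_per Suc by simp
  qed auto
  have S_bd: "\<bar>S n\<bar> \<le> real q" for n
  proof -
    have "S n = S (n mod q)" using S_mult[of "n mod q" "n div q"] by simp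
    also have "\<bar>\<dots>\<bar> \<le> (\<Sum>k<n mod q. 1)"
      unfolding S_def by (intro order.trans[OF sum_abs] sum_mono bd)
    also have "\<dots> \<le> real q" using q by (simp add: less_imp_le)
    finally show ?thesis .
  qed
  show ?thesis
  proof (cases "m \<le> n")
    case True
    have eq: "{..<Suc n} = {..<m} \<union> {m..n}" using True by auto
    have "(\<Sum>k<Suc n. f k) = (\<Sum>k<m. f k) + (\<Sum>k=m..n. f k)"
      unfolding eq by (rule sum.union_disjoint) auto
    hence "S (Suc n) = S m + (\<Sum>k=m..n. f k)" by (simp only: S_def)
    with S_bd[of "Suc n"] S_bd[of m] show ?thesis by linarith
  qed auto
qed

text \<open>The character is the symbol of the squarefree part s of d, which is not 1 as d is no
  square. It agrees with the Legendre symbol of d at primes prime to q, where d and s differ by a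
  nonzero square. The parameter m forces further primes to have value 0.\<close>

lemma exists_real_char:
  fixes d :: int and m :: nat
  assumes d: "\<not> is_square d" and m: "m > 0"
  shows "\<exists>chi q. real_char chi (2 * real q) q \<and> m dvd q \<and> 2 * d dvd int q \<and>
     (\<forall>p. prime p \<longrightarrow> chi p = (if p dvd q then 0 else real_of_int (Legendre d (int p))))"
proof -
  define s where "s = squarefree_part d"
  define t where "t = square_part d"
  have dst: "d = s * t\<^sup>2" unfolding s_def t_def by (rule squarefree_decompose)
  have d0: "d \<noteq> 0" using d by auto
  have s: "squarefree s" "s \<noteq> 1"
  proof -
    show "squarefree s" unfolding s_def by (rule squarefree_squarefree_part)
    show "s \<noteq> 1"
    proof
      assume "s = 1"
      hence "d = t\<^sup>2" using dst by (simp only: mult_1)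
      thus False using d unfolding is_nth_power_def by blast
    qed
  qed
  from quad_char_nonprincipal[OF s] obtain \<psi> where \<psi>: "quad_char s \<psi>"
    and np: "\<And>q. q > 0 \<Longrightarrow> 8 * s dvd int q \<Longrightarrow> \<exists>n. coprime n q \<and> \<psi> n = -1" by blast
  define q where "q = 8 * nat \<bar>d\<bar> * m"
  have q0: "q > 0" using d0 m by (simp add: q_def)
  have dq: "8 * d dvd int q" by (simp add: q_def)
  have sq: "8 * s dvd int q" using dq unfolding dst by (auto intro: dvd_trans[rotated])
  have cop: "coprime (int n) (2 * s)" if "coprime n q" for n
  proof -
    have "2 * s dvd int q" using sq by (auto intro: dvd_trans[rotated])
    thus ?thesis using that by (metis coprime_divisors coprime_int_iff dvd_refl)
  qed
  define chi where "chi n = (if coprime n q then real_of_int (\<psi> n) else 0)" for n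
  have vals: "\<psi> n = 1 \<or> \<psi> n = -1" if "coprime n q" for n
    by (intro quad_charD(2)[OF \<psi>] cop that)
  have mult: "\<psi> (m * n) = \<psi> m * \<psi> n" if "coprime m q" "coprime n q" for m n
    by (intro quad_charD(1)[OF \<psi>] cop that)
  have chi_mult: "chi (m * n) = chi m * chi n" for m n
    using mult[of m n] by (auto simp: chi_def)
  have chi_cases: "chi n = 0 \<or> chi n = 1 \<or> chi n = -1" for n
    using vals[of n] by (auto simp: chi_def)
  have cong: "chi a = chi b" if "[a = b] (mod q)" for a b
  proof -
    have "coprime a q \<longleftrightarrow> coprime b q" using that by (metis cong_imp_coprime cong_sym)
    moreover have "\<psi> a = \<psi> b" if "coprime a q"
    proof -
      have "[int a = int b] (mod int q)" using \<open>[a = b] (mod q)\<close> by (simp add: cong_int_iff)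
      hence "[int a = int b] (mod 8 * s)" using sq by (rule cong_dvd_modulus)
      thus ?thesis by (intro quad_charD(3)[OF \<psi>] cop that)
    qed
    ultimately show ?thesis by (simp add: chi_def)
  qed
  obtain n0 where n0: "coprime n0 q" "\<psi> n0 = -1" using np[OF q0 sq] by blast
  \<comment> \<open>Multiplication by \<open>n0\<close> permutes the residues modulo q and negates
    \<open>chi\<close>, so the sum over a period equals its own negative.\<close>
  have zero: "(\<Sum>k<q. chi k) = 0"
  proof -
    have "inj_on (\<lambda>k. n0 * k mod q) {..<q}"
    proof (rule inj_onI)
      fix a b assume ab: "a \<in> {..<q}" "b \<in> {..<q}" "n0 * a mod q = n0 * b mod q"
      hence "[n0 * a = n0 * b] (mod q)" by (simp add: cong_def)
      hence "[a = b] (mod q)" using n0 by (simp add: cong_mult_lcancel_nat coprime_commute)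
      thus "a = b" using ab by (simp add: cong_def)
    qed
    moreover have "(\<lambda>k. n0 * k mod q) ` {..<q} \<subseteq> {..<q}" using q0 by auto
    ultimately have "bij_betw (\<lambda>k. n0 * k mod q) {..<q} {..<q}"
      by (simp add: bij_betw_def endo_inj_surj)
    hence "(\<Sum>k<q. chi k) = (\<Sum>k<q. chi (n0 * k mod q))"
      by (rule sum.reindex_bij_betw [symmetric])
    also have "\<dots> = (\<Sum>k<q. chi n0 * chi k)"
      unfolding chi_mult [symmetric] by (intro sum.cong refl cong) (auto simp: cong_def)
    also have "\<dots> = - (\<Sum>k<q. chi k)"
      using n0 by (simp add: chi_def sum_negf flip: sum_distrib_left)
    finally show ?thesis by simp
  qed
  have psi1: "\<psi> 1 = 1"
    using vals[of 1] mult[of 1 1] by auto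
  have "real_char chi (2 * real q) q"
  proof
    show "chi (Suc 0) = 1" using psi1 by (simp add: chi_def)
    show "\<bar>\<Sum>k=m..n. chi k\<bar> \<le> 2 * real q" for m n
    proof (rule periodic_sum_bound[OF q0 _ _ zero])
      show "chi (n + q) = chi n" for n by (rule cong) (simp add: cong_def)
      show "\<bar>chi n\<bar> \<le> 1" for n using chi_cases[of n] by auto
    qed
    fix p :: nat assume p: "prime p" "chi p = 0"
    hence "\<not> coprime p q" using vals[of p] by (auto simp: chi_def)
    thus "p dvd q" using p prime_imp_coprime by blast
  qed (use chi_mult chi_cases q0 in auto)
  moreover have "chi p = (if p dvd q then 0 else real_of_int (Legendre d (int p)))" if p: "prime p" for p
  proof (cases "p dvd q")
    case True
    hence "\<not> coprime p q" using p by (metis coprime_absorb_left not_prime_unit)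
    thus ?thesis using True by (simp add: chi_def)
  next
    case False
    hence cp: "coprime p q" using p by (simp add: prime_imp_coprime)
    have "chi p = real_of_int (Legendre s (int p))"
      using quad_charD(4)[OF \<psi> p cop[OF cp]] cp by (simp add: chi_def)
    also have "Legendre s (int p) = Legendre d (int p)"
    proof -
      have p2: "p > 2" using prime_coprime_2_gt_2[OF p cop[OF cp]] .
      have "d dvd int q" using dq by (rule dvd_mult_right)
      hence "\<not> int p dvd d" using False by (metis dvd_trans of_nat_dvd_iff)
      hence "\<not> int p dvd t" unfolding dst by (metis dvd_mult dvd_triv_left power2_eq_square dvd_trans)
      hence "\<not> [t\<^sup>2 = 0] (mod int p)" using p
        by (metis cong_0_iff prime_dvd_power prime_nat_int_transfer)
      moreover have "QuadRes (int p) (t\<^sup>2)" unfolding QuadRes_def by (intro exI[of _ t]) auto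
      ultimately have "Legendre (t\<^sup>2) (int p) = 1" by (simp add: Legendre_def)
      thus ?thesis unfolding dst using Legendre_mult[OF p p2] by simp
    qed
    finally show ?thesis using False by simp
  qed
  moreover have "m dvd q" by (simp add: q_def)
  moreover have "2 * d dvd int q" using dq by (auto intro: dvd_trans[rotated])
  ultimately show ?thesis by blast
qed

section \<open>Norms and values of the form\<close>

text \<open>Hensel lifting: s + p^k u works modulo p^(k+1) as soon as t + 2 s u is divisible by p,
  where s^2 - d = p^k t. This is solvable because p is odd and does not divide s.\<close>

lemma square_mod_prime_power:
  fixes d :: int
  assumes p: "prime p" "p > 2" "\<not> int p dvd d" "QuadRes (int p) d"
  shows "\<exists>s. int (p ^ k) dvd s\<^sup>2 - d"
proof (cases "k = 0")
  case False
  hence "k \<ge> 1" by simp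
  thus ?thesis
  proof (induction k rule: dec_induct)
    case base
    then show ?case using p(4) by (auto simp: QuadRes_def cong_iff_dvd_diff)
  next
    case (step k)
    then obtain s where s: "int (p ^ k) dvd s\<^sup>2 - d" by blast
    then obtain t where t: "s\<^sup>2 - d = int (p ^ k) * t" by (auto elim: dvdE)
    have pk: "int p dvd int (p ^ k)" using step by (simp add: dvd_power)
    have "\<not> int p dvd s"
    proof
      assume "int p dvd s"
      hence "int p dvd s\<^sup>2" by (simp add: power2_eq_square)
      moreover have "int p dvd s\<^sup>2 - d" using pk s by (rule dvd_trans)
      ultimately have "int p dvd s\<^sup>2 - (s\<^sup>2 - d)" by (rule dvd_diff)
      thus False using p by simp
    qed
    moreover have "\<not> int p dvd 2" using p by (auto dest!: zdvd_imp_le)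
    ultimately have "\<not> int p dvd 2 * s" using p by (simp add: prime_dvd_mult_iff)
    hence "coprime (2 * s) (int p)" using p by (metis prime_imp_coprime coprime_commute prime_nat_int_transfer)
    then obtain x where x: "[2 * s * x = 1] (mod int p)" using cong_solve_coprime_int by blast
    define u where "u = - t * x"
    have "[t + 2 * s * u = 0] (mod int p)"
    proof -
      have "int p dvd 2 * s * x - 1" using x by (simp add: cong_iff_dvd_diff)
      hence "int p dvd (2 * s * x - 1) * (- t)" by (rule dvd_mult2)
      also have "(2 * s * x - 1) * (- t) = t + 2 * s * u" by (simp add: u_def algebra_simps)
      finally show ?thesis by (simp add: cong_0_iff)
    qed
    hence "int p dvd t + 2 * s * u" by (simp add: cong_0_iff)
    from dvd_add[OF this dvd_mult2[OF pk]]
    have "int p dvd t + 2 * s * u + int (p ^ k) * u\<^sup>2" .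
    hence "int (p ^ k) * int p dvd int (p ^ k) * (t + 2 * s * u + int (p ^ k) * u\<^sup>2)" by (intro mult_dvd_mono) auto
    also have "int (p ^ k) * (t + 2 * s * u + int (p ^ k) * u\<^sup>2) = (s\<^sup>2 - d) + 2 * s * u * int (p ^ k) + (int (p ^ k) * u)\<^sup>2"
      unfolding t by (simp add: power2_eq_square algebra_simps)
    also have "\<dots> = (s + int (p ^ k) * u)\<^sup>2 - d" by (simp add: power2_eq_square algebra_simps)
    finally show ?case by (intro exI[of _ "s + int (p ^ k) * u"]) (simp add: mult.commute)
  qed
qed auto

lemma square_mod:
  fixes d :: int
  assumes "n > 0" "\<And>p. prime p \<Longrightarrow> p dvd n \<Longrightarrow> p > 2 \<and> \<not> int p dvd d \<and> QuadRes (int p) d"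
  shows "\<exists>s. int n dvd s\<^sup>2 - d"
  using assms
proof (induction n rule: prime_power_coprime_induct)
  case (step p k m)
  have "p dvd p ^ k * m" using step by (simp add: dvd_power)
  then obtain s where s: "int (p ^ k) dvd s\<^sup>2 - d" using square_mod_prime_power step by blast
  obtain t where t: "int m dvd t\<^sup>2 - d" using step by (meson dvd_mult)
  have cop: "coprime (int (p ^ k)) (int m)" using step by (simp add: prime_imp_coprime)
  then obtain x where x: "[x = s] (mod int (p ^ k))" "[x = t] (mod int m)"
    using binary_chinese_remainder_int by blast
  have "[x\<^sup>2 - d = s\<^sup>2 - d] (mod int (p ^ k))" "[x\<^sup>2 - d = t\<^sup>2 - d] (mod int m)"
    using x by (auto intro!: cong_diff cong_pow)
  hence "int (p ^ k) dvd x\<^sup>2 - d" "int m dvd x\<^sup>2 - d" using s t by (meson cong_dvd_iff cong_sym)+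
  hence "int (p ^ k) * int m dvd x\<^sup>2 - d" using cop by (rule divides_mult)
  thus ?case by auto
qed auto

text \<open>Pigeonhole: with k the integer square root of n there are (k + 1)^2 > n pairs (x, y) in
  [0, k]^2, so two of them agree in x - s y modulo n; their difference is (U, V).\<close>

lemma thue:
  fixes s :: int
  assumes "n > 0"
  shows "\<exists>U V. (U \<noteq> 0 \<or> V \<noteq> 0) \<and> U\<^sup>2 \<le> int n \<and> V\<^sup>2 \<le> int n \<and> int n dvd U - s * V"
proof -
  define k where "k = (LEAST k. n < (Suc k)\<^sup>2)"
  have "n < (Suc n)\<^sup>2" by (simp add: power2_eq_square)
  hence k1: "n < (Suc k)\<^sup>2" unfolding k_def by (rule LeastI)
  have k2: "k\<^sup>2 \<le> n"
  proof (cases k)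
    case (Suc j)
    hence "\<not> n < (Suc j)\<^sup>2" using not_less_Least[of j "\<lambda>k. n < (Suc k)\<^sup>2"] by (simp add: k_def)
    thus ?thesis using Suc by simp
  qed auto
  let ?X = "{0..int k} \<times> {0..int k}"
  let ?f = "\<lambda>(x,y). (x - s * y) mod int n"
  have "\<not> inj_on ?f ?X"
  proof (rule pigeonhole)
    have "?f ` ?X \<subseteq> {0..<int n}" using assms by auto
    hence "card (?f ` ?X) \<le> card {0..<int n}" by (intro card_mono) auto
    also have "\<dots> = n" by simp
    also have "n < card ?X" using k1 by (simp add: card_cartesian_product power2_eq_square nat_add_distrib)
    finally show "card (?f ` ?X) < card ?X" .
  qed
  then obtain x y x' y' where *: "(x,y) \<in> ?X" "(x',y') \<in> ?X" "(x,y) \<noteq> (x',y')"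
      "(x - s * y) mod int n = (x' - s * y') mod int n"
    by (auto simp: inj_on_def)
  have sq: "z\<^sup>2 \<le> int n" if "\<bar>z\<bar> \<le> int k" for z
  proof -
    have "z\<^sup>2 \<le> (int k)\<^sup>2" using that by (simp add: abs_le_square_iff [symmetric])
    also have "\<dots> \<le> int n" using k2 by (metis of_nat_le_iff of_nat_power)
    finally show ?thesis .
  qed
  have "int n dvd (x - s * y) - (x' - s * y')" using *(4) by (simp add: mod_eq_dvd_iff)
  also have "(x - s * y) - (x' - s * y') = (x - x') - s * (y - y')" by (simp add: algebra_simps)
  finally show ?thesis using * by (intro exI[of _ "x - x'"] exI[of _ "y - y'"]) (auto intro!: sq)
qed

lemma norm_eq_0_imp:
  fixes d :: int
  assumes "\<not> is_square d" "U\<^sup>2 = d * V\<^sup>2"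
  shows "U = 0 \<and> V = 0"
proof (cases "V = 0")
  case False
  have "V\<^sup>2 dvd U\<^sup>2" using assms(2) by simp
  hence "V dvd U" by simp
  then obtain w where "U = V * w" by (auto elim: dvdE)
  hence "d = w\<^sup>2" using assms(2) False by (simp add: power_mult_distrib)
  thus ?thesis using assms(1) by (auto simp: is_nth_power_def)
qed (use assms in auto)

text \<open>For U congruent to s V modulo n, the norm U^2 - d V^2 is congruent to (s^2 - d) V^2,
  hence to 0. Thue's bounds limit the quotient to 1 + |d|, and it is nonzero because d is no
  square.\<close>

lemma small_norm_multiple:
  fixes d s :: int
  assumes d: "\<not> is_square d" and n: "n > 0" "int n dvd s\<^sup>2 - d"
  shows "\<exists>U V k. U\<^sup>2 - d * V\<^sup>2 = k * int n \<and> k \<noteq> 0 \<and> \<bar>k\<bar> \<le> 1 + \<bar>d\<bar>"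
proof -
  from thue[OF n(1), of s] obtain U V where UV: "U \<noteq> 0 \<or> V \<noteq> 0" "U\<^sup>2 \<le> int n" "V\<^sup>2 \<le> int n" "int n dvd U - s * V"
    by blast
  have "int n dvd (U - s * V) * (U + s * V) + (s\<^sup>2 - d) * V\<^sup>2"
    using UV n by (intro dvd_add dvd_mult2)
  also have "\<dots> = U\<^sup>2 - d * V\<^sup>2" by (simp add: power2_eq_square algebra_simps)
  finally obtain k where "U\<^sup>2 - d * V\<^sup>2 = int n * k" by (rule dvdE)
  hence k: "U\<^sup>2 - d * V\<^sup>2 = k * int n" by (simp only: mult.commute)
  have "U\<^sup>2 \<noteq> d * V\<^sup>2" using norm_eq_0_imp[OF d] UV(1) by blast
  hence k0: "k \<noteq> 0" using k by auto
  have "\<bar>k\<bar> * int n = \<bar>U\<^sup>2 - d * V\<^sup>2\<bar>" using k by (simp add: abs_mult)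
  also have "\<dots> \<le> U\<^sup>2 + \<bar>d\<bar> * V\<^sup>2" using abs_triangle_ineq4[of "U\<^sup>2" "d * V\<^sup>2"] by (simp add: abs_mult)
  also have "\<dots> \<le> int n + \<bar>d\<bar> * int n" using UV by (intro add_mono mult_left_mono) auto
  also have "\<dots> = (1 + \<bar>d\<bar>) * int n" by (simp add: algebra_simps)
  finally have "\<bar>k\<bar> \<le> 1 + \<bar>d\<bar>" using n by simp
  with k k0 show ?thesis by blast
qed

text \<open>This is the norm of (U + V sqrt d)(U0 - V0 sqrt d)/k. Congruence modulo M k makes both
  components divisible by k, the quotients being n0 modulo M and 0 modulo M.\<close>

lemma norm_quotient:
  fixes d :: int
  assumes "U\<^sup>2 - d * V\<^sup>2 = k * n" "U0\<^sup>2 - d * V0\<^sup>2 = k * n0" "k \<noteq> 0"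
    and "[U = U0] (mod M * k)" "[V = V0] (mod M * k)"
  shows "\<exists>a b. n * n0 = (n0 + M * a)\<^sup>2 - d * (M * b)\<^sup>2"
proof -
  obtain i where i: "U = U0 + M * k * i" using assms(4) by (metis cong_iff_lin cong_sym)
  obtain j where j: "V = V0 + M * k * j" using assms(5) by (metis cong_iff_lin cong_sym)
  define a b where "a = i * U0 - d * j * V0" and "b = j * U0 - i * V0"
  have 1: "k * (n0 + M * a) = U * U0 - d * (V * V0)"
    unfolding a_def i j using assms(2) by (simp add: algebra_simps power2_eq_square)
  have 2: "k * (M * b) = V * U0 - U * V0"
    unfolding b_def i j by (simp add: algebra_simps)
  have "k\<^sup>2 * ((n0 + M * a)\<^sup>2 - d * (M * b)\<^sup>2) = (k * (n0 + M * a))\<^sup>2 - d * (k * (M * b))\<^sup>2"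
    by (simp add: power_mult_distrib right_diff_distrib)
  also have "\<dots> = (U\<^sup>2 - d * V\<^sup>2) * (U0\<^sup>2 - d * V0\<^sup>2)"
    unfolding 1 2 by (simp add: algebra_simps power2_eq_square)
  also have "\<dots> = k\<^sup>2 * (n * n0)" unfolding assms(1,2) by (simp add: power2_eq_square)
  finally have "n * n0 = (n0 + M * a)\<^sup>2 - d * (M * b)\<^sup>2" using assms(3) by simp
  thus ?thesis by blast
qed

text \<open>
  Representatives of the finitely many residue types of \<open>(U, V)\<close> play the part of the ideal class
  group: the product with the conjugate of a representative of the same type, divided by the common
  factor \<open>k\<close> of the norms, is congruent to an integer prime to \<open>M\<close>, and an inverse of that integer
  rescales it to \<open>1\<close> modulo \<open>M\<close>.
\<close>

lemma norm_multiplier: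
  fixes d :: int and M :: nat
  assumes d: "\<not> is_square d" and M: "M > 0"
    and G: "\<And>n. n \<in> G \<Longrightarrow> n > 0 \<and> coprime n M \<and> (\<exists>s. int n dvd s\<^sup>2 - d)"
  shows "\<exists>C \<kappa>. \<forall>n\<in>G. 0 < \<kappa> n \<and> \<kappa> n \<le> (C::nat) \<and>
     (\<exists>x y. int (\<kappa> n * n) = (1 + int M * x)\<^sup>2 - d * (int M * y)\<^sup>2)"
proof -
  have ex: "\<forall>n\<in>G. \<exists>T. case T of (U,V,k) \<Rightarrow> U\<^sup>2 - d * V\<^sup>2 = k * int n \<and> k \<noteq> 0 \<and> \<bar>k\<bar> \<le> 1 + \<bar>d\<bar>"
  proof
    fix n assume "n \<in> G"
    then obtain s where "n > 0" "int n dvd s\<^sup>2 - d" using G by blast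
    from small_norm_multiple[OF d this] obtain U V k
      where "U\<^sup>2 - d * V\<^sup>2 = k * int n \<and> k \<noteq> 0 \<and> \<bar>k\<bar> \<le> 1 + \<bar>d\<bar>" by blast
    thus "\<exists>T. case T of (U,V,k) \<Rightarrow> U\<^sup>2 - d * V\<^sup>2 = k * int n \<and> k \<noteq> 0 \<and> \<bar>k\<bar> \<le> 1 + \<bar>d\<bar>"
      by (intro exI[of _ "(U,V,k)"]) simp
  qed
  obtain T where T': "\<forall>n\<in>G. case T n of (U,V,k) \<Rightarrow> U\<^sup>2 - d * V\<^sup>2 = k * int n \<and> k \<noteq> 0 \<and> \<bar>k\<bar> \<le> 1 + \<bar>d\<bar>"
    using bchoice[OF ex] by (rule exE)
  note T = bspec[OF T']
  define \<tau> where "\<tau> n = (case T n of (U,V,k) \<Rightarrow> (k, U mod (int M * \<bar>k\<bar>), V mod (int M * \<bar>k\<bar>)))" for n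
  define K where "K = int M * (1 + \<bar>d\<bar>)"
  have "\<tau> ` G \<subseteq> {-(1 + \<bar>d\<bar>)..1 + \<bar>d\<bar>} \<times> {0..K} \<times> {0..K}"
  proof
    fix t assume "t \<in> \<tau> ` G"
    then obtain n where n: "n \<in> G" "t = \<tau> n" by blast
    obtain U V k where UVk: "T n = (U,V,k)" by (cases "T n") auto
    have k: "k \<noteq> 0" "\<bar>k\<bar> \<le> 1 + \<bar>d\<bar>" using T[OF n(1)] UVk by auto
    have "int M * \<bar>k\<bar> > 0" using M k by simp
    moreover have "int M * \<bar>k\<bar> \<le> K" unfolding K_def using k by (intro mult_left_mono) auto
    ultimately have "0 \<le> x mod (int M * \<bar>k\<bar>) \<and> x mod (int M * \<bar>k\<bar>) \<le> K" for x
      by (smt (verit) pos_mod_bound pos_mod_sign)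
    thus "t \<in> {-(1 + \<bar>d\<bar>)..1 + \<bar>d\<bar>} \<times> {0..K} \<times> {0..K}"
      using k by (simp add: n \<tau>_def UVk) linarith
  qed
  hence fin: "finite (\<tau> ` G)" by (rule finite_subset) auto
  define \<rho> where "\<rho> t = (SOME n. n \<in> G \<and> \<tau> n = t)" for t
  have \<rho>: "\<rho> (\<tau> n) \<in> G \<and> \<tau> (\<rho> (\<tau> n)) = \<tau> n" if "n \<in> G" for n
    unfolding \<rho>_def by (rule someI[of _ n]) (use that in auto)
  define j where "j m = (SOME j. j > 0 \<and> [j * m = 1] (mod M))" for m
  have j: "j m > 0 \<and> [j m * m = 1] (mod M)" if "coprime m M" for m
  proof -
    have "\<exists>x. [m * x = Suc 0] (mod M)" using that by (rule cong_solve_coprime_nat)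
    then obtain x where x: "[m * x = 1] (mod M)" by auto
    have "(x + M) * m = m * x + M * m" by (simp add: algebra_simps)
    hence "[(x + M) * m = m * x] (mod M)" by (simp add: cong_def)
    hence xM: "[(x + M) * m = 1] (mod M)" using x by (rule cong_trans)
    show ?thesis unfolding j_def by (rule someI[of _ "x + M"]) (use M xM in simp)
  qed
  \<comment> \<open>Scaling an element by j multiplies its norm by j^2, whence the square.\<close>
  define \<kappa> where "\<kappa> n = (j (\<rho> (\<tau> n)))\<^sup>2 * \<rho> (\<tau> n)" for n
  have "finite ((\<lambda>t. (j (\<rho> t))\<^sup>2 * \<rho> t) ` \<tau> ` G)" using fin by (rule finite_imageI)
  then obtain C where C: "\<forall>x\<in>(\<lambda>t. (j (\<rho> t))\<^sup>2 * \<rho> t) ` \<tau> ` G. x \<le> C"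
    unfolding finite_nat_set_iff_bounded_le by (rule exE)
  have "0 < \<kappa> n \<and> \<kappa> n \<le> C \<and> (\<exists>x y. int (\<kappa> n * n) = (1 + int M * x)\<^sup>2 - d * (int M * y)\<^sup>2)"
    if n: "n \<in> G" for n
  proof (intro conjI)
    define m where "m = \<rho> (\<tau> n)"
    have m: "m \<in> G" "\<tau> m = \<tau> n" using \<rho>[OF n] by (auto simp: m_def)
    have copm: "coprime m M" "m > 0" using G m by auto
    have jm: "j m > 0" "[j m * m = 1] (mod M)" using j copm by auto
    have km: "\<kappa> n = (j m)\<^sup>2 * m" by (simp add: \<kappa>_def m_def)
    show "0 < \<kappa> n" using jm copm by (simp add: km)
    show "\<kappa> n \<le> C" using C n unfolding \<kappa>_def by blast
    obtain U V k where UVk: "T n = (U,V,k)" by (cases "T n") auto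
    obtain U0 V0 k0 where UVk0: "T m = (U0,V0,k0)" by (cases "T m") auto
    have eq: "k0 = k" "U0 mod (int M * \<bar>k\<bar>) = U mod (int M * \<bar>k\<bar>)" "V0 mod (int M * \<bar>k\<bar>) = V mod (int M * \<bar>k\<bar>)"
      using m(2) by (auto simp: \<tau>_def UVk UVk0)
    have 1: "U\<^sup>2 - d * V\<^sup>2 = k * int n" "k \<noteq> 0" using T[OF n] UVk by auto
    have 2: "U0\<^sup>2 - d * V0\<^sup>2 = k * int m" using T[OF m(1)] UVk0 eq by auto
    have "[U = U0] (mod int M * \<bar>k\<bar>)" "[V = V0] (mod int M * \<bar>k\<bar>)"
      unfolding cong_def eq(2,3) by (rule refl)+
    moreover have "int M * k dvd int M * \<bar>k\<bar>" by (intro mult_dvd_mono) auto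
    ultimately have UV: "[U = U0] (mod int M * k)" "[V = V0] (mod int M * k)"
      by (blast intro: cong_dvd_modulus)+
    from norm_quotient[OF 1(1) 2 1(2) UV] obtain a b
      where ab: "int n * int m = (int m + int M * a)\<^sup>2 - d * (int M * b)\<^sup>2" by blast
    have "[int (j m * m) = 1] (mod int M)" using jm(2) by (metis cong_int_iff of_nat_1)
    then obtain l where l: "int (j m * m) = 1 + int M * l" by (metis cong_iff_lin cong_sym)
    have "int (\<kappa> n * n) = (int (j m))\<^sup>2 * (int n * int m)" by (simp add: km)
    also have "\<dots> = (int (j m * m) + int M * (int (j m) * a))\<^sup>2 - d * (int M * (int (j m) * b))\<^sup>2"
      unfolding ab by (simp add: power2_eq_square algebra_simps)
    also have "int (j m * m) + int M * (int (j m) * a) = 1 + int M * (l + int (j m) * a)"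
      unfolding l by (simp add: algebra_simps)
    finally show "\<exists>x y. int (\<kappa> n * n) = (1 + int M * x)\<^sup>2 - d * (int M * y)\<^sup>2" by blast
  qed
  thus ?thesis by blast
qed

text \<open>Completing the square first in x and then in y; up to the factor 4a, the invariant D is
  the constant that remains.\<close>

lemma form_norm_identity:
  fixes a b c e f g x y :: int
  assumes "\<Delta> = b\<^sup>2 - 4 * a * c"
  shows "(\<Delta> * y - (2 * a * f - b * e))\<^sup>2 - \<Delta> * (2 * a * x + b * y + e)\<^sup>2 =
     4 * a * (a * f\<^sup>2 + c * e\<^sup>2 - b * f * e + \<Delta> * g)
      - 4 * a * \<Delta> * (a * x\<^sup>2 + b * x * y + c * y\<^sup>2 + e * x + f * y + g)"
  unfolding assms by (simp add: power2_eq_square algebra_simps)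

text \<open>Multiply W + Z sqrt \<Delta> by (1 + M s) + M t sqrt \<Delta>. The changes of W and Z
  are then divisible by M = 2 a \<Delta>, which is what solving W = \<Delta> y + const for y' and
  then Z = 2 a x + b y + e for x' in integers requires.\<close>

lemma form_scaling:
  fixes a b c e f g x y :: int
  defines "Q \<equiv> \<lambda>x y. a * x\<^sup>2 + b * x * y + c * y\<^sup>2 + e * x + f * y + g"
  assumes \<Delta>: "\<Delta> = b\<^sup>2 - 4 * a * c" "a * \<Delta> \<noteq> 0"
    and D: "a * f\<^sup>2 + c * e\<^sup>2 - b * f * e + \<Delta> * g = 0"
    and M: "M = 2 * a * \<Delta>"
  shows "\<exists>x' y'. Q x' y' = Q x y * ((1 + M * s)\<^sup>2 - \<Delta> * (M * t)\<^sup>2)"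
proof -
  define W where "W = (\<lambda>y. \<Delta> * y - (2 * a * f - b * e))"
  define Z where "Z = (\<lambda>x y. 2 * a * x + b * y + e)"
  have N: "- 4 * (a * \<Delta>) * Q x y = (W y)\<^sup>2 - \<Delta> * (Z x y)\<^sup>2" for x y
    using form_norm_identity[OF \<Delta>(1), of y f e x g] D by (simp add: Q_def W_def Z_def)
  define y' where "y' = y + 2 * a * (s * W y + \<Delta> * t * Z x y)"
  define x' where "x' = x + \<Delta> * (s * Z x y + t * W y) - b * (s * W y + \<Delta> * t * Z x y)"
  have W': "W y' = (1 + M * s) * W y + \<Delta> * (M * t) * Z x y"
    by (simp add: W_def y'_def M algebra_simps)
  have Z': "Z x' y' = (1 + M * s) * Z x y + (M * t) * W y"
    by (simp add: Z_def x'_def y'_def M algebra_simps)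
  have "- 4 * (a * \<Delta>) * Q x' y' = (W y')\<^sup>2 - \<Delta> * (Z x' y')\<^sup>2" by (rule N)
  also have "\<dots> = ((W y)\<^sup>2 - \<Delta> * (Z x y)\<^sup>2) * ((1 + M * s)\<^sup>2 - \<Delta> * (M * t)\<^sup>2)"
  proof -
    have "(u * w + dd * v * z)\<^sup>2 - dd * (u * z + v * w)\<^sup>2 = (w\<^sup>2 - dd * z\<^sup>2) * (u\<^sup>2 - dd * v\<^sup>2)"
      for u v w z dd :: int by (simp add: power2_eq_square algebra_simps)
    thus ?thesis unfolding W' Z' .
  qed
  also have "\<dots> = - 4 * (a * \<Delta>) * (Q x y * ((1 + M * s)\<^sup>2 - \<Delta> * (M * t)\<^sup>2))"
    unfolding N [symmetric] by simp
  finally have "Q x' y' = Q x y * ((1 + M * s)\<^sup>2 - \<Delta> * (M * t)\<^sup>2)" using \<Delta>(2) by simp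
  thus ?thesis by blast
qed

text \<open>Descent: if p divides the norm and d is a nonresidue, then p divides both W and Z, and a
  factor p^2 splits off.\<close>

lemma even_multiplicity_norm:
  fixes d :: int
  assumes p: "prime p" "Legendre d (int p) = -1" and N: "W\<^sup>2 - d * Z\<^sup>2 = N" "N \<noteq> 0"
  shows "even (multiplicity (int p) N)"
  using N
proof (induction "nat \<bar>N\<bar>" arbitrary: N W Z rule: less_induct)
  case less
  have nr: "\<not> QuadRes (int p) d" using p by (auto simp: Legendre_def split: if_splits)
  have pp: "prime (int p)" using p by simp
  show ?case
  proof (cases "int p dvd N")
    case False
    thus ?thesis by (simp add: not_dvd_imp_multiplicity_0)
  next
    case True
    have pZ: "int p dvd Z"
    proof (rule ccontr)
      assume "\<not> int p dvd Z"
      hence "coprime Z (int p)" using pp by (metis prime_imp_coprime coprime_commute)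
      then obtain x where x: "[Z * x = 1] (mod int p)" using cong_solve_coprime_int by blast
      have "[W\<^sup>2 = d * Z\<^sup>2] (mod int p)" using True less.prems by (simp add: cong_iff_dvd_diff)
      hence "[W\<^sup>2 * x\<^sup>2 = d * Z\<^sup>2 * x\<^sup>2] (mod int p)" by (rule cong_scalar_right)
      moreover have "[d * (Z * x)\<^sup>2 = d * 1\<^sup>2] (mod int p)" by (intro cong_scalar_left cong_pow x)
      ultimately have "[(W * x)\<^sup>2 = d] (mod int p)"
        by (simp add: power_mult_distrib mult.assoc) (metis cong_trans)
      thus False using nr unfolding QuadRes_def by blast
    qed
    have pW: "int p dvd W"
    proof -
      have "int p dvd N + d * Z\<^sup>2" using True pZ by (intro dvd_add dvd_mult) (auto simp: power2_eq_square)
      also have "N + d * Z\<^sup>2 = W\<^sup>2" using less.prems by simp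
      finally show ?thesis using pp prime_dvd_power by blast
    qed
    obtain W' Z' where WZ: "W = int p * W'" "Z = int p * Z'" using pW pZ by (auto elim!: dvdE)
    define N' where "N' = W'\<^sup>2 - d * Z'\<^sup>2"
    have NN: "N = (int p)\<^sup>2 * N'" using less.prems by (simp add: N'_def WZ power_mult_distrib algebra_simps)
    have N0: "N' \<noteq> 0" using NN less.prems by auto
    have "\<bar>N'\<bar> * 1 < \<bar>N'\<bar> * (int p)\<^sup>2"
      using N0 prime_gt_1_nat[OF p(1)] by (intro mult_strict_left_mono) (auto simp: power2_eq_square less_1_mult)
    hence "nat \<bar>N'\<bar> < nat \<bar>N\<bar>" unfolding NN abs_mult by (simp add: mult.commute)
    hence "even (multiplicity (int p) N')" using less.hyps N'_def N0 by blast
    moreover have "multiplicity (int p) N = 2 + multiplicity (int p) N'"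
      unfolding NN using pp N0 by (subst prime_elem_multiplicity_mult_distrib) (auto simp: prime_elem_multiplicity_power_distrib multiplicity_same_power)
    ultimately show ?thesis by simp
  qed
qed

context real_char
begin

lemma r_nonzero_of_even:
  assumes "n > 0" "\<And>p. prime p \<Longrightarrow> chi p = -1 \<Longrightarrow> even (multiplicity p n)"
  shows "r n \<noteq> 0"
  using assms
proof (induction n rule: prime_power_coprime_induct)
  case (step p k m)
  have cop: "coprime (p ^ k) m" using step by (simp add: prime_imp_coprime)
  have rm: "r (p ^ k * m) = r (p ^ k) * r m"
    using step cop by (intro r_mult) (auto simp: prime_gt_0_nat)
  have mult: "multiplicity p' (p ^ k * m) = (if p' = p then k else 0) + multiplicity p' m" if "prime p'" for p'
  proof -
    have "multiplicity p' (p ^ k * m) = k * multiplicity p' p + multiplicity p' m"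
      using that step by (simp add: prime_elem_multiplicity_mult_distrib prime_elem_multiplicity_power_distrib prime_gt_0_nat)
    moreover have "multiplicity p' p = (if p' = p then 1 else 0)"
      using that step by (simp add: prime_multiplicity_other)
    ultimately show ?thesis by simp
  qed
  have "multiplicity p m = 0" using step by (simp add: not_dvd_imp_multiplicity_0)
  hence "chi p = -1 \<Longrightarrow> even k" using step.prems[of p] mult[of p] step.hyps by simp
  moreover have "r m \<noteq> 0"
  proof (rule step.IH)
    fix p' assume p': "prime p'" "chi p' = -1"
    thus "even (multiplicity p' m)"
      using step.prems[OF p'] mult[OF p'(1)] \<open>multiplicity p m = 0\<close> by (cases "p' = p") auto
  qed
  ultimately show ?case
    using chi_cases[of p] r_prime_power_cases[OF step.hyps(1), of k] rm by auto
qed auto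

end

section \<open>Least common multiples\<close>

text \<open>Let c be the product of the interior terms. The induction hypothesis for the progression
  without its last and without its first term shows that c times either end divides n! L, hence so
  does c times the lcm of the ends. Their gcd divides m (n + 1) and is coprime to m, so it divides n
  + 1, the factor gained by the factorial.\<close>

lemma prod_AP_dvd:
  fixes u m :: nat
  assumes "coprime u m" "u > 0"
  shows "(\<Prod>i<Suc n. u + m * i) dvd fact n * Lcm ((\<lambda>i. u + m * i) ` {..<Suc n})"
  using assms
proof (induction n arbitrary: u)
  case (Suc n)
  define f where "f = (\<lambda>i. u + m * i)"
  define L where "L = Lcm (f ` {..<Suc (Suc n)})"
  define c where "c = (\<Prod>i<n. f (Suc i))"
  have f_Suc: "f (Suc i) = (u + m) + m * i" for i by (simp add: f_def)
  have "f 0 * c = (\<Prod>i<Suc n. f i)"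
    unfolding c_def by (subst prod.lessThan_Suc_shift) simp
  also have "\<dots> dvd fact n * Lcm (f ` {..<Suc n})" using Suc.IH[OF Suc.prems] by (simp only: f_def)
  also have "\<dots> dvd fact n * L" unfolding L_def by (intro mult_dvd_mono Lcm_subset) auto
  finally have 1: "c * f 0 dvd fact n * L" by (simp only: mult.commute)
  have "c * f (Suc n) = (\<Prod>i<Suc n. f (Suc i))" by (simp add: c_def)
  also have "\<dots> dvd fact n * Lcm ((\<lambda>i. f (Suc i)) ` {..<Suc n})"
  proof -
    have "coprime (u + m) m" using Suc.prems(1) unfolding coprime_iff_gcd_eq_1 by simp
    from Suc.IH[OF this] Suc.prems(2) show ?thesis unfolding f_Suc by simp
  qed
  also have "\<dots> dvd fact n * L" unfolding L_def by (intro mult_dvd_mono Lcm_subset) auto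
  finally have 2: "c * f (Suc n) dvd fact n * L" .
  have "c * lcm (f 0) (f (Suc n)) = lcm (c * f 0) (c * f (Suc n))" by (simp add: lcm_mult_left)
  also have "\<dots> dvd fact n * L" using 1 2 by (rule lcm_least)
  finally have 3: "c * lcm (f 0) (f (Suc n)) dvd fact n * L" .
  have "gcd (f 0) (f (Suc n)) dvd Suc n"
  proof -
    have "gcd (f 0) (f (Suc n)) dvd f (Suc n) - f 0" by (intro dvd_diff_nat) auto
    also have "f (Suc n) - f 0 = m * Suc n" by (simp add: f_def)
    finally have "gcd (f 0) (f (Suc n)) dvd m * Suc n" .
    moreover have "coprime (gcd (f 0) (f (Suc n))) m"
      using Suc.prems(1) by (auto simp: f_def intro: coprime_divisors[OF gcd_dvd1 dvd_refl])
    ultimately show ?thesis by (simp only: coprime_dvd_mult_right_iff)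
  qed
  with 3 have "c * lcm (f 0) (f (Suc n)) * gcd (f 0) (f (Suc n)) dvd fact n * L * Suc n"
    by (rule mult_dvd_mono)
  also have "c * lcm (f 0) (f (Suc n)) * gcd (f 0) (f (Suc n)) = f 0 * (c * f (Suc n))"
    using prod_gcd_lcm_nat[of "f 0" "f (Suc n)"] by (simp add: mult_ac)
  also have "\<dots> = (\<Prod>i<Suc (Suc n). f i)"
    by (subst prod.lessThan_Suc_shift) (simp add: c_def)
  also have "fact n * L * Suc n = fact (Suc n) * L" by (simp add: mult_ac)
  finally show ?case by (simp only: f_def L_def)
qed auto

lemma Lcm_AP_ge:
  fixes u m :: nat
  assumes "coprime u m" "u > 0"
  shows "m ^ n \<le> Lcm ((\<lambda>i. u + m * i) ` {..<Suc n})"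
proof -
  let ?L = "Lcm ((\<lambda>i. u + m * i) ` {..<Suc n})"
  have "fact n * m ^ n = (\<Prod>i<n. m * Suc i)"
    by (induction n) (simp_all add: algebra_simps)
  also have "\<dots> \<le> (\<Prod>i<n. u + m * Suc i)" by (intro prod_mono) auto
  also have "\<dots> \<le> u * (\<Prod>i<n. u + m * Suc i)" using assms by simp
  also have "\<dots> = (\<Prod>i<Suc n. u + m * i)" by (subst prod.lessThan_Suc_shift) simp
  also have "\<dots> \<le> fact n * ?L"
  proof (rule dvd_imp_le[OF prod_AP_dvd[OF assms]])
    have "?L \<noteq> 0" using assms by (auto simp: Lcm_0_iff)
    hence "?L > 0" by (rule neq0_conv[THEN iffD1])
    thus "0 < fact n * ?L" by (intro mult_pos_pos fact_gt_zero)
  qed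
  finally show ?thesis by simp
qed

text \<open>After division by g = gcd(r, 2m) the step is v = 2m/g >= 2, because g <= r <= m. For
  step m the reduced step could be 1 and the bound v^n trivial; hence the doubling.\<close>

lemma ln_Lcm_AP_ge:
  assumes "0 < r" "r \<le> m"
  shows "real n * ln 2 \<le> ln (real (Lcm ((\<lambda>i. r + 2 * m * i) ` {..<Suc n})))"
proof -
  define g where "g = gcd r (2 * m)"
  have g0: "g > 0" using assms by (simp add: g_def)
  have "g dvd r" "g dvd 2 * m" by (auto simp: g_def)
  then obtain u v where uv: "r = g * u" "2 * m = g * v" by (auto elim!: dvdE)
  have "g * gcd u v = gcd (g * u) (g * v)" by (rule gcd_mult_distrib_nat)
  also have "\<dots> = g" by (simp only: uv(1) [symmetric] uv(2) [symmetric]) (simp add: g_def)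
  finally have "gcd u v = 1" using g0 by simp
  hence cop: "coprime u v" by (rule gcd_eq_1_imp_coprime)
  have u0: "u > 0" using uv assms by (auto intro!: Nat.gr0I)
  have v2: "v \<ge> 2"
  proof (rule ccontr)
    assume "\<not> v \<ge> 2"
    hence "g * v \<le> g * 1" by (intro mult_le_mono) auto
    hence "2 * m \<le> g" using uv by simp
    also have "g \<le> r" using \<open>g dvd r\<close> assms by (auto dest: dvd_imp_le)
    finally show False using assms by simp
  qed
  let ?L = "Lcm ((\<lambda>i. r + 2 * m * i) ` {..<Suc n})" and ?L' = "Lcm ((\<lambda>i. u + v * i) ` {..<Suc n})"
  have "?L' dvd ?L"
  proof (rule Lcm_least)
    fix x assume "x \<in> (\<lambda>i. u + v * i) ` {..<Suc n}"
    then obtain i where i: "i < Suc n" "x = u + v * i" by auto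
    have "x dvd g * x" by simp
    also have "g * x = r + 2 * m * i" unfolding uv i by (simp add: algebra_simps)
    also have "\<dots> dvd ?L" using i by (intro dvd_Lcm) auto
    finally show "x dvd ?L" .
  qed
  moreover have "?L \<noteq> 0" using assms by (auto simp: Lcm_0_iff)
  ultimately have "?L' \<le> ?L" by (blast intro: dvd_imp_le neq0_conv[THEN iffD1])
  moreover have "(2::nat) ^ n \<le> v ^ n" using v2 by (intro power_mono) auto
  ultimately have "2 ^ n \<le> ?L" using Lcm_AP_ge[OF cop u0, of n] by linarith
  hence "real (2 ^ n) \<le> real ?L" by (simp only: of_nat_le_iff)
  hence "ln (2 ^ n) \<le> ln (real ?L)" by (subst ln_le_cancel_iff) (auto intro: less_le_trans[of 0 "2 ^ n"])
  thus ?thesis by (simp add: ln_realpow)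
qed

lemma ln_Lcm_le_of_dvd:
  fixes A :: "int set" and B :: "nat set"
  assumes "finite A" "\<And>a. a \<in> A \<Longrightarrow> a > 0" "\<And>b. b \<in> B \<Longrightarrow> \<exists>a\<in>A. int b dvd a"
  shows "ln (real (Lcm B)) \<le> ln (real_of_int (Lcm A))"
proof -
  have A0: "Lcm A > 0"
  proof -
    have "Lcm A \<noteq> 0" using assms(1,2) by (force simp: Lcm_0_iff)
    moreover have "Lcm A \<ge> 0" by simp
    ultimately show ?thesis by linarith
  qed
  have "Lcm B dvd nat (Lcm A)"
  proof (rule Lcm_least)
    fix b assume "b \<in> B"
    then obtain a where "a \<in> A" "int b dvd a" using assms(3) by blast
    hence "int b dvd Lcm A" by (meson dvd_Lcm dvd_trans)
    also have "Lcm A = int (nat (Lcm A))" using A0 by simp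
    finally show "b dvd nat (Lcm A)" by (simp only: of_nat_dvd_iff)
  qed
  moreover have A1: "nat (Lcm A) > 0" using A0 by simp
  ultimately have "Lcm B \<le> nat (Lcm A)" "Lcm B > 0"
    by (blast intro: dvd_imp_le dvd_pos_nat)+
  hence "ln (real (Lcm B)) \<le> ln (real (nat (Lcm A)))" by (subst ln_le_cancel_iff) auto
  thus ?thesis using A0 by simp
qed

section \<open>Represented integers as sets of natural numbers\<close>

lemma floor_bounds:
  fixes N :: real
  assumes "N \<ge> 1"
  shows "real (nat \<lfloor>N\<rfloor>) \<le> N" "N \<le> 2 * real (nat \<lfloor>N\<rfloor>)" "nat \<lfloor>N\<rfloor> \<ge> 1"
proof -
  have f: "\<lfloor>N\<rfloor> \<ge> 1" using assms by simp
  show "real (nat \<lfloor>N\<rfloor>) \<le> N" using f by simp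
  show "nat \<lfloor>N\<rfloor> \<ge> 1" using nat_mono[OF f] by simp
  have "N < real_of_int \<lfloor>N\<rfloor> + 1" by simp
  also have "\<dots> \<le> 2 * real_of_int \<lfloor>N\<rfloor>" using f by simp
  also have "\<dots> = 2 * real (nat \<lfloor>N\<rfloor>)" using f by simp
  finally show "N \<le> 2 * real (nat \<lfloor>N\<rfloor>)" by simp
qed

lemma rep_upto_iff: "int n \<in> rep_upto F N \<longleftrightarrow> n \<in> {1..nat \<lfloor>N\<rfloor>} \<and> represented F (int n)"
proof -
  have "real n \<le> N \<longleftrightarrow> n \<le> nat \<lfloor>N\<rfloor>" if "n > 0"
  proof -
    have "n \<le> nat \<lfloor>N\<rfloor> \<longleftrightarrow> int n \<le> \<lfloor>N\<rfloor>"
      using that by linarith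
    also have "\<dots> \<longleftrightarrow> real n \<le> N" by (simp add: le_floor_iff)
    finally show ?thesis ..
  qed
  thus ?thesis by (auto simp: rep_upto_def)
qed

lemma card_rep_upto: "card (rep_upto F N) = card ({n. n > 0 \<and> represented F (int n)} \<inter> {1..nat \<lfloor>N\<rfloor>})"
proof -
  have "rep_upto F N = int ` ({n. n > 0 \<and> represented F (int n)} \<inter> {1..nat \<lfloor>N\<rfloor>})"
  proof (intro equalityI subsetI)
    fix x assume x: "x \<in> rep_upto F N"
    hence "x = int (nat x)" by (simp add: rep_upto_def)
    with x rep_upto_iff[of "nat x" F N] show "x \<in> int ` ({n. n > 0 \<and> represented F (int n)} \<inter> {1..nat \<lfloor>N\<rfloor>})"
      by (intro image_eqI[of _ _ "nat x"]) auto
  qed (use rep_upto_iff in auto)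
  thus ?thesis by (simp add: card_image)
qed

lemma psi_F_upper: "N \<ge> 1 \<Longrightarrow> psi_F F N \<le> 4 * N"
proof -
  assume N: "N \<ge> 1"
  define n where "n = nat \<lfloor>N\<rfloor>"
  have L0: "Lcm {1..n} > 0" by (auto intro!: Nat.gr0I simp: Lcm_0_iff)
  have "Lcm (rep_upto F N) dvd int (Lcm {1..n})"
  proof (rule Lcm_least)
    fix x assume x: "x \<in> rep_upto F N"
    hence "x = int (nat x)" by (simp add: rep_upto_def)
    with x rep_upto_iff[of "nat x" F N] have "nat x \<in> {1..n}" by (simp add: n_def)
    hence "nat x dvd Lcm {1..n}" by (rule dvd_Lcm)
    thus "x dvd int (Lcm {1..n})" using \<open>x = int (nat x)\<close> by (metis of_nat_dvd_iff)
  qed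
  hence "Lcm (rep_upto F N) \<le> int (Lcm {1..n})" "Lcm (rep_upto F N) \<noteq> 0"
    using L0 by (auto intro: zdvd_imp_le)
  moreover have "Lcm (rep_upto F N) \<ge> 0" by simp
  ultimately have "ln (real_of_int (Lcm (rep_upto F N))) \<le> ln (real (Lcm {1..n}))"
    by (subst ln_le_cancel_iff) linarith+
  also have "\<dots> \<le> psi n" by (rule ln_Lcm_le_psi)
  also have "\<dots> \<le> 4 * real n" by (rule psi_le)
  also have "\<dots> \<le> 4 * N" using floor_bounds[OF N] by (simp add: n_def)
  finally show ?thesis by (simp add: psi_F_def)
qed

lemma bigtheta_at_top_I:
  fixes f g :: "real \<Rightarrow> real"
  assumes "c > 0" "\<And>N. N \<ge> N0 \<Longrightarrow> 0 \<le> g N" "\<And>N. N \<ge> N0 \<Longrightarrow> c * g N \<le> f N" "\<And>N. N \<ge> N0 \<Longrightarrow> f N \<le> C * g N"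
  shows "f \<in> \<Theta>(g)"
\<comment> \<open>The maximum is a positive constant whatever the sign of C.\<close>
proof (rule bigthetaI'[of c "max C c"])
  show "\<forall>\<^sub>F N in at_top. c * norm (g N) \<le> norm (f N) \<and> norm (f N) \<le> max C c * norm (g N)"
    using eventually_ge_at_top[of N0]
  proof eventually_elim
    case (elim N)
    have "0 \<le> c * g N" using assms elim by simp
    hence "f N \<ge> 0" using assms(3)[OF elim] by linarith
    moreover have "C * g N \<le> max C c * g N" using assms(2)[OF elim] by (intro mult_right_mono) auto
    ultimately show ?case using assms(2-4)[OF elim] by simp
  qed
qed (use assms in auto)

text \<open>With 0 < r <= m the t-th term is at most m (t + 1), so about N/m terms lie below N. For
  \<open>psi_F\<close> only even t are used, a progression with step 2m to which
  \<open>ln_Lcm_AP_ge\<close> applies.\<close>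

lemma AP_bounds:
  fixes r m :: nat
  assumes r: "0 < r" "r \<le> m" and rep: "\<And>t. represented F (int (r + m * t))"
  shows "delta_F F \<in> \<Theta>(\<lambda>N. 1)" "psi_F F \<in> \<Theta>(\<lambda>N. N)"
proof -
  have m0: "m > 0" using r by simp
  have up: "delta_F F N \<le> 1" if N: "N \<ge> 1" for N
  proof -
    have "card (rep_upto F N) \<le> card {1..nat \<lfloor>N\<rfloor>}" unfolding card_rep_upto by (intro card_mono) auto
    hence "real (card (rep_upto F N)) \<le> N" using floor_bounds[OF N] by simp
    thus ?thesis using N by (simp add: delta_F_def)
  qed
  have lo: "1 / (4 * real m) * 1 \<le> delta_F F N" if N: "N \<ge> real (4 * m)" for N
  proof -
    define n where "n = nat \<lfloor>N\<rfloor>"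
    have N1: "N \<ge> 1" using N m0 by linarith
    define k where "k = n div m"
    have "(\<lambda>t. r + m * t) ` {..<k} \<subseteq> {n. n > 0 \<and> represented F (int n)} \<inter> {1..n}"
    proof
      fix x assume "x \<in> (\<lambda>t. r + m * t) ` {..<k}"
      then obtain t where t: "t < k" "x = r + m * t" by auto
      have "x \<le> m * Suc t" using t r by simp
      also have "\<dots> \<le> m * k" using t by (intro mult_le_mono) auto
      also have "\<dots> \<le> n" by (simp add: k_def)
      finally show "x \<in> {n. n > 0 \<and> represented F (int n)} \<inter> {1..n}" using t r rep[of t] by simp
    qed
    hence "card ((\<lambda>t. r + m * t) ` {..<k}) \<le> card (rep_upto F N)"
      unfolding card_rep_upto n_def by (intro card_mono) auto
    moreover have "card ((\<lambda>t. r + m * t) ` {..<k}) = k" using m0 by (subst card_image) (auto simp: inj_on_def)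
    ultimately have kc: "k \<le> card (rep_upto F N)" by simp
    have "n \<ge> m" using N floor_bounds[OF N1] by (simp add: n_def)
    hence "k \<ge> 1" using m0 by (simp add: k_def Suc_le_eq div_greater_zero_iff)
    have "n < m * Suc k" using dividend_less_times_div[of m n] m0 by (simp add: k_def)
    also have "\<dots> \<le> m * (2 * k)" using \<open>k \<ge> 1\<close> by (intro mult_le_mono) auto
    finally have "real n \<le> real (m * (2 * k))" by (simp only: of_nat_le_iff less_imp_le)
    hence "N \<le> 4 * real m * real k" using floor_bounds[OF N1] by (simp add: n_def)
    also have "\<dots> \<le> 4 * real m * real (card (rep_upto F N))" using kc by (intro mult_left_mono) auto
    finally show ?thesis using N1 m0 by (simp add: delta_F_def field_simps)
  qed
  show "delta_F F \<in> \<Theta>(\<lambda>N. 1)"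
  proof (rule bigtheta_at_top_I[of "1 / (4 * real m)" "real (4 * m)" _ _ 1])
    fix N :: real assume N: "N \<ge> real (4 * m)"
    hence "N \<ge> 1" using m0 by linarith
    thus "delta_F F N \<le> 1 * 1" using up by simp
  qed (use lo m0 in auto)
  have lo2: "ln 2 / (16 * real m) * N \<le> psi_F F N" if N: "N \<ge> real (8 * m)" for N
  proof -
    define n where "n = nat \<lfloor>N\<rfloor>"
    have N1: "N \<ge> 1" using N m0 by linarith
    \<comment> \<open>The shift by 1 makes exactly \<open>Suc k\<close> terms fit below n; N >= 8 m
      guarantees k >= 1.\<close>
    define k where "k = n div (2 * m) - 1"
    have "2 * n \<ge> 8 * m" using N floor_bounds[OF N1] by (simp add: n_def)
    hence "n div (2 * m) \<ge> 2" using m0 by (simp add: less_eq_div_iff_mult_less_eq)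
    hence k: "n div (2 * m) = Suc k" "k \<ge> 1" by (auto simp: k_def)
    have "real k * ln 2 \<le> ln (real (Lcm ((\<lambda>i. r + 2 * m * i) ` {..<Suc k})))"
      by (rule ln_Lcm_AP_ge) (use r in auto)
    also have "\<dots> \<le> psi_F F N"
      unfolding psi_F_def
    proof (rule ln_Lcm_le_of_dvd)
      fix x assume "x \<in> (\<lambda>i. r + 2 * m * i) ` {..<Suc k}"
      then obtain i where i: "i < Suc k" "x = r + 2 * m * i" by auto
      have "x \<le> 2 * m * Suc i" using i r by simp
      also have "\<dots> \<le> 2 * m * Suc k" using i by (intro mult_le_mono) auto
      also have "\<dots> \<le> n" using k(1) by (metis times_div_less_eq_dividend)
      finally have "x \<le> n" .
      moreover have "x = r + m * (2 * i)" using i(2) by simp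
      hence "represented F (int x)" using rep[of "2 * i"] by (simp only:)
      moreover have "x \<ge> 1" using i(2) r by simp
      ultimately have "int x \<in> rep_upto F N" unfolding rep_upto_iff n_def by simp
      thus "\<exists>a\<in>rep_upto F N. int x dvd a" by (rule bexI[rotated]) (rule dvd_refl)
    next
      show "finite (rep_upto F N)" by (rule finite_rep_upto)
      show "a > 0" if "a \<in> rep_upto F N" for a using that by (simp add: rep_upto_def)
    qed
    finally have 1: "real k * ln 2 \<le> psi_F F N" .
    have "n < 2 * m * Suc (Suc k)" using dividend_less_times_div[of "2 * m" n] m0 k(1) by simp
    also have "\<dots> \<le> 2 * m * (4 * k)" using k(2) by (intro mult_le_mono) auto
    finally have "real n \<le> real (2 * m * (4 * k))" by (simp only: of_nat_le_iff less_imp_le)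
    hence "N \<le> 16 * real m * real k" using floor_bounds[OF N1] by (simp add: n_def)
    hence "ln 2 * N \<le> ln 2 * (16 * real m * real k)" by (intro mult_left_mono) auto
    hence "ln 2 / (16 * real m) * N \<le> real k * ln 2" using m0 by (simp add: field_simps)
    with 1 show ?thesis by linarith
  qed
  show "psi_F F \<in> \<Theta>(\<lambda>N. N)"
  proof (rule bigtheta_at_top_I[of "ln 2 / (16 * real m)" "real (8 * m)" _ _ 4])
    fix N :: real assume N: "N \<ge> real (8 * m)"
    hence "N \<ge> 1" using m0 by linarith
    thus "psi_F F N \<le> 4 * N" "0 \<le> N" using psi_F_upper by simp_all
  qed (use lo2 m0 in auto)
qed

lemma bipoly_quadratic:
  fixes a b c e f g :: int
  shows "of_int a * varX ^ 2 + of_int b * varX * varY + of_int c * varY ^ 2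
           + of_int e * varX + of_int f * varY + of_int g = [:[:g,f,c:],[:e,b:],[:a:]:]"
  by (simp add: varX_def varY_def of_int_poly power2_eq_square)

text \<open>The three equations say that the derivative of F in the direction (p, q) vanishes
  identically, coefficient by coefficient.\<close>

lemma quadratic_lin_indep:
  fixes a b c e f g p q :: int
  assumes F: "F = [:[:g,f,c:],[:e,b:],[:a:]:]"
    and indep: "lin_indep_rat (partial_x F) (partial_y F)"
    and 0: "p * e + q * f = 0" "p * b + 2 * q * c = 0" "2 * p * a + q * b = 0"
  shows "p = 0 \<and> q = 0"
proof -
  have x: "partial_x F = [:[:e,b:],[:2*a:]:]" by (simp add: partial_x_def F pderiv_pCons)
  have y: "partial_y F = [:[:f,2*c:],[:b:]:]" by (simp add: partial_y_def F map_poly_pCons pderiv_pCons)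
  have "Polynomial.smult [:of_int p:] (rat_bipoly (partial_x F)) + Polynomial.smult [:of_int q:] (rat_bipoly (partial_y F)) =
     [:[:of_int (p * e + q * f), of_int (p * b + 2 * q * c):],[:of_int (2 * p * a + q * b):]:]"
    unfolding x y rat_bipoly_def by (simp add: map_poly_pCons mult_ac)
  also have "\<dots> = 0" unfolding 0 by simp
  finally have "of_int p = (0::rat) \<and> of_int q = (0::rat)" using indep unfolding lin_indep_rat_def by blast
  thus ?thesis by simp
qed

section \<open>Order of magnitude\<close>

text \<open>Here the analysis meets the arithmetic. A bounded multiplier sends the split u <= N/K to
  represented integers up to N, which gives both lower bounds; nonvanishing of r puts every
  represented integer into the form u d k^2, which gives the upper bound for the density.\<close>

lemma (in real_char) split_multiplier_bounds:
  assumes k: "\<And>n. split n \<Longrightarrow> 0 < k n \<and> k n \<le> K \<and> represented F (int (k n * n))"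
    and r: "\<And>n. n > 0 \<Longrightarrow> represented F (int n) \<Longrightarrow> r n \<noteq> 0"
  shows "delta_F F \<in> \<Theta>(\<lambda>N. 1 / sqrt (ln N))" "psi_F F \<in> \<Theta>(\<lambda>N. N)"
proof -
  have K0: "K > 0" using k[of 1] by simp
  obtain c n0 where c: "c > 0" "n0 \<ge> 2" "\<And>n. n \<ge> n0 \<Longrightarrow> c * real n / sqrt (ln (real n)) \<le> cnt n"
    using cnt_lower by blast
  obtain c' n1 where c': "c' > 0" "n1 \<ge> 1" "\<And>n. n \<ge> n1 \<Longrightarrow> c' * real n \<le> theta n"
    using theta_lower by blast
  define A where "A = {n. n > 0 \<and> represented F (int n)}"
  have "n > 0 \<and> (\<exists>u d k. n = u * (d * k\<^sup>2) \<and> split u \<and> d dvd q)" if "n \<in> A" for n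
    using r_nonzero_decomp[of n] r that unfolding A_def by blast
  from card_split_times_square[of A, OF this] obtain C where
    C: "C > 0" "\<And>n. n \<ge> 1 \<Longrightarrow> real (card (A \<inter> {1..n})) * sqrt (1 + ln (real n)) \<le> C * real n" by blast
  \<comment> \<open>The factor 2 pays for N <= 2 floor(N); the rest makes y = floor(N) div K exceed
    both thresholds.\<close>
  define N0 where "N0 = real (2 * K * max n0 n1)"
  have y: "\<exists>y. y \<ge> n0 \<and> y \<ge> n1 \<and> K * y \<le> nat \<lfloor>N\<rfloor> \<and> N \<le> 4 * real K * real y \<and> real y \<le> N"
    if N: "N \<ge> N0" for N
  proof -
    have "2 * K * max n0 n1 \<ge> 1" using K0 c by (simp add: Suc_le_eq)
    hence N1: "N \<ge> 1" using N unfolding N0_def by linarith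
    define n where "n = nat \<lfloor>N\<rfloor>"
    define y where "y = n div K"
    have "2 * n \<ge> 2 * K * max n0 n1" using N floor_bounds[OF N1] unfolding N0_def n_def by linarith
    hence "max n0 n1 * K \<le> n" by (simp only: mult.assoc mult.commute[of K] mult_le_cancel1)
    hence yge: "y \<ge> max n0 n1" unfolding y_def less_eq_div_iff_mult_less_eq[OF K0] .
    have "n < K * Suc y" using dividend_less_times_div[of K n] K0 by (simp add: y_def)
    also have "\<dots> \<le> K * (2 * y)" using yge c by (intro mult_le_mono) auto
    finally have "real n \<le> real (K * (2 * y))" by (simp only: of_nat_le_iff less_imp_le)
    hence "N \<le> 4 * real K * real y" using floor_bounds[OF N1] by (simp add: n_def)
    moreover have "K * y \<le> n" by (simp add: y_def)
    moreover have "y \<le> n" by (simp add: y_def)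
    hence "real y \<le> N" using floor_bounds[OF N1] unfolding n_def by linarith
    ultimately show ?thesis using yge unfolding n_def by (intro exI[of _ y]) auto
  qed
  have lo: "c / (4 * real K * real K) * (1 / sqrt (ln N)) \<le> delta_F F N" if N: "N \<ge> N0" for N
  proof -
    from y[OF N] obtain y where y: "y \<ge> n0" "K * y \<le> nat \<lfloor>N\<rfloor>" "N \<le> 4 * real K * real y" "real y \<le> N" by blast
    have y2: "y \<ge> 2" using y c by simp
    have lny: "0 < ln (real y)" "ln (real y) \<le> ln N" using y2 y by auto
    have N0: "N > 0" using y y2 by linarith
    let ?G = "{u \<in> {1..y}. split u}"
    \<comment> \<open>The map from u to k u * u need not be injective, but it is so on each set
      where the multiplier is constant. At most K such sets occur, whence a loss of a factor
      K.\<close>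
    have "card ?G \<le> card (\<Union>j\<in>{1..K}. {u \<in> ?G. k u = j})"
      using k by (intro card_mono) (auto simp: Suc_le_eq)
    also have "\<dots> \<le> (\<Sum>j\<in>{1..K}. card {u \<in> ?G. k u = j})" by (rule card_UN_le) auto
    also have "\<dots> \<le> (\<Sum>j\<in>{1..K}. card (rep_upto F N))"
    proof (intro sum_mono)
      fix j assume j: "j \<in> {1..K}"
      have "(\<lambda>u. j * u) ` {u \<in> ?G. k u = j} \<subseteq> A \<inter> {1..nat \<lfloor>N\<rfloor>}"
      proof
        fix x assume "x \<in> (\<lambda>u. j * u) ` {u \<in> ?G. k u = j}"
        then obtain u where u: "u \<ge> 1" "u \<le> y" "split u" "k u = j" "x = j * u" by auto
        have "x \<le> K * y" unfolding u(5) using u j by (intro mult_le_mono) auto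
        also note y(2)
        finally show "x \<in> A \<inter> {1..nat \<lfloor>N\<rfloor>}" using k[OF u(3)] u j by (simp add: A_def)
      qed
      hence "card ((\<lambda>u. j * u) ` {u \<in> ?G. k u = j}) \<le> card (rep_upto F N)"
        unfolding card_rep_upto A_def by (intro card_mono) auto
      also have "card ((\<lambda>u. j * u) ` {u \<in> ?G. k u = j}) = card {u \<in> ?G. k u = j}"
        using j by (subst card_image) (auto simp: inj_on_def)
      finally show "card {u \<in> ?G. k u = j} \<le> card (rep_upto F N)" .
    qed
    also have "\<dots> = K * card (rep_upto F N)" by simp
    finally have "cnt y \<le> real (K * card (rep_upto F N))" unfolding cnt_def of_nat_le_iff .
    hence 1: "cnt y \<le> real K * real (card (rep_upto F N))" by simp
    have "c * (N / (4 * real K)) / sqrt (ln N) \<le> c * real y / sqrt (ln (real y))"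
      using y(3) K0 c lny N0 by (intro frac_le mult_left_mono) (auto simp: field_simps)
    also have "\<dots> \<le> cnt y" using c y by blast
    also note 1
    finally have "c * (N / (4 * real K)) / sqrt (ln N) / (real K * N) \<le> real K * real (card (rep_upto F N)) / (real K * N)"
      using K0 N0 by (intro divide_right_mono) auto
    thus ?thesis using K0 N0 by (simp add: delta_F_def field_simps)
  qed
  have up: "delta_F F N \<le> C * (1 / sqrt (ln N))" if N: "N \<ge> N0" for N
  proof -
    from y[OF N] obtain y where y: "y \<ge> n0" "real y \<le> N" by blast
    have N2: "N \<ge> 2" using y c by linarith
    define n where "n = nat \<lfloor>N\<rfloor>"
    have n: "real n \<le> N" "N \<le> 2 * real n" "n \<ge> 1" using floor_bounds[of N] N2 unfolding n_def by auto
    have "ln N \<le> ln (2 * real n)" using n N2 by (subst ln_le_cancel_iff) auto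
    also have "\<dots> = ln 2 + ln (real n)" using n by (simp add: ln_mult)
    also have "ln 2 \<le> (1::real)" using ln_le_minus_one[of "2::real"] by simp
    finally have "sqrt (ln N) \<le> sqrt (1 + ln (real n))" by simp
    hence "real (card (rep_upto F N)) * sqrt (ln N) \<le> real (card (A \<inter> {1..n})) * sqrt (1 + ln (real n))"
      unfolding card_rep_upto A_def n_def by (intro mult_left_mono) auto
    also have "\<dots> \<le> C * real n" using C n by blast
    also have "\<dots> \<le> C * N" using C n by (intro mult_left_mono) auto
    finally show ?thesis using N2 by (simp add: delta_F_def field_simps)
  qed
  show "delta_F F \<in> \<Theta>(\<lambda>N. 1 / sqrt (ln N))"
  proof (rule bigtheta_at_top_I[of "c / (4 * real K * real K)" N0 _ _ C])
    fix N assume "N \<ge> N0"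
    from y[OF this] obtain y where "y \<ge> n0" "real y \<le> N" by blast
    hence "N \<ge> 1" using c by linarith
    thus "0 \<le> 1 / sqrt (ln N)" by simp
  qed (use lo up c K0 in auto)
  have lo2: "c' / (4 * real K) * N \<le> psi_F F N" if N: "N \<ge> N0" for N
  proof -
    from y[OF N] obtain y where y: "y \<ge> n1" "K * y \<le> nat \<lfloor>N\<rfloor>" "N \<le> 4 * real K * real y" by blast
    have "c' / (4 * real K) * N \<le> c' / (4 * real K) * (4 * real K * real y)"
      using y c' K0 by (intro mult_left_mono) auto
    also have "\<dots> = c' * real y" using K0 by simp
    also have "\<dots> \<le> theta y" using c' y by blast
    also have "\<dots> \<le> ln (real (Lcm {u \<in> {1..y}. split u}))" by (rule ln_Lcm_split_ge)
    also have "\<dots> \<le> psi_F F N"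
      unfolding psi_F_def
    proof (rule ln_Lcm_le_of_dvd)
      fix u assume u: "u \<in> {u \<in> {1..y}. split u}"
      hence ku: "0 < k u" "k u \<le> K" "represented F (int (k u * u))" using k by auto
      have "k u * u \<le> K * y" using u ku by (intro mult_le_mono) auto
      also note y(2)
      finally have "int (k u * u) \<in> rep_upto F N" unfolding rep_upto_iff using ku u by simp
      thus "\<exists>a\<in>rep_upto F N. int u dvd a" by (intro bexI[of _ "int (k u * u)"]) auto
    next
      show "finite (rep_upto F N)" by (rule finite_rep_upto)
      show "a > 0" if "a \<in> rep_upto F N" for a using that by (simp add: rep_upto_def)
    qed
    finally show ?thesis .
  qed
  show "psi_F F \<in> \<Theta>(\<lambda>N. N)"
  proof (rule bigtheta_at_top_I[of "c' / (4 * real K)" N0 _ _ 4])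
    fix N assume "N \<ge> N0"
    from y[OF this] obtain y where "y \<ge> n0" "real y \<le> N" by blast
    hence "N \<ge> 1" using c by linarith
    thus "psi_F F N \<le> 4 * N" "0 \<le> N" using psi_F_upper by simp_all
  qed (use lo2 c' K0 in auto)
qed

text \<open>Along a zero direction (p, q) of the quadratic part, F grows linearly with slope l(x,
  y), its derivative in that direction. Independence of the partial derivatives prevents l from
  vanishing everywhere, and a line with nonzero slope supplies the progression.\<close>

lemma square_discriminant_bounds:
  fixes a b c e f g :: int
  assumes F: "F = of_int a * varX ^ 2 + of_int b * varX * varY + of_int c * varY ^ 2
                  + of_int e * varX + of_int f * varY + of_int g"
    and indep: "lin_indep_rat (partial_x F) (partial_y F)"
    and sq: "is_square (b\<^sup>2 - 4 * a * c)"
  shows "delta_F F \<in> \<Theta>(\<lambda>N. 1)" "psi_F F \<in> \<Theta>(\<lambda>N. N)"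
proof -
  define Q where "Q = (\<lambda>x y. a * x ^ 2 + b * x * y + c * y ^ 2 + e * x + f * y + g)"
  have rep: "represented F n \<longleftrightarrow> (\<exists>x y. n = Q x y)" for n
    unfolding represented_def F eval2_quadratic Q_def ..
  have "\<exists>p q. (p \<noteq> 0 \<or> q \<noteq> 0) \<and> a * p\<^sup>2 + b * p * q + c * q\<^sup>2 = 0"
  proof (cases "a = 0")
    case True
    thus ?thesis by (intro exI[of _ 1] exI[of _ 0]) auto
  next
    case False
    obtain k where k: "b\<^sup>2 - 4 * a * c = k\<^sup>2" using sq by (auto simp: is_nth_power_def)
    have "a * (k - b)\<^sup>2 + b * (k - b) * (2 * a) + c * (2 * a)\<^sup>2 = a * (k\<^sup>2 - (b\<^sup>2 - 4 * a * c))"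
      by (simp add: power2_eq_square algebra_simps)
    also have "\<dots> = 0" by (simp add: k)
    \<comment> \<open>The direction comes from the quadratic formula: (k - b)/(2a) is a root of a
      z^2 + b z + c.\<close>
    finally show ?thesis using False by (intro exI[of _ "k - b"] exI[of _ "2 * a"]) auto
  qed
  then obtain p q where pq: "p \<noteq> 0 \<or> q \<noteq> 0" "a * p\<^sup>2 + b * p * q + c * q\<^sup>2 = 0" by blast
  define l where "l = (\<lambda>x y. (2 * p * a + q * b) * x + (p * b + 2 * q * c) * y + (p * e + q * f))"
  have "\<exists>x y. l x y \<noteq> 0"
  proof (rule ccontr)
    assume "\<not> ?thesis"
    \<comment> \<open>An affine function is determined by its values at these three points.\<close>
    hence "l 0 0 = 0" "l 1 0 = 0" "l 0 1 = 0" by blast+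
    hence "p * e + q * f = 0" "p * b + 2 * q * c = 0" "2 * p * a + q * b = 0" by (simp_all add: l_def)
    from quadratic_lin_indep[OF _ indep this] pq(1) F bipoly_quadratic show False by simp
  qed
  then obtain x y where l0: "l x y \<noteq> 0" by blast
  have line: "Q (x + t * p) (y + t * q) = Q x y + l x y * t" for t
  proof -
    have "Q (x + t * p) (y + t * q) = Q x y + l x y * t + t\<^sup>2 * (a * p\<^sup>2 + b * p * q + c * q\<^sup>2)"
      by (simp add: Q_def l_def power2_eq_square algebra_simps)
    thus ?thesis by (simp add: pq)
  qed
  define m where "m = nat \<bar>l x y\<bar>"
  \<comment> \<open>The shift by 1 selects the representative of Q x y modulo m in 1..m instead of
    0..m-1. As t runs over all integers, the line attains the whole residue class, in particular all
    its positive members.\<close>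
  define r where "r = nat ((Q x y - 1) mod int m + 1)"
  have m: "m > 0" "int m = \<bar>l x y\<bar>" using l0 by (simp_all add: m_def)
  have mods: "0 \<le> (Q x y - 1) mod int m" "(Q x y - 1) mod int m < int m" using m(1) by simp_all
  hence r: "int r = (Q x y - 1) mod int m + 1" "0 < r" "r \<le> m" unfolding r_def by linarith+
  have "represented F (int (r + m * t))" for t
  proof -
    have "int m dvd int (r + m * t) - Q x y"
    proof -
      have "int m dvd ((Q x y - 1) mod int m - (Q x y - 1)) + int m * int t"
        by (intro dvd_add) (auto simp: mod_eq_dvd_iff [symmetric])
      moreover have "int (r + m * t) - Q x y = ((Q x y - 1) mod int m - (Q x y - 1)) + int m * int t"
        by (simp add: r(1))
      ultimately show ?thesis by (simp only:)
    qed
    hence "l x y dvd int (r + m * t) - Q x y" unfolding m(2) by simp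
    then obtain s where s: "int (r + m * t) - Q x y = l x y * s" by (rule dvdE)
    hence "int (r + m * t) = Q (x + s * p) (y + s * q)" unfolding line by linarith
    thus ?thesis unfolding rep by blast
  qed
  from AP_bounds[OF r(2,3) this] show "delta_F F \<in> \<Theta>(\<lambda>N. 1)" "psi_F F \<in> \<Theta>(\<lambda>N. N)" .
qed

lemma multiplicity_of_nat_int: "multiplicity (int p) (int n) = multiplicity p n"
proof -
  have "int p ^ k dvd int n \<longleftrightarrow> p ^ k dvd n" for k
    by (metis of_nat_dvd_iff of_nat_power)
  thus ?thesis by (simp add: multiplicity_def)
qed

lemma nonsquare_discriminant_bounds:
  fixes a b c e f g \<Delta> :: int
  assumes F: "F = of_int a * varX ^ 2 + of_int b * varX * varY + of_int c * varY ^ 2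
                  + of_int e * varX + of_int f * varY + of_int g"
    and pos: "\<exists>n>0. represented F n"
    and \<Delta>: "\<Delta> = b\<^sup>2 - 4 * a * c" "\<not> is_square \<Delta>"
    and D: "a * f\<^sup>2 + c * e\<^sup>2 - b * f * e + \<Delta> * g = 0"
  shows "delta_F F \<in> \<Theta>(\<lambda>N. 1 / sqrt (ln N))" "psi_F F \<in> \<Theta>(\<lambda>N. N)"
proof -
  define Q where "Q = (\<lambda>x y. a * x ^ 2 + b * x * y + c * y ^ 2 + e * x + f * y + g)"
  have rep: "represented F n \<longleftrightarrow> (\<exists>x y. n = Q x y)" for n
    unfolding represented_def F eval2_quadratic Q_def ..
  have a0: "a \<noteq> 0" using \<Delta> by auto
  have \<Delta>0: "\<Delta> \<noteq> 0" using \<Delta>(2) by auto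
  obtain x1 y1 where F1: "Q x1 y1 > 0" using pos unfolding rep by auto
  define M where "M = 2 * a * \<Delta>"
  define Mn where "Mn = nat \<bar>M\<bar>"
  have Mn: "Mn > 0" "int Mn = \<bar>M\<bar>" using a0 \<Delta>0 by (simp_all add: Mn_def M_def)
  \<comment> \<open>Since 2 |M| divides q, every prime dividing 4 a \<Delta> has value 0: primes
    with value 1 are odd and prime to M, and primes with value -1 do not divide the factor -4 a
    \<Delta> of the norm.\<close>
  obtain chi q where char: "real_char chi (2 * real q) q" and q: "2 * Mn dvd q"
    and chi: "\<And>p. prime p \<Longrightarrow> chi p = (if p dvd q then 0 else real_of_int (Legendre \<Delta> (int p)))"
    using exists_real_char[OF \<Delta>(2), of "2 * Mn"] Mn by auto
  interpret real_char chi "2 * real q" q by (rule char)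
  have split_prime: "\<not> p dvd q \<and> p > 2 \<and> \<not> int p dvd \<Delta> \<and> QuadRes (int p) \<Delta>"
    if "prime p" "chi p = 1" for p
  proof -
    have pq: "\<not> p dvd q" "Legendre \<Delta> (int p) = 1" using chi[OF that(1)] that(2) by (auto split: if_splits)
    have "p \<noteq> 2" using pq(1) q by (auto dest: dvd_mult_left)
    with prime_ge_2_nat[OF that(1)] pq show ?thesis
      by (auto simp: Legendre_def cong_0_iff split: if_splits)
  qed
  have G: "n > 0 \<and> coprime n Mn \<and> (\<exists>s. int n dvd s\<^sup>2 - \<Delta>)" if n: "n \<in> {n. split n}" for n
  proof (intro conjI)
    have sp: "split n" using n by simp
    show n0: "n > 0" using split_pos[OF sp] .
    show "coprime n Mn"
    proof (rule ccontr)
      assume "\<not> coprime n Mn"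
      then obtain p where p: "prime p" "p dvd gcd n Mn"
        using prime_factor_nat[of "gcd n Mn"] gcd_eq_1_imp_coprime by blast
      hence "chi p = 1" using sp by (auto simp: split_def)
      moreover have "p dvd q" using p q by (meson dvd_mult dvd_trans gcd_dvd2)
      ultimately show False using split_prime p by blast
    qed
    show "\<exists>s. int n dvd s\<^sup>2 - \<Delta>"
      using sp split_prime by (intro square_mod n0) (auto simp: split_def)
  qed
  have "\<exists>C \<kappa>. \<forall>n\<in>{n. split n}. 0 < \<kappa> n \<and> \<kappa> n \<le> (C::nat) \<and>
     (\<exists>x y. int (\<kappa> n * n) = (1 + int Mn * x)\<^sup>2 - \<Delta> * (int Mn * y)\<^sup>2)"
    by (rule norm_multiplier[OF \<Delta>(2) Mn(1) G])
  then obtain C \<kappa> where \<kappa>: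
    "\<And>n. split n \<Longrightarrow> 0 < \<kappa> n \<and> \<kappa> n \<le> (C::nat) \<and>
     (\<exists>x y. int (\<kappa> n * n) = (1 + int Mn * x)\<^sup>2 - \<Delta> * (int Mn * y)\<^sup>2)" by blast
  \<comment> \<open>One fixed positive value Q x1 y1 is moved by \<open>form_scaling\<close> along
    the norms congruent to 1, so it joins \<kappa> n in the bounded multiplier.\<close>
  have mult: "0 < nat (Q x1 y1) * \<kappa> n \<and> nat (Q x1 y1) * \<kappa> n \<le> nat (Q x1 y1) * C \<and>
     represented F (int (nat (Q x1 y1) * \<kappa> n * n))" if n: "split n" for n
  proof (intro conjI)
    show "0 < nat (Q x1 y1) * \<kappa> n" "nat (Q x1 y1) * \<kappa> n \<le> nat (Q x1 y1) * C" using \<kappa>[OF n] F1 by auto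
    obtain x y where xy: "int (\<kappa> n * n) = (1 + int Mn * x)\<^sup>2 - \<Delta> * (int Mn * y)\<^sup>2" using \<kappa>[OF n] by blast
    \<comment> \<open>The norms were built with |M|, while \<open>form_scaling\<close> uses M
      itself, which may be negative; the sign passes to the coordinates.\<close>
    have sg: "M * (sgn M * z) = int Mn * z" for z unfolding Mn(2) by (simp add: abs_sgn)
    obtain x' y' where "Q x' y' = Q x1 y1 * ((1 + M * (sgn M * x))\<^sup>2 - \<Delta> * (M * (sgn M * y))\<^sup>2)"
      using form_scaling[OF \<Delta>(1) _ D M_def, of x1 y1 "sgn M * x" "sgn M * y"] a0 \<Delta>0 unfolding Q_def by auto
    also have "\<dots> = Q x1 y1 * int (\<kappa> n * n)" unfolding sg xy ..
    also have "\<dots> = int (nat (Q x1 y1) * \<kappa> n * n)" using F1 by simp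
    finally show "represented F (int (nat (Q x1 y1) * \<kappa> n * n))" unfolding rep by metis
  qed
  have nonzero: "r n \<noteq> 0" if n: "n > 0" "represented F (int n)" for n
  proof (rule r_nonzero_of_even[OF n(1)])
    fix p :: nat assume p: "prime p" "chi p = -1"
    have pq: "\<not> p dvd q" "Legendre \<Delta> (int p) = -1" using chi[OF p(1)] p(2) by (auto split: if_splits)
    have pp: "prime (int p)" using p by simp
    obtain x y where xy: "int n = Q x y" using n(2) unfolding rep by blast
    have "(\<Delta> * y - (2 * a * f - b * e))\<^sup>2 - \<Delta> * (2 * a * x + b * y + e)\<^sup>2 = - 4 * a * \<Delta> * int n"
      using form_norm_identity[OF \<Delta>(1), of y f e x g] D by (simp add: xy Q_def)
    moreover have "- 4 * a * \<Delta> * int n \<noteq> 0" using a0 \<Delta>0 n by simp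
    ultimately have ev: "even (multiplicity (int p) (- 4 * a * \<Delta> * int n))"
      by (rule even_multiplicity_norm[OF p(1) pq(2)])
    have "\<not> int p dvd - 4 * a * \<Delta>"
    proof
      assume "int p dvd - 4 * a * \<Delta>"
      also have "- 4 * a * \<Delta> = - (2 * M)" by (simp add: M_def)
      finally have "int p dvd \<bar>2 * M\<bar>" by (simp only: dvd_minus_iff dvd_abs_iff)
      also have "\<bar>2 * M\<bar> = int (2 * Mn)" using Mn(2) by (simp add: abs_mult)
      finally have "int p dvd int (2 * Mn)" .
      hence "p dvd 2 * Mn" by (simp only: of_nat_dvd_iff)
      thus False using pq(1) q dvd_trans by blast
    qed
    hence "multiplicity (int p) (- 4 * a * \<Delta> * int n) = multiplicity (int p) (int n)"
      using pp by (intro multiplicity_prime_elem_times_other) auto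
    also have "\<dots> = multiplicity p n" by (rule multiplicity_of_nat_int)
    finally show "even (multiplicity p n)" using ev by simp
  qed
  show "delta_F F \<in> \<Theta>(\<lambda>N. 1 / sqrt (ln N))"
    by (rule split_multiplier_bounds(1)[OF mult nonzero])
  show "psi_F F \<in> \<Theta>(\<lambda>N. N)"
    by (rule split_multiplier_bounds(2)[OF mult nonzero])
qed

theorem theorem1p3:
  fixes F :: "int bipoly" and a b c e f g \<Delta> D :: int
  assumes F: "F = of_int a * varX ^ 2 + of_int b * varX * varY + of_int c * varY ^ 2
                  + of_int e * varX + of_int f * varY + of_int g"
    and degree_2: "total_deg F = 2"
    and represents_large: "\<forall>M. \<exists>n. n > M \<and> represented F n"
    and indep: "lin_indep_rat (partial_x F) (partial_y F)"
    and \<Delta>: "\<Delta> = b ^ 2 - 4 * a * c"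
    and D: "D = a * f ^ 2 + c * e ^ 2 - b * f * e + \<Delta> * g"
  shows "(is_square \<Delta> \<longrightarrow>
            delta_F F \<in> \<Theta>(\<lambda>N. 1) \<and> psi_F F \<in> \<Theta>(\<lambda>N. N)) \<and>
         (\<not> is_square \<Delta> \<and> D = 0 \<longrightarrow>
            delta_F F \<in> \<Theta>(\<lambda>N. 1 / sqrt (ln N)) \<and> psi_F F \<in> \<Theta>(\<lambda>N. N))"
proof (intro conjI impI)
  assume "is_square \<Delta>"
  hence sq: "is_square (b ^ 2 - 4 * a * c)" by (simp only: \<Delta>)
  show "delta_F F \<in> \<Theta>(\<lambda>N. 1)" "psi_F F \<in> \<Theta>(\<lambda>N. N)"
    using square_discriminant_bounds[OF F indep sq] by auto
next
  assume *: "\<not> is_square \<Delta> \<and> D = 0"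
  have pos: "\<exists>n>0. represented F n" using represents_large by blast
  have D0: "a * f ^ 2 + c * e ^ 2 - b * f * e + \<Delta> * g = 0" using * D by simp
  show "delta_F F \<in> \<Theta>(\<lambda>N. 1 / sqrt (ln N))" "psi_F F \<in> \<Theta>(\<lambda>N. N)"
    using nonsquare_discriminant_bounds[OF F pos \<Delta> _ D0] * by auto
qed

end
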